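(* Let $n=2p$, $J_n=i\begin{pmatrix} I_p & 0 \\ 0 & -I_p \end{pmatrix}$, and let $Q=\begin{pmatrix} Q_{11} & Q_{12} \\ Q_{21} & Q_{22} \end{pmatrix}\in L^1_{\mathrm{loc}}(\mathbb{R},\mathbb{C}^{n\times n})$ with $p\times p$ blocks $Q_{kl}$. Let $j$ be the conjugation in $L^2(\mathbb{R},\mathbb{C}^n)$ given by $(jf)(t)=\begin{pmatrix} 0 & I_p \\ I_p & 0 \end{pmatrix}\overline{f(t)}$. If $$Q_{11}^\top(x)=Q_{22}(x),\quad Q_{12}^\top(x)=Q_{12}(x),\quad Q_{21}^\top(x)=Q_{21}(x)\quad\text{for a.e. }x\in\mathbb{R},\qquad( * )$$ then the operator $D_{\min}(Q)\,(=D_{\max}(Q))$ in $L^2(\mathbb{R},\mathbb{C}^n)$ is $j$-selfadjoint. Conversely, if $Q\in L^2_{\mathrm{loc}}(\mathbb{R},\mathbb{C}^{n\times n})$ and $D_{\min}(Q)$ is $j$-selfadjoint, then $( * )$ holds.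
   Context: For $D(Q)y=J_ny'+Q(x)y$ on $\mathbb{R}$, the maximal operator $D_{\max}(Q)$ in $L^2(\mathbb{R},\mathbb{C}^n)$ has domain $\{y\in L^2: y\in AC_{\mathrm{loc}}(\mathbb{R},\mathbb{C}^n),\ D(Q)y\in L^2\}$ and acts as $y\mapsto D(Q)y$; the minimal operator $D_{\min}(Q)$ is the closure of its restriction to the compactly supported $y\in\mathrm{dom}\,D_{\max}(Q)$. $C^\top$ is the transpose of $C$ and the bar denotes entrywise complex conjugation. A densely defined operator $A$ is $j$-selfadjoint (with respect to a conjugation $j$, i.e. an antilinear map with $j^2=I$ and $(ju,v)=(jv,u)$) if $A=jA^*j$. *)

theory Defs
  imports "HOL-Analysis.Analysis"
begin

section \<open>The Hilbert space of square-integrable functions on the line\<close>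

definition sq_integrable :: "(real \<Rightarrow> complex ^ 'n) \<Rightarrow> bool" where
  "sq_integrable f \<longleftrightarrow>
     f \<in> borel_measurable lebesgue \<and> integrable lebesgue (\<lambda>x. (norm (f x))\<^sup>2)"

definition cinner_vec :: "complex ^ 'n \<Rightarrow> complex ^ 'n \<Rightarrow> complex" where
  "cinner_vec u v = (\<Sum>k\<in>UNIV. u $ k * cnj (v $ k))"

lemma Re_cinner_vec: "Re (cinner_vec u v) = u \<bullet> v"
  by (simp add: cinner_vec_def inner_vec_def inner_complex_def)

lemma sq_integrable_measurable [measurable_dest]:
  "sq_integrable f \<Longrightarrow> f \<in> borel_measurable lebesgue"
  by (simp add: sq_integrable_def)

lemma sq_integrable_zero: "sq_integrable (\<lambda>x. 0)"
  by (simp add: sq_integrable_def)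

lemma sq_integrable_add:
  assumes "sq_integrable f" "sq_integrable g"
  shows "sq_integrable (\<lambda>x. f x + g x)"
proof -
  note [measurable] = assms[THEN sq_integrable_measurable]
  have "integrable lebesgue (\<lambda>x. (norm (f x + g x))\<^sup>2)"
  proof (rule Bochner_Integration.integrable_bound)
    show "integrable lebesgue (\<lambda>x. 2 * (norm (f x))\<^sup>2 + 2 * (norm (g x))\<^sup>2)"
      using assms by (simp add: sq_integrable_def)
    have "(norm (f x + g x))\<^sup>2 \<le> 2 * (norm (f x))\<^sup>2 + 2 * (norm (g x))\<^sup>2" for x
    proof -
      have "(norm (f x + g x))\<^sup>2 \<le> (norm (f x) + norm (g x))\<^sup>2"
        by (intro power_mono norm_triangle_ineq) auto
      also have "\<dots> \<le> 2 * (norm (f x))\<^sup>2 + 2 * (norm (g x))\<^sup>2"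
        using sum_squares_bound[of "norm (f x)" "norm (g x)"] by (simp add: power2_sum)
      finally show ?thesis .
    qed
    then show "AE x in lebesgue. norm ((norm (f x + g x))\<^sup>2)
        \<le> norm (2 * (norm (f x))\<^sup>2 + 2 * (norm (g x))\<^sup>2)"
      by (auto intro!: AE_I2 order_trans[OF _ abs_ge_self])
  qed measurable
  then show ?thesis by (simp add: sq_integrable_def)
qed

lemma sq_integrable_linear:
  fixes T :: "complex ^ 'n \<Rightarrow> complex ^ 'm"
  assumes "sq_integrable f" "linear T"
  shows "sq_integrable (\<lambda>x. T (f x))"
proof -
  note [measurable] = assms(1)[THEN sq_integrable_measurable]
  have T: "bounded_linear T" using assms(2) by (simp add: linear_conv_bounded_linear)
  obtain K where K: "\<And>x. norm (T x) \<le> norm x * K" and "K > 0"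
    using bounded_linear.pos_bounded[OF T] by blast
  have [measurable]: "T \<in> borel_measurable borel"
    by (rule borel_measurable_continuous_onI) (rule linear_continuous_on[OF T])
  have "integrable lebesgue (\<lambda>x. (norm (T (f x)))\<^sup>2)"
  proof (rule Bochner_Integration.integrable_bound)
    show "integrable lebesgue (\<lambda>x. (norm (f x))\<^sup>2 * K\<^sup>2)"
      using assms by (simp add: sq_integrable_def)
    show "AE x in lebesgue. norm ((norm (T (f x)))\<^sup>2) \<le> norm ((norm (f x))\<^sup>2 * K\<^sup>2)"
      by (auto intro!: AE_I2 power_mono K simp flip: power_mult_distrib)
  qed measurable
  then show ?thesis by (simp add: sq_integrable_def)
qed

lemma linear_vector_scalar_mult: "linear (\<lambda>v :: complex ^ 'n. c *s v)"
  by (intro linearI) (auto simp: vec_eq_iff algebra_simps scaleR_conv_of_real)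

lemma sq_integrable_inner:
  assumes "sq_integrable f" "sq_integrable g"
  shows "integrable lebesgue (\<lambda>x. f x \<bullet> g x)"
proof -
  note [measurable] = assms[THEN sq_integrable_measurable]
  show ?thesis
  proof (rule Bochner_Integration.integrable_bound)
    show "integrable lebesgue (\<lambda>x. (norm (f x))\<^sup>2 + (norm (g x))\<^sup>2)"
      using assms by (simp add: sq_integrable_def)
    have "\<bar>f x \<bullet> g x\<bar> \<le> (norm (f x))\<^sup>2 + (norm (g x))\<^sup>2" for x
      using Cauchy_Schwarz_ineq2[of "f x" "g x"] sum_squares_bound[of "norm (f x)" "norm (g x)"]
        mult_nonneg_nonneg[OF norm_ge_zero[of "f x"] norm_ge_zero[of "g x"]]
      by linarith
    then show "AE x in lebesgue. norm (f x \<bullet> g x) \<le> norm ((norm (f x))\<^sup>2 + (norm (g x))\<^sup>2)"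
      by (auto intro!: AE_I2)
  qed measurable
qed

quotient_type (overloaded) 'n L2 = "real \<Rightarrow> complex ^ 'n" / partial:
  "\<lambda>f g. sq_integrable f \<and> sq_integrable g \<and> (AE x in lebesgue. f x = g x)"
  morphisms rep_L2 abs_L2
proof (rule part_equivpI)
  show "\<exists>f :: real \<Rightarrow> complex ^ 'n.
      sq_integrable f \<and> sq_integrable f \<and> (AE x in lebesgue. f x = f x)"
    using sq_integrable_zero by fastforce
qed (auto simp: symp_def transp_def elim: eventually_mono eventually_elim2)

lift_definition cinner_L2 :: "'n::finite L2 \<Rightarrow> 'n L2 \<Rightarrow> complex"
  is "\<lambda>f g. integral\<^sup>L lebesgue (\<lambda>x. cinner_vec (f x) (g x))"
proof (rule integral_cong_AE; elim conjE)
  fix f g h k :: "real \<Rightarrow> complex ^ 'n"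
  assume "sq_integrable f" "sq_integrable g" "sq_integrable h" "sq_integrable k"
  note [measurable] = this[THEN sq_integrable_measurable]
  have [measurable]: "(\<lambda>x. F x $ i) \<in> borel_measurable lebesgue"
    if "F \<in> borel_measurable lebesgue" for F :: "real \<Rightarrow> complex ^ 'n" and i
    using measurable_comp[OF that borel_measurable_continuous_onI[of "\<lambda>v. v $ i"]]
    by (simp add: o_def continuous_intros)
  have [measurable]: "cnj \<in> borel_measurable borel"
    by (intro borel_measurable_continuous_onI continuous_intros)
  show "(\<lambda>x. cinner_vec (f x) (h x)) \<in> borel_measurable lebesgue"
    "(\<lambda>x. cinner_vec (g x) (k x)) \<in> borel_measurable lebesgue"
    unfolding cinner_vec_def by measurable
  assume "AE x in lebesgue. f x = g x" "AE x in lebesgue. h x = k x"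
  then show "AE x in lebesgue. cinner_vec (f x) (h x) = cinner_vec (g x) (k x)"
    by eventually_elim simp
qed

lift_definition cscale_L2 :: "complex \<Rightarrow> 'n::finite L2 \<Rightarrow> 'n L2"
  is "\<lambda>c f x. c *s f x"
  by (auto intro: sq_integrable_linear[OF _ linear_vector_scalar_mult] elim: eventually_mono)

text \<open>The real inner product below is the real part of the complex one, so it induces the
  usual norm and topology.\<close>

instantiation L2 :: (finite) real_inner
begin

lift_definition zero_L2 :: "'a L2" is "\<lambda>x. 0"
  by (simp add: sq_integrable_zero)

lift_definition plus_L2 :: "'a L2 \<Rightarrow> 'a L2 \<Rightarrow> 'a L2" is "\<lambda>f g x. f x + g x"
  by (auto intro: sq_integrable_add elim: eventually_elim2)

lift_definition scaleR_L2 :: "real \<Rightarrow> 'a L2 \<Rightarrow> 'a L2" is "\<lambda>r f x. r *\<^sub>R f x"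
  by (auto intro: sq_integrable_linear[OF _ linear_scaleR] elim: eventually_mono)

definition uminus_L2 :: "'a L2 \<Rightarrow> 'a L2" where "uminus f = (-1) *\<^sub>R (f :: 'a L2)"

definition minus_L2 :: "'a L2 \<Rightarrow> 'a L2 \<Rightarrow> 'a L2" where "f - g = f + - (g :: 'a L2)"

lift_definition inner_L2 :: "'a L2 \<Rightarrow> 'a L2 \<Rightarrow> real"
  is "\<lambda>f g. integral\<^sup>L lebesgue (\<lambda>x. f x \<bullet> g x)"
proof (rule integral_cong_AE; elim conjE)
  fix f g h k :: "real \<Rightarrow> complex ^ 'a"
  assume "sq_integrable f" "sq_integrable g" "sq_integrable h" "sq_integrable k"
  note [measurable] = this[THEN sq_integrable_measurable]
  show "(\<lambda>x. f x \<bullet> h x) \<in> borel_measurable lebesgue"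
    "(\<lambda>x. g x \<bullet> k x) \<in> borel_measurable lebesgue"
    by measurable
  assume "AE x in lebesgue. f x = g x" "AE x in lebesgue. h x = k x"
  then show "AE x in lebesgue. f x \<bullet> h x = g x \<bullet> k x"
    by eventually_elim simp
qed

definition norm_L2 :: "'a L2 \<Rightarrow> real" where "norm f = sqrt (f \<bullet> (f :: 'a L2))"

definition sgn_L2 :: "'a L2 \<Rightarrow> 'a L2" where "sgn f = inverse (norm f) *\<^sub>R (f :: 'a L2)"

definition dist_L2 :: "'a L2 \<Rightarrow> 'a L2 \<Rightarrow> real" where "dist f g = norm (f - g :: 'a L2)"

definition uniformity_L2 :: "('a L2 \<times> 'a L2) filter" where
  "uniformity = (INF e\<in>{0 <..}. principal {(f, g). dist f (g :: 'a L2) < e})"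

definition open_L2 :: "'a L2 set \<Rightarrow> bool" where
  "open U \<longleftrightarrow> (\<forall>f\<in>U. \<forall>\<^sub>F (f', g) in uniformity. f' = f \<longrightarrow> g \<in> (U :: 'a L2 set))"

instance
proof
  fix f g h :: "'a L2" and r s :: real and U :: "'a L2 set"
  show "f + g + h = f + (g + h)" by transfer (auto intro!: sq_integrable_add simp: add.assoc)
  show "f + g = g + f" by transfer (auto intro!: sq_integrable_add simp: add.commute)
  show "0 + f = f" by transfer (auto intro!: sq_integrable_add)
  show "- f + f = 0" unfolding uminus_L2_def
    by transfer (auto intro!: sq_integrable_add sq_integrable_zero
        dest: sq_integrable_linear[OF _ linear_scaleR[of "-1"]])
  show "f - g = f + - g" by (simp add: minus_L2_def)
  show "r *\<^sub>R (f + g) = r *\<^sub>R f + r *\<^sub>R g"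
    by transfer (auto intro!: sq_integrable_add sq_integrable_linear[OF _ linear_scaleR]
        simp: scaleR_add_right)
  show "(r + s) *\<^sub>R f = r *\<^sub>R f + s *\<^sub>R f"
    by transfer (auto intro!: sq_integrable_add sq_integrable_linear[OF _ linear_scaleR]
        simp: scaleR_add_left)
  show "r *\<^sub>R s *\<^sub>R f = (r * s) *\<^sub>R f"
    by transfer (auto dest: sq_integrable_linear[OF _ linear_scaleR])
  show "1 *\<^sub>R f = f" by transfer auto
  show "dist f g = norm (f - g)" by (simp add: dist_L2_def)
  show "sgn f = inverse (norm f) *\<^sub>R f" by (simp add: sgn_L2_def)
  show "(uniformity :: ('a L2 \<times> 'a L2) filter)
      = (INF e\<in>{0 <..}. principal {(f, g). dist f g < e})"
    by (simp add: uniformity_L2_def)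
  show "open U \<longleftrightarrow> (\<forall>f\<in>U. \<forall>\<^sub>F (f', g) in uniformity. f' = f \<longrightarrow> g \<in> U)"
    by (simp add: open_L2_def)
  show "f \<bullet> g = g \<bullet> f" by transfer (simp add: inner_commute)
  show "(f + g) \<bullet> h = f \<bullet> h + g \<bullet> h"
    by transfer (simp add: inner_add_left sq_integrable_inner)
  show "r *\<^sub>R f \<bullet> g = r * (f \<bullet> g)" by transfer simp
  show "0 \<le> f \<bullet> f" by transfer simp
  show "f \<bullet> f = 0 \<longleftrightarrow> f = 0"
    by transfer (simp add: integral_nonneg_eq_0_iff_AE sq_integrable_inner sq_integrable_zero)
  show "norm f = sqrt (f \<bullet> f)" by (simp add: norm_L2_def)
qed

end


section \<open>Operators as graphs, adjoints, conjugations\<close>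

definition is_operator :: "('n::finite L2 \<times> 'n L2) set \<Rightarrow> bool" where
  "is_operator A \<longleftrightarrow> single_valued A \<and> (0, 0) \<in> A \<and>
     (\<forall>(u, u')\<in>A. \<forall>(v, v')\<in>A. (u + v, u' + v') \<in> A) \<and>
     (\<forall>c. \<forall>(u, u')\<in>A. (cscale_L2 c u, cscale_L2 c u') \<in> A)"

definition densely_defined :: "('n::finite L2 \<times> 'n L2) set \<Rightarrow> bool" where
  "densely_defined A \<longleftrightarrow> closure (Domain A) = UNIV"

definition op_adjoint :: "('n::finite L2 \<times> 'n L2) set \<Rightarrow> ('n L2 \<times> 'n L2) set" where
  "op_adjoint A = {(v, w). \<forall>(u, u')\<in>A. cinner_L2 u' v = cinner_L2 u w}"

definition is_conjugation :: "('n::finite L2 \<Rightarrow> 'n L2) \<Rightarrow> bool" where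
  "is_conjugation j \<longleftrightarrow>
     (\<forall>u v. j (u + v) = j u + j v) \<and>
     (\<forall>c u. j (cscale_L2 c u) = cscale_L2 (cnj c) (j u)) \<and>
     (\<forall>u. j (j u) = u) \<and>
     (\<forall>u v. cinner_L2 (j u) v = cinner_L2 (j v) u)"

definition j_selfadjoint ::
    "('n::finite L2 \<Rightarrow> 'n L2) \<Rightarrow> ('n L2 \<times> 'n L2) set \<Rightarrow> bool" where
  "j_selfadjoint j A \<longleftrightarrow>
     is_conjugation j \<and> is_operator A \<and> densely_defined A \<and>
     A = {(u, j v) | u v. (j u, v) \<in> op_adjoint A}"


section \<open>Local function classes\<close>

definition AC_on :: "real set \<Rightarrow> (real \<Rightarrow> 'a::real_normed_vector) \<Rightarrow> bool" where
  "AC_on S f \<longleftrightarrow> (\<forall>\<epsilon>>0. \<exists>\<delta>>0. \<forall>d.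
     d division_of \<Union>d \<and> \<Union>d \<subseteq> S \<and> (\<Sum>k\<in>d. Sup k - Inf k) < \<delta> \<longrightarrow>
     (\<Sum>k\<in>d. norm (f (Sup k) - f (Inf k))) < \<epsilon>)"

definition AC_loc :: "(real \<Rightarrow> 'a::real_normed_vector) \<Rightarrow> bool" where
  "AC_loc f \<longleftrightarrow> (\<forall>a b. AC_on {a..b} f)"

definition L1_loc :: "(real \<Rightarrow> 'a::euclidean_space) \<Rightarrow> bool" where
  "L1_loc f \<longleftrightarrow> (\<forall>a b. set_integrable lebesgue {a..b} f)"

definition L2_loc :: "(real \<Rightarrow> 'a::euclidean_space) \<Rightarrow> bool" where
  "L2_loc f \<longleftrightarrow> f \<in> borel_measurable lebesgue \<and>
     (\<forall>a b. set_integrable lebesgue {a..b} (\<lambda>x. (norm (f x))\<^sup>2))"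


section \<open>Dirac type operators\<close>

text \<open>With \<open>n = 2 p\<close>, vectors of length \<open>n\<close> are indexed by \<open>'p + 'p\<close>, where \<open>p\<close> is the
  cardinality of \<open>'p\<close>; the summands \<open>Inl\<close> and \<open>Inr\<close> are the first and the second block.\<close>

definition block_mat ::
    "'a ^ 'p ^ 'p \<Rightarrow> 'a ^ 'p ^ 'p \<Rightarrow> 'a ^ 'p ^ 'p \<Rightarrow> 'a ^ 'p ^ 'p \<Rightarrow> 'a ^ ('p + 'p) ^ ('p + 'p)"
  where
  "block_mat A B C D = (\<chi> k l. case (k, l) of
       (Inl a, Inl b) \<Rightarrow> A $ a $ b
     | (Inl a, Inr b) \<Rightarrow> B $ a $ b
     | (Inr a, Inl b) \<Rightarrow> C $ a $ b
     | (Inr a, Inr b) \<Rightarrow> D $ a $ b)"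

definition J_mat :: "complex ^ ('p::finite + 'p) ^ ('p + 'p)" where
  "J_mat = block_mat (mat \<i>) 0 0 (mat (- \<i>))"

definition swap_mat :: "complex ^ ('p::finite + 'p) ^ ('p + 'p)" where
  "swap_mat = block_mat 0 (mat 1) (mat 1) 0"

lemma linear_swap_cnj:
  "linear (\<lambda>v :: complex ^ ('p::finite + 'p). swap_mat *v (\<chi> k. cnj (v $ k)))"
proof -
  have "linear (\<lambda>v :: complex ^ ('p + 'p). \<chi> k. cnj (v $ k))"
    by (intro linearI) (auto simp: vec_eq_iff)
  from linear_compose[OF this, of "(*v) swap_mat"] show ?thesis
    by (simp add: o_def)
qed

lift_definition swap_conj :: "('p::finite + 'p) L2 \<Rightarrow> ('p + 'p) L2"
  is "\<lambda>f t. swap_mat *v (\<chi> k. cnj (f t $ k))"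
  by (auto intro: sq_integrable_linear[OF _ linear_swap_cnj] elim: eventually_mono)

text \<open>\<open>dirac_rep Q y z\<close>: \<open>y\<close> is a locally absolutely continuous representative of an element of
  the domain of the maximal operator and \<open>z = D(Q) y\<close> almost everywhere. The existence of the
  derivative almost everywhere is not an additional restriction, as it follows from \<open>AC_loc y\<close>.\<close>

definition dirac_rep :: "(real \<Rightarrow> complex ^ ('p::finite + 'p) ^ ('p + 'p)) \<Rightarrow>
    (real \<Rightarrow> complex ^ ('p + 'p)) \<Rightarrow> (real \<Rightarrow> complex ^ ('p + 'p)) \<Rightarrow> bool" where
  "dirac_rep Q y z \<longleftrightarrow> sq_integrable y \<and> AC_loc y \<and> sq_integrable z \<and>
     (AE x in lebesgue. \<exists>y'. (y has_vector_derivative y') (at x) \<and>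
        z x = J_mat *v y' + Q x *v y x)"

definition D_max :: "(real \<Rightarrow> complex ^ ('p::finite + 'p) ^ ('p + 'p)) \<Rightarrow>
    (('p + 'p) L2 \<times> ('p + 'p) L2) set" where
  "D_max Q = {(abs_L2 y, abs_L2 z) | y z. dirac_rep Q y z}"

definition D_min :: "(real \<Rightarrow> complex ^ ('p::finite + 'p) ^ ('p + 'p)) \<Rightarrow>
    (('p + 'p) L2 \<times> ('p + 'p) L2) set" where
  "D_min Q = closure {(abs_L2 y, abs_L2 z) | y z.
     dirac_rep Q y z \<and> compact (closure {x. y x \<noteq> 0})}"

end

theory Submission
  imports Defs
begin

text \<open>Whatever the symmetry of a locally integrable \<open>Q\<close>, the minimal and the maximal operator coincide,
and their adjoint is the maximal operator of the pointwise adjoint matrix \<open>Q*\<close>. Once this is known,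
the theorem is algebra. Conjugating with \<open>j\<close> gives \<open>j D_max(Q*) j = D_max(S Q^T S)\<close>, where \<open>S\<close> swaps
the two blocks, because \<open>j\<close> is antilinear and commutes with \<open>J\<close>. Hence \<open>D_min(Q)\<close> is
\<open>j\<close>-selfadjoint if and only if \<open>D_max(Q) = D_max(S Q^T S)\<close> (\<open>j_selfadjoint_D_min_iff\<close>), and the
block condition of the theorem says precisely that \<open>Q = S Q^T S\<close> almost everywhere. Conversely, if
\<open>Q\<close> is locally square-integrable, then a smooth cutoff times a constant vector belongs to the domain;
applying two operators with equal graphs to these functions shows that the potentials agree
(\<open>D_max_subset_imp_eq_AE\<close>).

That \<open>D_max(Q) = D_min(Q)\<close> relies on the order of the system being one. For a scalar cutoff \<open>\<phi>\<close> we
have \<open>D(Q)(\<phi> y) = \<phi> D(Q) y + \<phi>' J y\<close>, where \<open>y\<close> is not differentiated on the right; so cutoffs that flatten out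
approximate every element of the maximal domain in the graph norm (\<open>D_max_subset_D_min\<close>). The
opposite inclusion holds because \<open>D_max(Q)\<close> is closed, being an adjoint.

The adjoint is the hard part (\<open>op_adjoint_D_cpt\<close>). Since \<open>Q\<close> is merely locally integrable, smooth
functions need not lie in the domain. They are replaced by \<open>Y \<eta>\<close>, where \<open>Y\<close> is a fundamental matrix,
\<open>J Y' + Q Y = 0\<close>, and \<open>\<eta>\<close> is a Lipschitz vector function of compact support: then
\<open>D(Q)(Y \<eta>) = J Y \<eta>'\<close>, and \<open>Q\<close> has disappeared. Tested against these functions, the relation
\<open>(D(Q) y, v) = (y, w)\<close> becomes \<open>\<integral> (\<eta>', g) = \<integral> (\<eta>, h)\<close> with \<open>g = - Y* J v\<close> and \<open>h = Y* w\<close>, so the lemma of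
du Bois-Reymond makes \<open>g\<close> a constant minus a primitive of \<open>h\<close>. The fundamental matrix \<open>Z\<close> of the
adjoint system satisfies \<open>Z J Y* = J\<close>, whence \<open>v = Z J g\<close>; this exhibits \<open>v\<close> as locally absolutely
continuous and as a solution of \<open>D(Q*) v = w\<close>. The functions \<open>Y \<eta>\<close> also show that the domain is
dense, since \<open>Y\<close> is invertible.

The real analysis behind this is the equivalence of two descriptions of a pair \<open>F\<close>, \<open>f\<close>: the function
\<open>F\<close> is locally absolutely continuous with derivative \<open>f\<close> almost everywhere, or \<open>F\<close> is an indefinite
integral of \<open>f\<close>. One direction is Lebesgue's differentiation theorem, the other the fundamental
theorem of calculus for absolutely continuous functions; both are proved with the gauge integral.
The fundamental matrices come from a fixed point argument in a weighted supremum norm.\<close>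

section \<open>Lebesgue's differentiation theorem on the line\<close>

text \<open>The intervals on which the mean value of \<open>f\<close> is far from its value at an end point form a Vitali cover
of the exceptional set, even if only intervals fine for a given gauge are admitted. A disjoint
subfamily exhausts the set up to measure zero, and Henstock's lemma bounds its total length by an
arbitrarily small number.\<close>

lemma negligible_not_differentiable_indefinite_integral:
  fixes f :: "real \<Rightarrow> 'a::euclidean_space"
  assumes f: "f integrable_on {a..b}" and "\<epsilon> > 0"
  shows "negligible {x \<in> {a<..<b}. \<forall>d>0. \<exists>u v. a \<le> u \<and> u < v \<and> v \<le> b \<and> (x = u \<or> x = v) \<and> v - u < d \<and>
            \<epsilon> * (v - u) < norm ((v - u) *\<^sub>R f x - integral {u..v} f)}" (is "negligible ?E")
  unfolding negligible_outer_le
proof (intro allI impI)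
  fix e :: real assume "e > 0"
  obtain \<gamma> where "gauge \<gamma>" and \<gamma>: "\<And>p. \<lbrakk>p tagged_partial_division_of (cbox a b); \<gamma> fine p\<rbrakk> \<Longrightarrow>
             sum (\<lambda>(x,k). norm (measure lborel k *\<^sub>R f x - integral k f)) p < \<epsilon> * e"
    using Henstock_lemma[of f a b "\<epsilon> * e"] f \<open>e > 0\<close> \<open>\<epsilon> > 0\<close> by auto
  define K where "K = {(x, u, v). x \<in> ?E \<and> a \<le> u \<and> u < v \<and> v \<le> b \<and> (x = u \<or> x = v) \<and> {u..v} \<subseteq> \<gamma> x \<and>
            \<epsilon> * (v - u) < norm ((v - u) *\<^sub>R f x - integral {u..v} f)}"
  define c where "c = (\<lambda>(x::real, u::real, v::real). (u + v) / 2)"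
  define r where "r = (\<lambda>(x::real, u::real, v::real). (v - u) / 2)"
  have cb: "cball (c i) (r i) = {fst (snd i)..snd (snd i)}" for i
    by (cases i) (auto simp: c_def r_def cball_eq_atLeastAtMost field_simps)
  obtain C where C: "countable C" "C \<subseteq> K"
     "pairwise (\<lambda>i j. disjnt (cball (c i) (r i)) (cball (c j) (r j))) C"
     "negligible (?E - (\<Union>i \<in> C. cball (c i) (r i)))"
  proof (rule Vitali_covering_theorem_cballs[of K r ?E c])
    show "0 < r i" if "i \<in> K" for i using that by (auto simp: K_def r_def)
    fix x d :: real assume x: "x \<in> ?E" and d: "0 < d"
    have "open (\<gamma> x)" "x \<in> \<gamma> x" using \<open>gauge \<gamma>\<close> by (auto simp: gauge_def)
    then obtain d' where d': "d' > 0" "ball x d' \<subseteq> \<gamma> x" by (meson openE)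
    have "min d d' > 0" using d d' by simp
    then obtain u v where uv: "a \<le> u" "u < v" "v \<le> b" "x = u \<or> x = v" "v - u < min d d'"
      "\<epsilon> * (v - u) < norm ((v - u) *\<^sub>R f x - integral {u..v} f)"
      using x by blast
    have "{u..v} \<subseteq> ball x d'" using uv by (auto simp: dist_real_def)
    then have "(x, u, v) \<in> K" using uv x d' unfolding K_def by blast
    moreover have "x \<in> cball (c (x, u, v)) (r (x, u, v))" unfolding cb using uv by auto
    moreover have "r (x, u, v) < d" using uv by (auto simp: r_def)
    ultimately show "\<exists>i. i \<in> K \<and> x \<in> cball (c i) (r i) \<and> r i < d" by blast
  qed
  have fin: "measure lebesgue (\<Union>i\<in>D. cball (c i) (r i)) \<le> e" if D: "D \<subseteq> C" "finite D" for D
  proof -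
    define g where "g = (\<lambda>(x::real, u::real, v::real). (x, {u..v}))"
    have DK: "D \<subseteq> K" using D C by auto
    have inj: "inj_on g D"
    proof (rule inj_onI)
      fix i j assume "i \<in> D" "j \<in> D" "g i = g j"
      then show "i = j" using DK
        by (cases i, cases j) (auto simp: g_def K_def Icc_eq_Icc)
    qed
    have "measure lebesgue (\<Union>i\<in>D. cball (c i) (r i)) \<le> (\<Sum>i\<in>D. measure lebesgue (cball (c i) (r i)))"
      using D by (intro measure_UNION_le) auto
    also have "\<dots> \<le> (\<Sum>i\<in>D. (1/\<epsilon>) * (\<lambda>(x,k). norm (measure lborel k *\<^sub>R f x - integral k f)) (g i))"
    proof (rule sum_mono)
      fix i assume "i \<in> D"
      then have "i \<in> K" using DK by auto
      then show "measure lebesgue (cball (c i) (r i)) \<le> (1/\<epsilon>) * (\<lambda>(x,k). norm (measure lborel k *\<^sub>R f x - integral k f)) (g i)"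
        using \<open>\<epsilon> > 0\<close> unfolding cb by (cases i) (auto simp: K_def g_def field_simps)
    qed
    also have "\<dots> = (1/\<epsilon>) * (\<Sum>p\<in>g ` D. (\<lambda>(x,k). norm (measure lborel k *\<^sub>R f x - integral k f)) p)"
      by (simp only: sum_distrib_left[symmetric] sum.reindex[OF inj] o_def)
    also have "\<dots> \<le> (1/\<epsilon>) * (\<epsilon> * e)"
    proof (intro mult_left_mono less_imp_le[OF \<gamma>])
      show "0 \<le> 1 / \<epsilon>" using \<open>\<epsilon> > 0\<close> by simp
      show "g ` D tagged_partial_division_of cbox a b"
        unfolding tagged_partial_division_of_def
      proof (intro conjI allI impI)
        show "finite (g ` D)" using D by auto
        fix x k assume "(x, k) \<in> g ` D"
        then obtain u v where uv: "(x,u,v) \<in> D" "k = {u..v}" by (auto simp: g_def)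
        then have "(x,u,v) \<in> K" using DK by auto
        then show "x \<in> k" "k \<subseteq> cbox a b" "\<exists>a b. k = cbox a b"
          using uv by (auto simp: K_def box_real[symmetric] simp del: box_real)
      next
        fix x k x2 k2 assume A: "(x, k) \<in> g ` D \<and> (x2, k2) \<in> g ` D \<and> (x, k) \<noteq> (x2, k2)"
        then obtain u v where uv: "(x,u,v) \<in> D" "k = {u..v}" by (auto simp: g_def)
        from A obtain u2 v2 where uv2: "(x2,u2,v2) \<in> D" "k2 = {u2..v2}" by (auto simp: g_def)
        then have "(x,u,v) \<noteq> (x2,u2,v2)" using A uv by auto
        then have "disjnt {u..v} {u2..v2}"
          using pairwiseD[OF C(3), of "(x,u,v)" "(x2,u2,v2)"] uv(1) uv2(1) D(1)
          unfolding cb by (metis fst_conv snd_conv subsetD)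
        then show "interior k \<inter> interior k2 = {}"
          using uv uv2 interior_subset unfolding disjnt_def by blast
      qed
      show "\<gamma> fine g ` D" using DK unfolding fine_def by (auto simp: g_def K_def)
    qed
    finally show ?thesis using \<open>\<epsilon> > 0\<close> by simp
  qed
  let ?U = "\<Union>i\<in>C. cball (c i) (r i)"
  have U: "?U \<in> lmeasurable" "measure lebesgue ?U \<le> e"
    using fmeasurable_UN_bound[OF C(1) _ fin] measure_UN_bound[OF C(1) _ fin] \<open>e > 0\<close>
    by (auto simp: lmeasurable_cball)
  have N: "?E - ?U \<in> lmeasurable" "measure lebesgue (?E - ?U) = 0"
    using C(4) by (auto simp: negligible_imp_measurable negligible_imp_measure0)
  have "measure lebesgue ((?E - ?U) \<union> ?U) \<le> 0 + e"
    using measure_Un_le[of "?E - ?U" lebesgue ?U] N U by auto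
  moreover have "(?E - ?U) \<union> ?U \<in> lmeasurable" using N(1) U(1) by (rule fmeasurable.Un)
  moreover have "?E \<subseteq> (?E - ?U) \<union> ?U" by blast
  ultimately show "\<exists>T. ?E \<subseteq> T \<and> T \<in> lmeasurable \<and> measure lebesgue T \<le> e"
    by (metis (no_types, lifting) add_0)
qed

lemma indefinite_integral_differentiable_ae:
  fixes f :: "real \<Rightarrow> 'a::euclidean_space"
  assumes f: "f integrable_on {a..b}"
  shows "AE x in lebesgue. x \<in> {a<..<b} \<longrightarrow> ((\<lambda>y. integral {a..y} f) has_vector_derivative f x) (at x)"
proof -
  let ?E = "\<lambda>\<epsilon>. {x \<in> {a<..<b}. \<forall>d>0. \<exists>u v. a \<le> u \<and> u < v \<and> v \<le> b \<and> (x = u \<or> x = v) \<and> v - u < d \<and>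
            \<epsilon> * (v - u) < norm ((v - u) *\<^sub>R f x - integral {u..v} f)}"
  have "negligible (?E (inverse (real (Suc n))))" for n
    by (rule negligible_not_differentiable_indefinite_integral[OF f]) simp
  then have "negligible (\<Union>n. ?E (inverse (real (Suc n))))" by (intro negligible_countable_Union) auto
  then have "AE x in lebesgue. x \<notin> (\<Union>n. ?E (inverse (real (Suc n))))"
    by (intro AE_not_in) (simp only: negligible_iff_null_sets)
  then show ?thesis
  proof (rule eventually_mono, intro impI)
    fix x assume "x \<notin> (\<Union>n. ?E (inverse (real (Suc n))))" and x: "x \<in> {a<..<b}"
    then have nE: "x \<notin> ?E (inverse (real (Suc n)))" for n by blast
    show "((\<lambda>y. integral {a..y} f) has_vector_derivative f x) (at x)"
      unfolding has_vector_derivative_def has_derivative_at_alt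
    proof (intro conjI allI impI)
      show "bounded_linear (\<lambda>h. h *\<^sub>R f x)" by (rule bounded_linear_scaleR_left)
      fix e :: real assume "e > 0"
      then obtain n where n: "inverse (real (Suc n)) < e" using reals_Archimedean by blast
      obtain d where d: "d > 0" and P: "\<And>u v. \<lbrakk>a \<le> u; u < v; v \<le> b; x = u \<or> x = v; v - u < d\<rbrakk> \<Longrightarrow>
         norm ((v - u) *\<^sub>R f x - integral {u..v} f) \<le> inverse (real (Suc n)) * (v - u)"
      proof -
        have "\<not> (\<forall>d>0. \<exists>u v. a \<le> u \<and> u < v \<and> v \<le> b \<and> (x = u \<or> x = v) \<and> v - u < d \<and>
            inverse (real (Suc n)) * (v - u) < norm ((v - u) *\<^sub>R f x - integral {u..v} f))"
          using nE[of n] x by blast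
        then show ?thesis using that by (meson not_less)
      qed
      have P': "norm ((v - u) *\<^sub>R f x - integral {u..v} f) \<le> e * (v - u)"
        if "a \<le> u" "u < v" "v \<le> b" "x = u \<or> x = v" "v - u < d" for u v
        using P[OF that] n that mult_right_mono[of "inverse (real (Suc n))" e "v - u"] by linarith
      have *: "integral {a..u} f + integral {u..v} f = integral {a..v} f" if "a \<le> u" "u \<le> v" "v \<le> b" for u v
        using that by (intro Henstock_Kurzweil_Integration.integral_combine integrable_subinterval_real[OF f]) auto
      show "\<exists>d>0. \<forall>y. norm (y - x) < d \<longrightarrow>
            norm (integral {a..y} f - integral {a..x} f - (y - x) *\<^sub>R f x) \<le> e * norm (y - x)"
      proof (intro exI[of _ "Min {d, x - a, b - x}"] conjI allI impI)
        show "Min {d, x - a, b - x} > 0" using d x by simp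
        fix y assume "norm (y - x) < Min {d, x - a, b - x}"
        then have y: "\<bar>y - x\<bar> < d" "a < y" "y < b" by auto
        consider "y = x" | "x < y" | "y < x" by linarith
        then show "norm (integral {a..y} f - integral {a..x} f - (y - x) *\<^sub>R f x) \<le> e * norm (y - x)"
        proof cases
          case 2
          have "integral {a..y} f - integral {a..x} f - (y - x) *\<^sub>R f x = - ((y - x) *\<^sub>R f x - integral {x..y} f)"
            using *[of x y] 2 x y by (simp add: algebra_simps)
          then show ?thesis using P'[of x y] 2 x y by (simp only: norm_minus_cancel) auto
        next
          case 3
          have "integral {a..y} f - integral {a..x} f - (y - x) *\<^sub>R f x = (x - y) *\<^sub>R f x - integral {y..x} f"
            using *[of y x] 3 x y by (simp add: algebra_simps)
          then show ?thesis using P'[of y x] 3 x y by auto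
        qed simp
      qed
    qed
  qed
qed


section \<open>Absolutely continuous functions\<close>

lemma division_of_real_intervalE:
  fixes K :: "real set"
  assumes "d division_of S" "K \<in> d"
  obtains u v where "u \<le> v" "K = {u..v}" "Sup K = v" "Inf K = u" "{u..v} \<subseteq> S"
proof -
  obtain u v where K: "K = cbox u v" "K \<noteq> {}" "K \<subseteq> S"
    using division_ofD[OF assms(1)] assms(2) by metis
  then have "u \<le> v" by auto
  with K show ?thesis by (intro that[of u v]) auto
qed

lemma AC_on_imp_continuous_on:
  fixes f :: "real \<Rightarrow> 'a::real_normed_vector"
  assumes "AC_on {a..b} f"
  shows "continuous_on {a..b} f"
proof -
  have "uniformly_continuous_on {a..b} f"
    unfolding uniformly_continuous_on_def
  proof (intro allI impI)
    fix e :: real assume "e > 0"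
    then obtain \<delta> where "\<delta> > 0" and \<delta>: "\<And>d. \<lbrakk>d division_of \<Union>d; \<Union>d \<subseteq> {a..b}; (\<Sum>k\<in>d. Sup k - Inf k) < \<delta>\<rbrakk>
        \<Longrightarrow> (\<Sum>k\<in>d. norm (f (Sup k) - f (Inf k))) < e"
      using assms unfolding AC_on_def by meson
    have *: "norm (f y - f x) < e" if "x \<in> {a..b}" "y \<in> {a..b}" "x \<le> y" "y - x < \<delta>" for x y
      using \<delta>[of "{{x..y}}"] division_of_self[of x y] that by (simp add: subset_iff)
    show "\<exists>d>0. \<forall>x\<in>{a..b}. \<forall>x'\<in>{a..b}. dist x' x < d \<longrightarrow> dist (f x') (f x) < e"
    proof (intro exI[of _ \<delta>] conjI ballI impI)
      fix x x' assume "x \<in> {a..b}" "x' \<in> {a..b}" "dist x' x < \<delta>"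
      then show "dist (f x') (f x) < e"
        using *[of x x'] *[of x' x] by (cases "x \<le> x'") (auto simp: dist_norm norm_minus_commute)
    qed fact
  qed
  then show ?thesis by (rule uniformly_continuous_imp_continuous)
qed

text \<open>Two dominating functions are allowed because the increments of a product are controlled by those of
both factors.\<close>

lemma AC_on_dominated:
  fixes f :: "real \<Rightarrow> 'a::real_normed_vector" and g :: "real \<Rightarrow> 'b::real_normed_vector"
    and h :: "real \<Rightarrow> 'c::real_normed_vector"
  assumes g: "AC_on {a..b} g" and h: "AC_on {a..b} h" and C: "C > 0"
    and le: "\<And>x y. \<lbrakk>a \<le> x; x \<le> y; y \<le> b\<rbrakk> \<Longrightarrow> norm (f y - f x) \<le> C * (norm (g y - g x) + norm (h y - h x))"
  shows "AC_on {a..b} f"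
  unfolding AC_on_def
proof (intro allI impI)
  fix e :: real assume "e > 0"
  then have "e / (2 * C) > 0" using C by simp
  with g obtain \<delta>1 where "\<delta>1 > 0" and \<delta>1: "\<And>d. \<lbrakk>d division_of \<Union>d; \<Union>d \<subseteq> {a..b}; (\<Sum>k\<in>d. Sup k - Inf k) < \<delta>1\<rbrakk>
        \<Longrightarrow> (\<Sum>k\<in>d. norm (g (Sup k) - g (Inf k))) < e / (2 * C)"
    unfolding AC_on_def by meson
  from h \<open>e / (2 * C) > 0\<close> obtain \<delta>2 where "\<delta>2 > 0" and \<delta>2: "\<And>d. \<lbrakk>d division_of \<Union>d; \<Union>d \<subseteq> {a..b}; (\<Sum>k\<in>d. Sup k - Inf k) < \<delta>2\<rbrakk>
        \<Longrightarrow> (\<Sum>k\<in>d. norm (h (Sup k) - h (Inf k))) < e / (2 * C)"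
    unfolding AC_on_def by meson
  show "\<exists>\<delta>>0. \<forall>d. d division_of \<Union>d \<and> \<Union>d \<subseteq> {a..b} \<and> (\<Sum>k\<in>d. Sup k - Inf k) < \<delta> \<longrightarrow>
     (\<Sum>k\<in>d. norm (f (Sup k) - f (Inf k))) < e"
  proof (intro exI[of _ "min \<delta>1 \<delta>2"] conjI allI impI)
    fix d :: "real set set"
    assume d: "d division_of \<Union>d \<and> \<Union>d \<subseteq> {a..b} \<and> (\<Sum>k\<in>d. Sup k - Inf k) < min \<delta>1 \<delta>2"
    then have dd: "d division_of \<Union>d" by simp
    have "(\<Sum>k\<in>d. norm (f (Sup k) - f (Inf k)))
      \<le> (\<Sum>k\<in>d. C * (norm (g (Sup k) - g (Inf k)) + norm (h (Sup k) - h (Inf k))))"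
    proof (rule sum_mono)
      fix k assume "k \<in> d"
      from division_of_real_intervalE[OF dd this] d
      obtain u v where "u \<le> v" "Sup k = v" "Inf k = u" "{u..v} \<subseteq> {a..b}"
        by (metis subset_trans)
      then show "norm (f (Sup k) - f (Inf k)) \<le> C * (norm (g (Sup k) - g (Inf k)) + norm (h (Sup k) - h (Inf k)))"
        by (intro le) auto
    qed
    also have "\<dots> = C * ((\<Sum>k\<in>d. norm (g (Sup k) - g (Inf k))) + (\<Sum>k\<in>d. norm (h (Sup k) - h (Inf k))))"
      by (simp add: sum_distrib_left[symmetric] sum.distrib)
    also have "\<dots> < C * (e / (2 * C) + e / (2 * C))"
      using d C by (intro mult_strict_left_mono add_strict_mono \<delta>1 \<delta>2) auto
    also have "\<dots> = e" using C by (simp add: field_simps)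
    finally show "(\<Sum>k\<in>d. norm (f (Sup k) - f (Inf k))) < e" .
  qed (use \<open>\<delta>1 > 0\<close> \<open>\<delta>2 > 0\<close> in auto)
qed

lemma AC_on_ident: "AC_on {a..b} (\<lambda>x::real. x)"
  unfolding AC_on_def
proof (intro allI impI)
  fix e :: real assume "e > 0"
  have "(\<Sum>k\<in>d. norm (Sup k - Inf k)) < e" if d: "d division_of \<Union>d" "(\<Sum>k\<in>d. Sup k - Inf k) < e"
    for d :: "real set set"
  proof -
    have "(\<Sum>k\<in>d. norm (Sup k - Inf k)) = (\<Sum>k\<in>d. Sup k - Inf k)"
    proof (rule sum.cong[OF refl])
      fix k assume "k \<in> d"
      from division_of_real_intervalE[OF d(1) this] show "norm (Sup k - Inf k) = Sup k - Inf k"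
        by (metis abs_of_nonneg diff_ge_0_iff_ge real_norm_def)
    qed
    with d show ?thesis by simp
  qed
  with \<open>e > 0\<close> show "\<exists>\<delta>>0. \<forall>d. d division_of \<Union>d \<and> \<Union>d \<subseteq> {a..b} \<and> (\<Sum>k\<in>d. Sup k - Inf k) < \<delta> \<longrightarrow>
     (\<Sum>k\<in>d. norm (Sup k - Inf k)) < e"
    by blast
qed

lemma AC_on_bilinear:
  assumes "bounded_bilinear pr" and f: "AC_on {a..b} f" and g: "AC_on {a..b} g"
  shows "AC_on {a..b} (\<lambda>x. pr (f x) (g x))"
proof -
  interpret bounded_bilinear pr by fact
  obtain K where K: "K > 0" "\<And>x y. norm (pr x y) \<le> norm x * norm y * K" using pos_bounded by blast
  have "bounded (f ` {a..b})" "bounded (g ` {a..b})"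
    using AC_on_imp_continuous_on[OF f] AC_on_imp_continuous_on[OF g]
    by (auto intro!: compact_imp_bounded compact_continuous_image)
  then obtain Mf Mg where M: "Mf > 0" "Mg > 0" "\<And>x. x \<in> {a..b} \<Longrightarrow> norm (f x) \<le> Mf" "\<And>x. x \<in> {a..b} \<Longrightarrow> norm (g x) \<le> Mg"
    unfolding bounded_pos by auto
  show ?thesis
  proof (rule AC_on_dominated[OF f g])
    show "K * (Mf + Mg) > 0" using K M by simp
    fix x y assume xy: "a \<le> x" "x \<le> y" "y \<le> b"
    have "pr (f y) (g y) - pr (f x) (g x) = pr (f y - f x) (g y) + pr (f x) (g y - g x)"
      by (simp add: diff_left diff_right)
    then have "norm (pr (f y) (g y) - pr (f x) (g x))
        \<le> norm (f y - f x) * norm (g y) * K + norm (f x) * norm (g y - g x) * K"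
      using K(2) by (smt (verit, best) norm_triangle_ineq)
    also have "\<dots> \<le> norm (f y - f x) * (Mf + Mg) * K + (Mf + Mg) * norm (g y - g x) * K"
    proof -
      have "norm (g y) \<le> Mf + Mg" "norm (f x) \<le> Mf + Mg" using M(1,2) M(3)[of x] M(4)[of y] xy by auto
      then show ?thesis using K(1) M by (intro add_mono mult_mono mult_nonneg_nonneg) auto
    qed
    also have "\<dots> = K * (Mf + Mg) * (norm (f y - f x) + norm (g y - g x))" by (simp add: algebra_simps)
    finally show "norm (pr (f y) (g y) - pr (f x) (g x)) \<le> K * (Mf + Mg) * (norm (f y - f x) + norm (g y - g x))" .
  qed
qed

text \<open>Truncating \<open>\<phi>\<close> at a high level \<open>k\<close> changes its integral by little, and over a set of
small measure the integral of the bounded part is small as well.\<close>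

lemma AC_on_indefinite_integral:
  fixes f :: "real \<Rightarrow> 'a::real_normed_vector" and \<phi> :: "real \<Rightarrow> real"
  assumes \<phi>: "\<phi> absolutely_integrable_on {a..b}" and nn: "\<And>x. 0 \<le> \<phi> x"
    and le: "\<And>x y. \<lbrakk>a \<le> x; x \<le> y; y \<le> b\<rbrakk> \<Longrightarrow> norm (f y - f x) \<le> integral {x..y} \<phi>"
  shows "AC_on {a..b} f"
  unfolding AC_on_def
proof (intro allI impI)
  fix e :: real assume "e > 0"
  have int: "(\<lambda>x. min (\<phi> x) (real k)) absolutely_integrable_on {a..b}" for k
    using \<phi> by (intro absolutely_integrable_min_1) (auto simp: absolutely_integrable_on_def)
  have "(\<lambda>k. integral {a..b} (\<lambda>x. min (\<phi> x) (real k))) \<longlonglongrightarrow> integral {a..b} \<phi>"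
  proof (rule dominated_convergence)
    show "(\<lambda>k. min (\<phi> x) (real k)) \<longlonglongrightarrow> \<phi> x" for x
    proof (rule tendsto_eventually)
      show "\<forall>\<^sub>F k in sequentially. min (\<phi> x) (real k) = \<phi> x"
        using eventually_ge_at_top[of "nat \<lceil>\<phi> x\<rceil>"] by eventually_elim (auto simp: min_def nat_le_iff ceiling_le_iff)
    qed
  qed (use int \<phi> nn in \<open>auto simp: absolutely_integrable_on_def\<close>)
  from LIMSEQ_D[OF this, of "e/2"] \<open>e > 0\<close>
  obtain k where k: "\<bar>integral {a..b} (\<lambda>x. min (\<phi> x) (real k)) - integral {a..b} \<phi>\<bar> < e / 2" by force
  define \<psi> where "\<psi> = (\<lambda>x. \<phi> x - min (\<phi> x) (real k))"
  have \<psi>: "\<psi> integrable_on {a..b}" and \<phi>i: "\<phi> integrable_on {a..b}"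
    unfolding \<psi>_def using int[of k] \<phi> by (auto intro!: integrable_diff simp: absolutely_integrable_on_def)
  have "integral {a..b} \<psi> = integral {a..b} \<phi> - integral {a..b} (\<lambda>x. min (\<phi> x) (real k))"
    unfolding \<psi>_def using int[of k] \<phi>i
    by (intro Henstock_Kurzweil_Integration.integral_diff) (auto simp: absolutely_integrable_on_def)
  then have \<psi>e: "integral {a..b} \<psi> < e / 2" using k by linarith
  show "\<exists>\<delta>>0. \<forall>d. d division_of \<Union>d \<and> \<Union>d \<subseteq> {a..b} \<and> (\<Sum>k\<in>d. Sup k - Inf k) < \<delta> \<longrightarrow>
     (\<Sum>k\<in>d. norm (f (Sup k) - f (Inf k))) < e"
  proof (intro exI[of _ "e / (2 * (real k + 1))"] conjI allI impI)
    show "0 < e / (2 * (real k + 1))" using \<open>e > 0\<close> by simp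
    fix d :: "real set set"
    assume d: "d division_of \<Union>d \<and> \<Union>d \<subseteq> {a..b} \<and> (\<Sum>k\<in>d. Sup k - Inf k) < e / (2 * (real k + 1))"
    then have dd: "d division_of \<Union>d" by simp
    have "(\<Sum>K\<in>d. norm (f (Sup K) - f (Inf K))) \<le> (\<Sum>K\<in>d. integral K \<psi> + (real k + 1) * (Sup K - Inf K))"
    proof (rule sum_mono)
      fix K assume "K \<in> d"
      from division_of_real_intervalE[OF dd this] d
      obtain u v where uv: "u \<le> v" "K = {u..v}" "Sup K = v" "Inf K = u" "{u..v} \<subseteq> {a..b}"
        by (metis subset_trans)
      have i: "\<psi> integrable_on {u..v}" "\<phi> integrable_on {u..v}"
        using integrable_subinterval_real[OF \<psi> uv(5)] integrable_subinterval_real[OF \<phi>i uv(5)] by auto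
      have "norm (f v - f u) \<le> integral {u..v} \<phi>" using uv by (intro le) auto
      also have "\<dots> \<le> integral {u..v} (\<lambda>x. \<psi> x + (real k + 1))"
        by (rule integral_le) (auto simp: \<psi>_def intro!: i(2) integrable_add integrable_diff i(1)[unfolded \<psi>_def])
      also have "\<dots> = integral {u..v} \<psi> + (real k + 1) * (v - u)"
        using i uv by (subst integral_add) auto
      finally show "norm (f (Sup K) - f (Inf K)) \<le> integral K \<psi> + (real k + 1) * (Sup K - Inf K)" using uv by simp
    qed
    also have "\<dots> = integral (\<Union>d) \<psi> + (real k + 1) * (\<Sum>K\<in>d. Sup K - Inf K)"
      using integral_combine_division_topdown[of \<psi> "\<Union>d" d] dd d \<psi>
      by (simp add: sum.distrib sum_distrib_left integrable_on_subdivision[OF dd \<psi>])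
    also have "integral (\<Union>d) \<psi> \<le> integral {a..b} \<psi>"
      using d \<psi> by (intro integral_subset_le) (auto simp: \<psi>_def[symmetric] integrable_on_subdivision[OF dd \<psi>], simp add: \<psi>_def)
    also have "(real k + 1) * (\<Sum>K\<in>d. Sup K - Inf K) \<le> (real k + 1) * (e / (2 * (real k + 1)))"
      using d by (intro mult_left_mono) auto
    also have "(real k + 1) * (e / (2 * (real k + 1))) = e / 2" by (simp add: field_simps)
    finally show "(\<Sum>k\<in>d. norm (f (Sup k) - f (Inf k))) < e" using \<psi>e by linarith
  qed
qed


section \<open>The fundamental theorem of calculus for absolutely continuous functions\<close>

lemma negligible_open_superset:
  fixes N :: "'a::euclidean_space set"
  assumes "negligible N" "e > 0"
  obtains U where "open U" "N \<subseteq> U" "U \<in> lmeasurable" "measure lebesgue U < e"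
proof -
  have N: "N \<in> null_sets lebesgue" using assms negligible_iff_null_sets by blast
  obtain U where U: "open U" "N \<subseteq> U" "U - N \<in> lmeasurable" "emeasure lebesgue (U - N) < ennreal e"
    using sets_lebesgue_outer_open[of N e] N assms(2) by blast
  have eq: "U = (U - N) \<union> N" using U by blast
  have "N \<in> lmeasurable" using assms by (simp add: negligible_imp_measurable)
  then have "U \<in> lmeasurable" using eq U(3) by (metis fmeasurable.Un)
  moreover have "emeasure lebesgue U = emeasure lebesgue (U - N)"
    using emeasure_Un_null_set[of "U - N" lebesgue N] eq U(3) N by (simp add: fmeasurableD)
  ultimately show ?thesis using U that assms(2)
    by (metis emeasure_eq_measure2 ennreal_less_iff measure_nonneg)
qed

text \<open>The gauge is chosen so that tags outside \<open>N\<close> obey the straddle estimate, and tags in \<open>N\<close>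
carry intervals inside an open set of small measure. The increments of \<open>y\<close> over the latter intervals
are small in total by absolute continuity, and the integrand may be taken to vanish on \<open>N\<close>.\<close>

lemma AC_on_fundamental_theorem:
  fixes y :: "real \<Rightarrow> 'a::banach"
  assumes ab: "a \<le> b" and y: "AC_on {a..b} y" and N: "negligible N"
    and der: "\<And>x. x \<in> {a..b} - N \<Longrightarrow> (y has_vector_derivative g x) (at x)"
  shows "(g has_integral (y b - y a)) {a..b}"
proof -
  define h where "h = (\<lambda>x. if x \<in> N then 0 else g x)"
  have "(h has_integral (y b - y a)) {a..b}"
    unfolding has_integral_real
  proof (intro allI impI)
    fix e :: real assume e: "e > 0"
    \<comment> \<open>Adding \<open>1\<close> keeps the denominator positive when \<open>a = b\<close>.\<close>
    define \<epsilon> where "\<epsilon> = e / (2 * (b - a + 1))"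
    have \<epsilon>: "\<epsilon> > 0" "\<epsilon> * (b - a) \<le> e / 2" using e ab by (auto simp: \<epsilon>_def field_simps)
    from y e obtain \<delta> where "\<delta> > 0" and \<delta>: "\<And>d. \<lbrakk>d division_of \<Union>d; \<Union>d \<subseteq> {a..b}; (\<Sum>k\<in>d. Sup k - Inf k) < \<delta>\<rbrakk>
        \<Longrightarrow> (\<Sum>k\<in>d. norm (y (Sup k) - y (Inf k))) < e / 2"
      unfolding AC_on_def by (meson half_gt_zero)
    obtain U where U: "open U" "N \<subseteq> U" "U \<in> lmeasurable" "measure lebesgue U < \<delta>"
      using negligible_open_superset[OF N \<open>\<delta> > 0\<close>] .
    have "\<exists>d>0. \<forall>t. \<bar>t - x\<bar> < d \<longrightarrow> norm (y t - y x - (t - x) *\<^sub>R g x) \<le> \<epsilon> * \<bar>t - x\<bar>" if "x \<in> {a..b} - N" for x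
      using der[OF that] \<epsilon>(1) unfolding has_vector_derivative_def has_derivative_at_alt by auto
    then obtain d where d: "\<And>x. x \<in> {a..b} - N \<Longrightarrow> d x > 0"
       "\<And>x t. \<lbrakk>x \<in> {a..b} - N; \<bar>t - x\<bar> < d x\<rbrakk> \<Longrightarrow> norm (y t - y x - (t - x) *\<^sub>R g x) \<le> \<epsilon> * \<bar>t - x\<bar>"
      by metis
    define \<gamma> where "\<gamma> x = (if x \<in> N then U else if x \<in> {a..b} then ball x (d x) else UNIV)" for x
    have \<gamma>: "gauge \<gamma>" unfolding gauge_def \<gamma>_def using U d(1) by auto
    have main: "norm ((\<Sum>(x, k)\<in>p. measure lborel k *\<^sub>R h x) - (y b - y a)) < e"
      if p: "p tagged_division_of {a..b}" and fine: "\<gamma> fine p" for p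
    proof -
      have fp: "finite p" using p by blast
      define A where "A = {q \<in> p. fst q \<in> N}"
      have A: "A \<subseteq> p" unfolding A_def by auto
      have elem: "\<exists>u v. u \<le> v \<and> k = {u..v} \<and> Sup k = v \<and> Inf k = u \<and> x \<in> {u..v} \<and> {u..v} \<subseteq> {a..b} \<and> measure lborel k = v - u"
        if xk: "(x, k) \<in> p" for x k
      proof -
        obtain u v where "k = cbox u v" "x \<in> k" "k \<subseteq> {a..b}"
          using tagged_division_ofD(2,3,4)[OF p xk] by blast
        then show ?thesis by (intro exI[of _ u] exI[of _ v]) auto
      qed
      have "(\<Sum>(x, k)\<in>p. measure lborel k *\<^sub>R h x) - (y b - y a)
          = (\<Sum>(x, k)\<in>p. measure lborel k *\<^sub>R h x - (y (Sup k) - y (Inf k)))"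
        using additive_tagged_division_1[OF ab p, of y] by (simp add: sum_subtractf case_prod_unfold)
      then have "norm ((\<Sum>(x, k)\<in>p. measure lborel k *\<^sub>R h x) - (y b - y a))
          \<le> (\<Sum>(x, k)\<in>p. norm (measure lborel k *\<^sub>R h x - (y (Sup k) - y (Inf k))))"
        by (auto intro: order_trans[OF norm_sum] simp: case_prod_unfold)
      also have "\<dots> \<le> (\<Sum>q\<in>p. \<epsilon> * measure lborel (snd q) + (if fst q \<in> N then norm (y (Sup (snd q)) - y (Inf (snd q))) else 0))"
      proof (rule sum_mono, clarify)
        fix x k assume xk: "(x, k) \<in> p"
        obtain u v where uv: "u \<le> v" "k = {u..v}" "Sup k = v" "Inf k = u" "x \<in> {u..v}" "{u..v} \<subseteq> {a..b}" "measure lborel k = v - u"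
          using elem[OF xk] by blast
        have sub: "k \<subseteq> \<gamma> x" using fine xk unfolding fine_def by blast
        show "norm (measure lborel k *\<^sub>R h x - (y (Sup k) - y (Inf k)))
          \<le> \<epsilon> * measure lborel (snd (x, k)) + (if fst (x, k) \<in> N then norm (y (Sup (snd (x, k))) - y (Inf (snd (x, k)))) else 0)"
        proof (cases "x \<in> N")
          case True
          then show ?thesis using uv \<epsilon> by (simp add: h_def norm_minus_commute)
        next
          case False
          then have x: "x \<in> {a..b} - N" using uv by auto
          then have "{u..v} \<subseteq> ball x (d x)" using sub uv(2) False by (simp add: \<gamma>_def)
          then have "u \<in> ball x (d x)" "v \<in> ball x (d x)" using uv(1) by (simp_all add: subset_iff)
          then have 1: "norm (y v - y x - (v - x) *\<^sub>R g x) \<le> \<epsilon> * (v - x)" "norm (y u - y x - (u - x) *\<^sub>R g x) \<le> \<epsilon> * (x - u)"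
            using d(2)[OF x, of v] d(2)[OF x, of u] uv by (auto simp: dist_real_def)
          have "(v - u) *\<^sub>R g x - (y v - y u) = (y u - y x - (u - x) *\<^sub>R g x) - (y v - y x - (v - x) *\<^sub>R g x)"
            by (simp add: algebra_simps)
          also have "norm \<dots> \<le> \<epsilon> * (x - u) + \<epsilon> * (v - x)"
            using 1 by (smt (verit) norm_triangle_ineq4)
          also have "\<dots> = \<epsilon> * (v - u)" by (simp add: algebra_simps)
          finally show ?thesis using uv False by (simp add: h_def)
        qed
      qed
      also have "\<dots> = \<epsilon> * (\<Sum>(x, k)\<in>p. measure lborel k) + (\<Sum>q\<in>A. norm (y (Sup (snd q)) - y (Inf (snd q))))"
        unfolding A_def by (simp add: sum.distrib sum_distrib_left[symmetric] case_prod_unfold sum.inter_filter[OF fp])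
      also have "(\<Sum>(x, k)\<in>p. measure lborel k) = b - a"
        using additive_content_tagged_division[of p a b] p ab by simp
      also have "(\<Sum>q\<in>A. norm (y (Sup (snd q)) - y (Inf (snd q)))) < e / 2"
      proof -
        have part: "A tagged_partial_division_of {a..b}"
          using p A tagged_partial_division_subset by (metis tagged_division_of_def)
        have tdiv: "A tagged_division_of \<Union>(snd ` A)" by (rule tagged_partial_division_of_Union_self[OF part])
        have div: "snd ` A division_of \<Union>(snd ` A)" by (rule division_of_tagged_division[OF tdiv])
        have sub: "\<Union>(snd ` A) \<subseteq> {a..b}" using A elem by fastforce
        have subU: "\<Union>(snd ` A) \<subseteq> U" using fine A unfolding fine_def A_def \<gamma>_def by fastforce
        \<comment> \<open>The default value on the empty set serves the lemma on sums over tagged divisions, which quantifies over empty intervals as well.\<close>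
        define \<phi> where "\<phi> k = (if k = {} then 0 else norm (y (Sup k) - y (Inf k)))" for k
        have \<phi>: "norm (y (Sup k) - y (Inf k)) = \<phi> k" if "(x, k) \<in> A" for x k
          using that tagged_partial_division_ofD(2)[OF part that] by (auto simp: \<phi>_def)
        have "(\<Sum>q\<in>A. norm (y (Sup (snd q)) - y (Inf (snd q)))) = (\<Sum>(x,k)\<in>A. \<phi> k)"
          by (intro sum.cong) (auto simp: \<phi>)
        also have "\<dots> = (\<Sum>k\<in>snd ` A. \<phi> k)"
        proof (rule sum.over_tagged_division_lemma[OF tdiv])
          fix u v :: real assume "box u v = {}"
          then show "\<phi> (cbox u v) = 0" by (cases "u = v") (auto simp: box_eq_empty \<phi>_def)
        qed
        also have "\<dots> = (\<Sum>k\<in>snd ` A. norm (y (Sup k) - y (Inf k)))"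
          by (intro sum.cong) (auto simp: \<phi>)
        also have "\<dots> < e / 2"
        proof (rule \<delta>[OF div sub])
          have "(\<Sum>k\<in>snd ` A. Sup k - Inf k) = (\<Sum>k\<in>snd ` A. measure lebesgue k)"
          proof (rule sum.cong[OF refl])
            fix k assume "k \<in> snd ` A"
            then obtain x where "(x, k) \<in> p" using A by auto
            then obtain u v where "u \<le> v" "k = {u..v}" "Sup k = v" "Inf k = u" using elem by metis
            then show "Sup k - Inf k = measure lebesgue k" by simp
          qed
          also have "\<dots> = measure lebesgue (\<Union>(snd ` A))" by (rule content_division[OF div])
          also have "\<dots> \<le> measure lebesgue U"
            using U subU lmeasurable_division[OF div] by (intro measure_mono_fmeasurable) auto
          finally show "(\<Sum>k\<in>snd ` A. Sup k - Inf k) < \<delta>" using U by linarith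
        qed
        finally show ?thesis .
      qed
      finally show ?thesis using \<epsilon>(2) by linarith
    qed
    then show "\<exists>\<gamma>. gauge \<gamma> \<and> (\<forall>p. p tagged_division_of {a..b} \<and> \<gamma> fine p \<longrightarrow>
        norm ((\<Sum>(x, k)\<in>p. measure lborel k *\<^sub>R h x) - (y b - y a)) < e)"
      using \<gamma> by blast
  qed
  then show ?thesis
    by (rule has_integral_spike[OF N, rotated]) (simp add: h_def)
qed


section \<open>Local primitives\<close>

text \<open>The working notion for everything below: it is linear, satisfies a product rule, and is equivalent to
\<open>F\<close> being locally absolutely continuous with locally integrable derivative \<open>f\<close> almost everywhere.\<close>

definition local_primitive :: "(real \<Rightarrow> 'a::euclidean_space) \<Rightarrow> (real \<Rightarrow> 'a) \<Rightarrow> bool" where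
  "local_primitive F f \<longleftrightarrow> L1_loc f \<and> (\<forall>a b. a \<le> b \<longrightarrow> (f has_integral F b - F a) {a..b})"

lemma AE_negligibleE:
  assumes "AE x in lebesgue. P x"
  obtains N where "negligible N" "{x. \<not> P x} \<subseteq> N"
proof -
  from assms obtain N where "N \<in> null_sets lebesgue" "{x \<in> space lebesgue. \<not> P x} \<subseteq> N"
    unfolding eventually_ae_filter by blast
  then show ?thesis using that[of N] by (simp add: negligible_iff_null_sets)
qed

lemma L1_loc_integrable_on: "L1_loc f \<Longrightarrow> f integrable_on {a..b}"
  by (auto simp: L1_loc_def absolutely_integrable_on_def)

lemma L1_loc_borel_measurable:
  fixes f :: "real \<Rightarrow> 'a::euclidean_space"
  assumes "L1_loc f" shows "f \<in> borel_measurable lebesgue"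
proof -
  have [measurable]: "(\<lambda>x. indicator {- real n..real n} x *\<^sub>R f x) \<in> borel_measurable lebesgue" for n
    using assms unfolding L1_loc_def set_integrable_def by (blast dest: borel_measurable_integrable)
  show ?thesis
  proof (rule borel_measurable_LIMSEQ_metric)
    fix x :: real
    have "\<forall>\<^sub>F n in sequentially. indicator {- real n..real n} x *\<^sub>R f x = f x"
      using eventually_ge_at_top[of "nat \<lceil>\<bar>x\<bar>\<rceil>"]
    proof eventually_elim
      case (elim n)
      then have "\<bar>x\<bar> \<le> real n" by (simp add: nat_le_iff ceiling_le_iff)
      then show ?case by (auto simp: indicator_def)
    qed
    then show "(\<lambda>n. indicator {- real n..real n} x *\<^sub>R f x) \<longlonglongrightarrow> f x" by (rule tendsto_eventually)
  qed measurable
qed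

lemma L1_loc_continuous:
  fixes f :: "real \<Rightarrow> 'a::euclidean_space"
  assumes "continuous_on UNIV f" shows "L1_loc f"
  using assms by (auto simp: L1_loc_def intro: absolutely_integrable_continuous_real continuous_on_subset)

lemma L1_loc_add: "L1_loc f \<Longrightarrow> L1_loc g \<Longrightarrow> L1_loc (\<lambda>x. f x + g x)"
  by (auto simp: L1_loc_def intro: set_integral_add)

lemma L1_loc_diff: "L1_loc f \<Longrightarrow> L1_loc g \<Longrightarrow> L1_loc (\<lambda>x. f x - g x)"
  by (auto simp: L1_loc_def intro: set_integral_diff)

lemma L1_loc_linear:
  fixes h :: "'a::euclidean_space \<Rightarrow> 'b::euclidean_space"
  assumes "L1_loc f" "linear h" shows "L1_loc (\<lambda>x. h (f x))"
  using assms absolutely_integrable_linear[where f=f and h=h]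
  by (auto simp: L1_loc_def o_def linear_conv_bounded_linear)

lemma L1_loc_bilinear_continuous:
  fixes pr :: "'a::euclidean_space \<Rightarrow> 'b::euclidean_space \<Rightarrow> 'c::euclidean_space"
  assumes pr: "bounded_bilinear pr" and f: "continuous_on UNIV f" and g: "L1_loc g"
  shows "L1_loc (\<lambda>x. pr (f x) (g x))"
  unfolding L1_loc_def
proof (intro allI absolutely_integrable_bounded_measurable_product[where h = pr])
  fix a b :: real
  have c: "continuous_on {a..b} f" using f continuous_on_subset by blast
  show "bilinear pr" using pr bilinear_conv_bounded_bilinear by blast
  show "f \<in> borel_measurable (lebesgue_on {a..b})" "{a..b} \<in> sets lebesgue"
    using c by (auto intro: continuous_imp_measurable_on_sets_lebesgue)
  show "bounded (f ` {a..b})" using c compact_continuous_image compact_imp_bounded by blast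
  show "set_integrable lebesgue {a..b} g" using g by (simp add: L1_loc_def)
qed

lemma L1_loc_bilinear_continuous2:
  fixes pr :: "'a::euclidean_space \<Rightarrow> 'b::euclidean_space \<Rightarrow> 'c::euclidean_space"
  assumes pr: "bounded_bilinear pr" and f: "L1_loc f" and g: "continuous_on UNIV g"
  shows "L1_loc (\<lambda>x. pr (f x) (g x))"
  by (rule L1_loc_bilinear_continuous[OF bounded_bilinear.flip[OF pr] g f])

lemma local_primitiveD:
  assumes "local_primitive F f" "a \<le> b"
  shows "(f has_integral F b - F a) {a..b}" "integral {a..b} f = F b - F a" "f integrable_on {a..b}"
  using assms by (auto simp: local_primitive_def)

lemma local_primitive_L1_loc: "local_primitive F f \<Longrightarrow> L1_loc f"
  by (simp add: local_primitive_def)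

lemma L1_loc_norm:
  fixes f :: "real \<Rightarrow> 'a::euclidean_space"
  assumes "L1_loc f" shows "L1_loc (\<lambda>x. norm (f x))"
  using assms absolutely_integrable_norm unfolding L1_loc_def o_def by blast

lemma local_primitive_AC_loc:
  assumes F: "local_primitive F f" shows "AC_loc F"
  unfolding AC_loc_def
proof (intro allI)
  fix a b
  show "AC_on {a..b} F"
  proof (rule AC_on_indefinite_integral)
    have L: "L1_loc f" using F by (simp add: local_primitive_def)
    show "(\<lambda>x. norm (f x)) absolutely_integrable_on {a..b}"
      using L1_loc_norm[OF L] unfolding L1_loc_def by blast
    fix x y assume "a \<le> x" "x \<le> y" "y \<le> b"
    then have "F y - F x = integral {x..y} f" using local_primitiveD(2)[OF F, of x y] by simp
    also have "norm \<dots> \<le> integral {x..y} (\<lambda>x. norm (f x))"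
      by (rule integral_norm_bound_integral[OF L1_loc_integrable_on[OF L] L1_loc_integrable_on[OF L1_loc_norm[OF L]]]) simp
    finally show "norm (F y - F x) \<le> integral {x..y} (\<lambda>x. norm (f x))" .
  qed simp
qed

lemma AC_loc_continuous: "AC_loc f \<Longrightarrow> continuous_on UNIV f"
proof (rule continuous_at_imp_continuous_on, intro ballI)
  fix x :: real assume "AC_loc f"
  then have "continuous_on {x-1..x+1} f" unfolding AC_loc_def by (blast intro: AC_on_imp_continuous_on)
  then show "isCont f x" by (rule continuous_on_interior) auto
qed

lemma local_primitive_continuous: "local_primitive F f \<Longrightarrow> continuous_on UNIV F"
  using AC_loc_continuous local_primitive_AC_loc by blast

lemma local_primitive_has_derivative_AE:
  assumes F: "local_primitive F f"
  shows "AE x in lebesgue. (F has_vector_derivative f x) (at x)"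
proof -
  have "AE x in lebesgue. \<forall>n::nat. x \<in> {- real n<..<real n} \<longrightarrow> ((\<lambda>y. integral {- real n..y} f) has_vector_derivative f x) (at x)"
    unfolding AE_all_countable using F by (intro allI indefinite_integral_differentiable_ae local_primitiveD(3)[OF F])  auto
  then show ?thesis
  proof eventually_elim
    case (elim x)
    obtain n :: nat where n: "\<bar>x\<bar> < real n" using reals_Archimedean2 by blast
    then have x: "x \<in> {- real n<..<real n}" by auto
    then have "((\<lambda>y. integral {- real n..y} f + F (- real n)) has_vector_derivative f x + 0) (at x)"
      using elim x by (intro has_vector_derivative_add has_vector_derivative_const) auto
    then have "((\<lambda>y. integral {- real n..y} f + F (- real n)) has_vector_derivative f x) (at x)" by simp
    then show ?case
    proof (rule has_vector_derivative_transform_within_open[OF _ _ x])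
      fix y assume "y \<in> {- real n<..<real n}"
      then show "integral {- real n..y} f + F (- real n) = F y"
        using local_primitiveD(2)[OF F, of "- real n" y] by simp
    qed auto
  qed
qed

lemma local_primitiveI_AC_loc:
  fixes F :: "real \<Rightarrow> 'a::euclidean_space"
  assumes "AC_loc F" "L1_loc f" "AE x in lebesgue. (F has_vector_derivative f x) (at x)"
  shows "local_primitive F f"
  unfolding local_primitive_def
proof (intro conjI allI impI assms(2))
  fix a b :: real assume ab: "a \<le> b"
  obtain N where N: "negligible N" "{x. \<not> (F has_vector_derivative f x) (at x)} \<subseteq> N"
    using AE_negligibleE[OF assms(3)] .
  show "(f has_integral F b - F a) {a..b}"
    using assms(1) N by (intro AC_on_fundamental_theorem[OF ab, of _ N])
      (auto simp: AC_loc_def)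
qed

lemma local_primitive_exists:
  fixes f :: "real \<Rightarrow> 'a::euclidean_space"
  assumes "L1_loc f"
  obtains F where "local_primitive F f" "F x0 = c"
proof -
  define F where "F x = c + (if x0 \<le> x then integral {x0..x} f else - integral {x..x0} f)" for x
  have "F x0 = c" by (simp add: F_def)
  moreover have "local_primitive F f"
    unfolding local_primitive_def
  proof (intro conjI allI impI assms)
    fix a b :: real assume ab: "a \<le> b"
    have i: "f integrable_on {u..v}" for u v using assms by (rule L1_loc_integrable_on)
    have c: "integral {u..v} f + integral {v..w} f = integral {u..w} f" if "u \<le> v" "v \<le> w" for u v w
      using that i by (rule Henstock_Kurzweil_Integration.integral_combine)
    have "integral {a..b} f = F b - F a"
      using c[of x0 a b] c[of a x0 b] c[of a b x0] ab by (auto simp: F_def algebra_simps)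
    then show "(f has_integral F b - F a) {a..b}" using i by (metis integrable_integral)
  qed
  ultimately show ?thesis using that by blast
qed

lemma local_primitive_unique_AE:
  assumes "local_primitive F f" "local_primitive F g"
  shows "AE x in lebesgue. f x = g x"
  using assms[THEN local_primitive_has_derivative_AE]
  by eventually_elim (rule vector_derivative_unique_at)

lemma local_primitive_add:
  "local_primitive F f \<Longrightarrow> local_primitive G g \<Longrightarrow> local_primitive (\<lambda>x. F x + G x) (\<lambda>x. f x + g x)"
  using has_integral_add[of f "F b - F a" "{a..b}" g "G b - G a" for a b]
  unfolding local_primitive_def by (simp add: L1_loc_add add_diff_add)

lemma local_primitive_const: "local_primitive (\<lambda>x. c) (\<lambda>x. 0)"
  by (auto simp: local_primitive_def L1_loc_def)

lemma local_primitive_linear: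
  fixes h :: "'a::euclidean_space \<Rightarrow> 'b::euclidean_space"
  assumes "local_primitive F f" "linear h"
  shows "local_primitive (\<lambda>x. h (F x)) (\<lambda>x. h (f x))"
proof -
  have h: "bounded_linear h" using assms by (simp add: linear_conv_bounded_linear)
  show ?thesis
    unfolding local_primitive_def
  proof (intro conjI allI impI)
    show "L1_loc (\<lambda>x. h (f x))" by (rule L1_loc_linear[OF local_primitive_L1_loc[OF assms(1)] assms(2)])
    fix a b :: real assume "a \<le> b"
    then show "((\<lambda>x. h (f x)) has_integral h (F b) - h (F a)) {a..b}"
      using has_integral_linear[OF local_primitiveD(1)[OF assms(1)] h] by (simp add: o_def linear_diff[OF assms(2)])
  qed
qed

lemma local_primitive_bilinear:
  fixes pr :: "'a::euclidean_space \<Rightarrow> 'b::euclidean_space \<Rightarrow> 'c::euclidean_space"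
  assumes pr: "bounded_bilinear pr" and F: "local_primitive F f" and G: "local_primitive G g"
  shows "local_primitive (\<lambda>x. pr (F x) (G x)) (\<lambda>x. pr (F x) (g x) + pr (f x) (G x))"
proof (rule local_primitiveI_AC_loc)
  show "AC_loc (\<lambda>x. pr (F x) (G x))"
    using local_primitive_AC_loc[OF F] local_primitive_AC_loc[OF G] unfolding AC_loc_def
    by (blast intro: AC_on_bilinear[OF pr])
  show "L1_loc (\<lambda>x. pr (F x) (g x) + pr (f x) (G x))"
    by (intro L1_loc_add L1_loc_bilinear_continuous[OF pr] L1_loc_bilinear_continuous2[OF pr]
        local_primitive_continuous[OF F] local_primitive_continuous[OF G] local_primitive_L1_loc[OF F] local_primitive_L1_loc[OF G])
  show "AE x in lebesgue. ((\<lambda>x. pr (F x) (G x)) has_vector_derivative pr (F x) (g x) + pr (f x) (G x)) (at x)"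
    using local_primitive_has_derivative_AE[OF F] local_primitive_has_derivative_AE[OF G]
    by eventually_elim (rule bounded_bilinear.has_vector_derivative[OF pr])
qed


section \<open>Linear systems with locally integrable coefficients\<close>

text \<open>Supplies the weights of the next lemma; on a compact interval \<open>q\<close> is bounded, and
there the exponential function is Lipschitz.\<close>

lemma local_primitive_exp:
  fixes q b :: "real \<Rightarrow> real"
  assumes q: "local_primitive q b"
  shows "local_primitive (\<lambda>x. exp (c * q x)) (\<lambda>x. b x * (c * exp (c * q x)))"
proof (rule local_primitiveI_AC_loc)
  show "AC_loc (\<lambda>x. exp (c * q x))"
    unfolding AC_loc_def
  proof (intro allI)
    fix u v
    have "continuous_on {u..v} q" using local_primitive_continuous[OF q] continuous_on_subset by blast
    then have "bounded (q ` {u..v})" using compact_continuous_image compact_imp_bounded by blast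
    then obtain M where "\<forall>t\<in>q ` {u..v}. norm t \<le> M" unfolding bounded_iff by blast
    then have M: "\<bar>q x\<bar> \<le> M" if "x \<in> {u..v}" for x using that by auto
    define C where "C = \<bar>c\<bar> * exp (\<bar>c\<bar> * M) + 1"
    show "AC_on {u..v} (\<lambda>x. exp (c * q x))"
    proof (rule AC_on_dominated)
      show "AC_on {u..v} q" "AC_on {u..v} q" using local_primitive_AC_loc[OF q] by (auto simp: AC_loc_def)
      have "0 \<le> \<bar>c\<bar> * exp (\<bar>c\<bar> * M)" by simp
      then show C0: "C > 0" unfolding C_def by linarith
      fix x y assume xy: "u \<le> x" "x \<le> y" "y \<le> v"
      have "norm (exp (c * q y) - exp (c * q x)) \<le> C * norm (q y - q x)"
      proof (rule field_differentiable_bound[where S = "{-M..M}" and f = "\<lambda>t. exp (c * t)" and f' = "\<lambda>t. c * exp (c * t)"])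
        show "((\<lambda>t. exp (c * t)) has_field_derivative c * exp (c * z)) (at z within {- M..M})" for z
          by (auto intro!: derivative_eq_intros)
        fix z assume "z \<in> {-M..M}"
        then have "\<bar>c * z\<bar> \<le> \<bar>c\<bar> * M" by (auto simp: abs_mult intro!: mult_left_mono)
        then have "c * z \<le> \<bar>c\<bar> * M" by linarith
        then have "\<bar>c\<bar> * exp (c * z) \<le> \<bar>c\<bar> * exp (\<bar>c\<bar> * M)" by (intro mult_left_mono) auto
        then show "norm (c * exp (c * z)) \<le> C" by (simp add: C_def abs_mult)
      next
        show "q y \<in> {-M..M}" "q x \<in> {-M..M}" using M[of x] M[of y] xy by auto
      qed simp
      also have "\<dots> \<le> C * (norm (q y - q x) + norm (q y - q x))" using C0 by (intro mult_left_mono) auto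
      finally show "norm (exp (c * q y) - exp (c * q x)) \<le> C * (norm (q y - q x) + norm (q y - q x))" .
    qed
  qed
  show "L1_loc (\<lambda>x. b x * (c * exp (c * q x)))"
    by (intro L1_loc_bilinear_continuous2[OF bounded_bilinear_mult local_primitive_L1_loc[OF q]] continuous_intros local_primitive_continuous[OF q])
  show "AE x in lebesgue. ((\<lambda>x. exp (c * q x)) has_vector_derivative b x * (c * exp (c * q x))) (at x)"
    using local_primitive_has_derivative_AE[OF q]
  proof eventually_elim
    case (elim x)
    have "((\<lambda>t. exp (c * t)) has_field_derivative c * exp (c * q x)) (at (q x))"
      by (auto intro!: derivative_eq_intros)
    from field_vector_diff_chain_at[OF elim this] show ?case by (simp add: o_def)
  qed
qed

text \<open>Writing the solution as \<open>e u\<close> with the weight \<open>e(x) = exp (2 \<bar>q(x)\<bar>)\<close>, where \<open>q\<close> vanishes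
at \<open>0\<close> and is a primitive of a constant times the norm of the coefficient, turns the integral equation into a fixed point problem for a bounded
continuous \<open>u\<close> on the whole line. The weight makes the Volterra operator a contraction with constant
\<open>1/2\<close>, since \<open>q' exp (2 q)\<close> is half of the derivative of \<open>exp (2 q)\<close>. No gluing of local solutions is required.\<close>

lemma linear_ode_exists:
  fixes B :: "real \<Rightarrow> 'a::euclidean_space" and pr :: "'a \<Rightarrow> 'b::euclidean_space \<Rightarrow> 'b"
  assumes pr: "bounded_bilinear pr" and B: "L1_loc B"
  obtains Y where "Y 0 = c" "local_primitive Y (\<lambda>x. pr (B x) (Y x))"
proof -
  interpret pr: bounded_bilinear pr by fact
  obtain K where K: "K > 0" "\<And>x y. norm (pr x y) \<le> norm x * norm y * K" using pr.pos_bounded by blast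
  define b where "b x = norm (B x) * K" for x
  have b0: "b x \<ge> 0" for x using K by (simp add: b_def)
  have bL: "L1_loc b" unfolding b_def
    using L1_loc_linear[OF L1_loc_norm[OF B], of "\<lambda>t. t * K"] by (simp add: linear_iff algebra_simps)
  obtain q where q: "local_primitive q b" and q0: "q 0 = 0" using local_primitive_exists[OF bL] by blast
  have qmono: "q x \<le> q y" if "x \<le> y" for x y
    using has_integral_nonneg[OF local_primitiveD(1)[OF q that]] b0 by simp
  define e where "e x = exp (2 * \<bar>q x\<bar>)" for x
  have e1: "e x \<ge> 1" for x by (simp add: e_def)
  have econt: "continuous_on UNIV e" unfolding e_def by (intro continuous_intros local_primitive_continuous[OF q])
  have beL: "L1_loc (\<lambda>x. b x * e x)" by (rule L1_loc_bilinear_continuous2[OF bounded_bilinear_mult bL econt])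
  have up: "integral {0..x} (\<lambda>s. b s * e s) \<le> e x / 2" if "0 \<le> x" for x
  proof -
    have "((\<lambda>s. b s * (2 * exp (2 * q s)) * (1/2)) has_integral (exp (2 * q x) - exp (2 * q 0)) * (1/2)) {0..x}"
      by (intro has_integral_mult_left local_primitiveD(1)[OF local_primitive_exp[OF q]] that)
    moreover have "b s * (2 * exp (2 * q s)) * (1/2) = b s * e s" if "s \<in> {0..x}" for s
      using qmono[of 0 s] that q0 by (simp add: e_def)
    ultimately have "((\<lambda>s. b s * e s) has_integral (exp (2 * q x) - exp (2 * q 0)) * (1/2)) {0..x}"
      by (rule has_integral_eq[rotated])
    then have "integral {0..x} (\<lambda>s. b s * e s) = (exp (2 * q x) - exp (2 * q 0)) * (1/2)" by (rule integral_unique)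
    also have "\<dots> \<le> e x / 2" using qmono[OF that] q0 by (simp add: e_def)
    finally show ?thesis .
  qed
  have down: "integral {x..0} (\<lambda>s. b s * e s) \<le> e x / 2" if "x \<le> 0" for x
  proof -
    have "((\<lambda>s. b s * (-2 * exp (-2 * q s)) * (-1/2)) has_integral (exp (-2 * q 0) - exp (-2 * q x)) * (-1/2)) {x..0}"
      by (intro has_integral_mult_left local_primitiveD(1)[OF local_primitive_exp[OF q]] that)
    moreover have "b s * (-2 * exp (-2 * q s)) * (-1/2) = b s * e s" if "s \<in> {x..0}" for s
      using qmono[of s 0] that q0 by (simp add: e_def)
    ultimately have "((\<lambda>s. b s * e s) has_integral (exp (-2 * q 0) - exp (-2 * q x)) * (-1/2)) {x..0}"
      by (rule has_integral_eq[rotated])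
    then have "integral {x..0} (\<lambda>s. b s * e s) = (exp (-2 * q 0) - exp (-2 * q x)) * (-1/2)" by (rule integral_unique)
    also have "\<dots> \<le> e x / 2" using qmono[OF that] q0 by (simp add: e_def field_simps)
    finally show ?thesis .
  qed
  \<comment> \<open>The weighted estimate behind both the boundedness and the contraction property of the operator below.\<close>
  have est: "norm (P x - P 0) \<le> M * (e x / 2)"
    if P: "local_primitive P (\<lambda>s. pr (B s) (w s))" and w: "\<And>s. norm (w s) \<le> M * e s" for P w M x
  proof -
    have M0: "M \<ge> 0" using order_trans[OF norm_ge_zero w[of 0]] e1[of 0] by (simp add: zero_le_mult_iff)
    have le: "norm (pr (B s) (w s)) \<le> M * (b s * e s)" for s
    proof -
      have "norm (pr (B s) (w s)) \<le> norm (B s) * norm (w s) * K" by (rule K)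
      also have "\<dots> \<le> norm (B s) * (M * e s) * K" using w[of s] K by (intro mult_right_mono mult_left_mono) auto
      finally show ?thesis by (simp add: b_def algebra_simps)
    qed
    have ib: "(\<lambda>s. M * (b s * e s)) integrable_on {u..v}" for u v
      using L1_loc_integrable_on[OF beL] by (rule integrable_on_mult_right)
    have gen: "norm (P v - P u) \<le> M * integral {u..v} (\<lambda>s. b s * e s)" if "u \<le> v" for u v
    proof -
      have "norm (integral {u..v} (\<lambda>s. pr (B s) (w s))) \<le> integral {u..v} (\<lambda>s. M * (b s * e s))"
        by (rule integral_norm_bound_integral[OF local_primitiveD(3)[OF P that] ib le])
      then show ?thesis using local_primitiveD(2)[OF P that] by simp
    qed
    show ?thesis
    proof (cases "0 \<le> x")
      case True
      have "M * integral {0..x} (\<lambda>s. b s * e s) \<le> M * (e x / 2)" by (rule mult_left_mono[OF up[OF True] M0])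
      with gen[OF True] show ?thesis by linarith
    next
      case False
      then have x: "x \<le> 0" by simp
      have "M * integral {x..0} (\<lambda>s. b s * e s) \<le> M * (e x / 2)" by (rule mult_left_mono[OF down[OF x] M0])
      with gen[OF x] show ?thesis by (simp add: norm_minus_commute)
    qed
  qed
  have euC: "continuous_on UNIV (\<lambda>x. e x *\<^sub>R apply_bcontfun u x)" for u :: "real \<Rightarrow>\<^sub>C 'b"
    by (intro continuous_intros econt) auto
  have "\<exists>P. local_primitive P (\<lambda>s. pr (B s) (e s *\<^sub>R apply_bcontfun u s)) \<and> P 0 = c" for u :: "real \<Rightarrow>\<^sub>C 'b"
    using local_primitive_exists[OF L1_loc_bilinear_continuous2[OF pr B euC]] by metis
  then obtain P where P: "\<And>u. local_primitive (P u) (\<lambda>s. pr (B s) (e s *\<^sub>R apply_bcontfun u s))" and P0: "\<And>u. P u 0 = c"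
    by metis
  \<comment> \<open>At a fixed point \<open>P u = e u\<close>, which turns the relation defining \<open>P u\<close> into the differential equation.\<close>
  define T where "T u = Bcontfun (\<lambda>x. P u x /\<^sub>R e x)" for u
  have e0: "e x > 0" for x using e1[of x] by linarith
  have "(\<lambda>x. P u x /\<^sub>R e x) \<in> bcontfun" for u
  proof (rule bcontfun_normI)
    show "continuous_on UNIV (\<lambda>x. P u x /\<^sub>R e x)"
      using e0 by (intro continuous_intros econt local_primitive_continuous[OF P]) (auto simp: less_imp_neq[symmetric])
    fix x
    have "norm (P u x - P u 0) \<le> norm u * (e x / 2)"
    proof (rule est[OF P])
      show "norm (e s *\<^sub>R apply_bcontfun u s) \<le> norm u * e s" for s
        using norm_bounded[of u s] e0[of s] by (simp add: mult_right_mono mult.commute)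
    qed
    then have "norm (P u x) \<le> norm c + norm u * (e x / 2)"
      using norm_triangle_sub[of "P u x" c] unfolding P0 by linarith
    also have "\<dots> \<le> norm c * e x + norm u * e x"
    proof (intro add_mono mult_left_mono)
      show "norm c \<le> norm c * e x" using mult_left_mono[OF e1[of x], of "norm c"] by simp
    qed (use e0[of x] in auto)
    also have "\<dots> = (norm c + norm u) * e x" by (simp add: algebra_simps)
    finally have "norm (P u x) / e x \<le> norm c + norm u" using e0[of x] by (simp add: divide_le_eq)
    then show "norm (P u x /\<^sub>R e x) \<le> norm c + norm u"
      using e0[of x] by (simp add: divide_inverse mult.commute)
  qed
  then have T: "apply_bcontfun (T u) x = P u x /\<^sub>R e x" for u x
    by (simp add: T_def Bcontfun_inverse)
  have "dist (T u) (T v) \<le> 1/2 * dist u v" for u v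
  proof (rule dist_bound)
    fix x
    have D: "local_primitive (\<lambda>x. P u x + - P v x) (\<lambda>s. pr (B s) (e s *\<^sub>R (apply_bcontfun u s - apply_bcontfun v s)))"
      using local_primitive_add[OF P local_primitive_linear[OF P, of uminus], of u v]
      by (simp add: linear_iff algebra_simps pr.diff_right)
    have "norm ((P u x + - P v x) - (P u 0 + - P v 0)) \<le> dist u v * (e x / 2)"
    proof (rule est[OF D])
      show "norm (e s *\<^sub>R (apply_bcontfun u s - apply_bcontfun v s)) \<le> dist u v * e s" for s
        using dist_bounded[of u s v] e0[of s] by (simp add: dist_norm mult_right_mono mult.commute)
    qed
    then have "norm (P u x - P v x) \<le> dist u v * (e x / 2)" by (simp add: P0)
    then show "dist (apply_bcontfun (T u) x) (apply_bcontfun (T v) x) \<le> 1/2 * dist u v"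
    proof -
      have "dist (apply_bcontfun (T u) x) (apply_bcontfun (T v) x) = norm ((P u x - P v x) /\<^sub>R e x)"
        by (simp add: T dist_norm scaleR_diff_right)
      also have "\<dots> = norm (P u x - P v x) / e x" using e0[of x] by (simp add: divide_inverse mult.commute)
      also have "\<dots> \<le> (dist u v * (e x / 2)) / e x"
        using \<open>norm (P u x - P v x) \<le> dist u v * (e x / 2)\<close> e0[of x] by (intro divide_right_mono) auto
      finally show ?thesis using e0[of x] by simp
    qed
  qed
  then obtain u where u: "T u = u" using banach_fix_type[of "1/2" T] by auto
  have "P u x = e x *\<^sub>R apply_bcontfun u x" for x
    using T[of u x] u e0[of x] by simp
  then have "P u = (\<lambda>x. e x *\<^sub>R apply_bcontfun u x)" by auto
  then show ?thesis using that[of "P u"] P[of u] P0[of u] by metis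
qed


section \<open>Matrix algebra of \<open>J\<close> and of the block swap\<close>

definition mat_adjoint :: "complex ^ 'n ^ 'm \<Rightarrow> complex ^ 'm ^ 'n" where
  "mat_adjoint A = (\<chi> i j. cnj (A $ j $ i))"

lemma bounded_bilinear_matrix_vector_mult:
  "bounded_bilinear ((*v) :: complex ^ 'n ^ 'm \<Rightarrow> complex ^ 'n \<Rightarrow> complex ^ 'm)"
  by (auto simp: bilinear_conv_bounded_bilinear[symmetric] bilinear_def linear_iff vec_eq_iff
      matrix_vector_mult_def sum.distrib scaleR_sum_right algebra_simps)

lemma bounded_bilinear_matrix_mult:
  "bounded_bilinear ((**) :: complex ^ 'n ^ 'm \<Rightarrow> complex ^ 'k ^ 'n \<Rightarrow> complex ^ 'k ^ 'm)"
  by (auto simp: bilinear_conv_bounded_bilinear[symmetric] bilinear_def linear_iff vec_eq_iff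
      matrix_matrix_mult_def sum.distrib scaleR_sum_right algebra_simps)

lemma bounded_bilinear_cinner_vec:
  "bounded_bilinear (cinner_vec :: complex ^ 'n \<Rightarrow> complex ^ 'n \<Rightarrow> complex)"
  by (auto simp: bilinear_conv_bounded_bilinear[symmetric] bilinear_def linear_iff
      cinner_vec_def sum.distrib scaleR_sum_right algebra_simps)

interpretation matrix_vector: bounded_bilinear "(*v) :: complex ^ 'n ^ 'm \<Rightarrow> complex ^ 'n \<Rightarrow> complex ^ 'm"
  by (rule bounded_bilinear_matrix_vector_mult)

interpretation cinner_vec: bounded_bilinear "cinner_vec :: complex ^ 'n \<Rightarrow> complex ^ 'n \<Rightarrow> complex"
  by (rule bounded_bilinear_cinner_vec)

interpretation matrix_mult: bounded_bilinear "(**) :: complex ^ 'n ^ 'm \<Rightarrow> complex ^ 'k ^ 'n \<Rightarrow> complex ^ 'k ^ 'm"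
  by (rule bounded_bilinear_matrix_mult)

lemma linear_mat_adjoint: "linear mat_adjoint"
  by (auto simp: linear_iff mat_adjoint_def vec_eq_iff)

lemma mat_adjoint_mult: "mat_adjoint (A ** B) = mat_adjoint B ** mat_adjoint A"
  by (simp add: mat_adjoint_def vec_eq_iff matrix_matrix_mult_def mult.commute)

lemma mat_adjoint_adjoint [simp]: "mat_adjoint (mat_adjoint A) = A"
  by (simp add: mat_adjoint_def vec_eq_iff)

lemma cinner_vec_mat_adjoint: "cinner_vec (A *v u) v = cinner_vec u (mat_adjoint A *v v)"
proof -
  have "cinner_vec (A *v u) v = (\<Sum>k\<in>UNIV. \<Sum>l\<in>UNIV. A $ k $ l * u $ l * cnj (v $ k))"
    by (simp add: cinner_vec_def matrix_vector_mult_def sum_distrib_right)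
  also have "\<dots> = (\<Sum>l\<in>UNIV. \<Sum>k\<in>UNIV. A $ k $ l * u $ l * cnj (v $ k))" by (rule sum.swap)
  also have "\<dots> = cinner_vec u (mat_adjoint A *v v)"
    by (simp add: cinner_vec_def matrix_vector_mult_def mat_adjoint_def sum_distrib_left algebra_simps)
  finally show ?thesis .
qed

lemma cinner_vec_eq_0_imp_eq_0: "(\<And>u. cinner_vec u v = 0) \<Longrightarrow> v = 0"
  by (metis Re_cinner_vec inner_eq_zero_iff zero_complex.sel(1))

lemma J_mat_mult_J_mat: "J_mat ** J_mat = - (mat 1 :: complex ^ ('p::finite + 'p) ^ ('p + 'p))"
proof -
  have "(\<Sum>k\<in>UNIV. J_mat $ i $ k * J_mat $ k $ j) = (- mat 1 :: complex ^ ('p + 'p) ^ ('p + 'p)) $ i $ j" for i j :: "'p + 'p"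
  proof -
    have "(\<Sum>k\<in>UNIV. J_mat $ i $ k * J_mat $ k $ j) = (\<Sum>k\<in>UNIV. if k = i then J_mat $ i $ i * J_mat $ i $ j else (0::complex))"
      by (intro sum.cong refl) (auto simp: J_mat_def block_mat_def mat_def split: sum.splits)
    also have "\<dots> = J_mat $ i $ i * J_mat $ i $ j" by simp
    also have "\<dots> = (- mat 1 :: complex ^ ('p + 'p) ^ ('p + 'p)) $ i $ j"
      by (auto simp: J_mat_def block_mat_def mat_def split: sum.splits)
    finally show ?thesis .
  qed
  then show ?thesis by (simp add: vec_eq_iff matrix_matrix_mult_def)
qed

lemma mat_adjoint_J_mat: "mat_adjoint J_mat = - J_mat"
  by (auto simp: mat_adjoint_def J_mat_def block_mat_def mat_def vec_eq_iff split: sum.splits)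

lemma J_mat_J_mat_vec [simp]: "J_mat *v (J_mat *v v) = - v"
  by (simp add: matrix_vector_mul_assoc J_mat_mult_J_mat matrix_vector.minus_left)

lemma cinner_vec_J_mat: "cinner_vec (J_mat *v u) v = - cinner_vec u (J_mat *v v)"
  by (simp add: cinner_vec_mat_adjoint mat_adjoint_J_mat matrix_vector.minus_left cinner_vec.minus_right)

lemma swap_mat_mult_left:
  "swap_mat ** A = (\<chi> i j. A $ (case i of Inl a \<Rightarrow> Inr a | Inr a \<Rightarrow> Inl a) $ j)"
proof -
  have "(\<Sum>k\<in>UNIV. swap_mat $ i $ k * A $ k $ j) = A $ (case i of Inl a \<Rightarrow> Inr a | Inr a \<Rightarrow> Inl a) $ j" for i j
  proof -
    have "(\<Sum>k\<in>UNIV. swap_mat $ i $ k * A $ k $ j) =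
      (\<Sum>k\<in>UNIV. if k = (case i of Inl a \<Rightarrow> Inr a | Inr a \<Rightarrow> Inl a) then A $ k $ j else 0)"
      by (intro sum.cong refl) (auto simp: swap_mat_def block_mat_def mat_def split: sum.splits)
    then show ?thesis by simp
  qed
  then show ?thesis by (simp add: vec_eq_iff matrix_matrix_mult_def)
qed

lemma swap_mat_mult_right:
  "A ** swap_mat = (\<chi> i j. A $ i $ (case j of Inl a \<Rightarrow> Inr a | Inr a \<Rightarrow> Inl a))"
proof -
  have "(\<Sum>k\<in>UNIV. A $ i $ k * swap_mat $ k $ j) = A $ i $ (case j of Inl a \<Rightarrow> Inr a | Inr a \<Rightarrow> Inl a)" for i j
  proof -
    have "(\<Sum>k\<in>UNIV. A $ i $ k * swap_mat $ k $ j) =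
      (\<Sum>k\<in>UNIV. if k = (case j of Inl a \<Rightarrow> Inr a | Inr a \<Rightarrow> Inl a) then A $ i $ k else 0)"
      by (intro sum.cong refl) (auto simp: swap_mat_def block_mat_def mat_def split: sum.splits)
    then show ?thesis by simp
  qed
  then show ?thesis by (simp add: vec_eq_iff matrix_matrix_mult_def)
qed

text \<open>The potential of \<open>j D(Q*) j\<close>; the theorem's condition on the blocks says that \<open>Q\<close> is fixed by it.\<close>

definition swap_transpose :: "complex ^ ('p::finite + 'p) ^ ('p + 'p) \<Rightarrow> complex ^ ('p + 'p) ^ ('p + 'p)" where
  "swap_transpose A = swap_mat ** transpose A ** swap_mat"

lemma linear_swap_transpose: "linear swap_transpose"
  by (auto simp: swap_transpose_def linear_iff swap_mat_mult_left swap_mat_mult_right transpose_def vec_eq_iff)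

lemma swap_transpose_block_mat:
  "swap_transpose (block_mat A B C D) = block_mat (transpose D) (transpose B) (transpose C) (transpose A)"
  by (auto simp: swap_transpose_def swap_mat_mult_left swap_mat_mult_right transpose_def block_mat_def vec_eq_iff split: sum.splits)

lemma swap_transpose_block_mat_eq_iff:
  "swap_transpose (block_mat A B C D) = block_mat A B C D \<longleftrightarrow>
     transpose A = D \<and> transpose B = B \<and> transpose C = C"
proof -
  have "block_mat A B C D = block_mat A' B' C' D' \<longleftrightarrow> A = A' \<and> B = B' \<and> C = C' \<and> D = D'" for A' B' C' D'
    by (auto simp: vec_eq_iff block_mat_def split: sum.splits)
  then show ?thesis unfolding swap_transpose_block_mat by (metis transpose_transpose)
qed

definition vec_swap_cnj :: "complex ^ ('p::finite + 'p) \<Rightarrow> complex ^ ('p + 'p)" where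
  "vec_swap_cnj v = swap_mat *v (\<chi> k. cnj (v $ k))"

lemma vec_swap_cnj_nth: "vec_swap_cnj v $ i = cnj (v $ (case i of Inl a \<Rightarrow> Inr a | Inr a \<Rightarrow> Inl a))"
proof -
  have "(\<Sum>k\<in>UNIV. swap_mat $ i $ k * cnj (v $ k)) =
      (\<Sum>k\<in>UNIV. if k = (case i of Inl a \<Rightarrow> Inr a | Inr a \<Rightarrow> Inl a) then cnj (v $ k) else 0)"
    by (intro sum.cong refl) (auto simp: swap_mat_def block_mat_def mat_def split: sum.splits)
  then show ?thesis by (simp add: vec_swap_cnj_def matrix_vector_mult_def)
qed

lemma linear_vec_swap_cnj: "linear vec_swap_cnj"
  unfolding vec_swap_cnj_def[abs_def] by (rule linear_swap_cnj)

lemma vec_swap_cnj_swap_cnj [simp]: "vec_swap_cnj (vec_swap_cnj v) = v"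
  by (auto simp: vec_eq_iff vec_swap_cnj_nth split: sum.splits)

lemma bij_sum_swap: "bij (\<lambda>i :: 'p + 'p. case i of Inl a \<Rightarrow> Inr a | Inr a \<Rightarrow> Inl a)"
  by (rule involuntory_imp_bij) (auto split: sum.splits)

lemma cinner_vec_swap_cnj: "cinner_vec (vec_swap_cnj u) v = cinner_vec (vec_swap_cnj v) u"
proof -
  let ?s = "\<lambda>i :: 'a + 'a. case i of Inl a \<Rightarrow> Inr a | Inr a \<Rightarrow> Inl a"
  have "cinner_vec (vec_swap_cnj u) v = (\<Sum>i\<in>UNIV. cnj (u $ ?s i) * cnj (v $ i))"
    by (simp add: cinner_vec_def vec_swap_cnj_nth)
  also have "\<dots> = (\<Sum>i\<in>UNIV. cnj (u $ ?s (?s i)) * cnj (v $ ?s i))"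
    using sum.reindex_bij_betw[OF bij_sum_swap, of "\<lambda>i. cnj (u $ ?s i) * cnj (v $ i)"] by simp
  also have "\<dots> = (\<Sum>i\<in>UNIV. cnj (v $ ?s i) * cnj (u $ i))"
    by (intro sum.cong refl) (auto split: sum.splits)
  also have "\<dots> = cinner_vec (vec_swap_cnj v) u" by (simp add: cinner_vec_def vec_swap_cnj_nth)
  finally show ?thesis .
qed

text \<open>An antilinear map turns the matrix \<open>A\<close> into its entrywise conjugate, conjugated by the block swap.
The entrywise conjugate is the transpose of the adjoint.\<close>

lemma vec_swap_cnj_mult:
  "vec_swap_cnj (A *v v) = swap_transpose (mat_adjoint A) *v vec_swap_cnj v"
proof -
  let ?s = "\<lambda>i :: 'a + 'a. case i of Inl a \<Rightarrow> Inr a | Inr a \<Rightarrow> Inl a"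
  have "vec_swap_cnj (A *v v) $ i = (swap_transpose (mat_adjoint A) *v vec_swap_cnj v) $ i" for i
  proof -
    have "vec_swap_cnj (A *v v) $ i = (\<Sum>k\<in>UNIV. cnj (A $ ?s i $ k) * cnj (v $ k))"
      by (simp add: vec_swap_cnj_nth matrix_vector_mult_def)
    also have "\<dots> = (\<Sum>k\<in>UNIV. cnj (A $ ?s i $ ?s k) * cnj (v $ ?s k))"
      using sum.reindex_bij_betw[OF bij_sum_swap, of "\<lambda>k. cnj (A $ ?s i $ k) * cnj (v $ k)"] by simp
    also have "\<dots> = (swap_transpose (mat_adjoint A) *v vec_swap_cnj v) $ i"
      by (simp add: swap_transpose_def swap_mat_mult_left swap_mat_mult_right transpose_def mat_adjoint_def
          matrix_vector_mult_def vec_swap_cnj_nth)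
    finally show ?thesis .
  qed
  then show ?thesis by (simp add: vec_eq_iff)
qed

lemma vec_swap_cnj_J_mat:
  fixes v :: "complex ^ ('p::finite + 'p)"
  shows "vec_swap_cnj (J_mat *v v) = J_mat *v vec_swap_cnj v"
proof -
  have "swap_transpose (mat_adjoint J_mat) = (J_mat :: complex ^ ('p + 'p) ^ ('p + 'p))"
    by (auto simp: swap_transpose_def swap_mat_mult_left swap_mat_mult_right transpose_def mat_adjoint_def
        J_mat_def block_mat_def mat_def vec_eq_iff split: sum.splits)
  then show ?thesis by (simp add: vec_swap_cnj_mult)
qed

lemma swap_transpose_involutive [simp]: "swap_transpose (swap_transpose A) = A"
  by (auto simp: swap_transpose_def swap_mat_mult_left swap_mat_mult_right transpose_def vec_eq_iff split: sum.splits)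

lemma mat_adjoint_swap_transpose: "mat_adjoint (swap_transpose A) = swap_transpose (mat_adjoint A)"
  by (auto simp: swap_transpose_def swap_mat_mult_left swap_mat_mult_right transpose_def mat_adjoint_def vec_eq_iff split: sum.splits)


section \<open>Square-integrable functions, adjoints and the conjugation\<close>

lemma abs_L2_eq_iff:
  assumes "sq_integrable f" "sq_integrable g"
  shows "abs_L2 f = abs_L2 g \<longleftrightarrow> (AE x in lebesgue. f x = g x)"
  using Quotient_rel[OF Quotient_L2, of f g] assms by simp

lemma L2_cases:
  obtains f where "sq_integrable f" "u = abs_L2 f"
proof -
  have "abs_L2 (rep_L2 u) = u" using Quotient_abs_rep[OF Quotient_L2] by blast
  moreover have "sq_integrable (rep_L2 u)" using Quotient_rep_reflp[OF Quotient_L2, of u] by blast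
  ultimately show ?thesis by (intro that[of "rep_L2 u"]) auto
qed

lemma cinner_L2_abs:
  assumes "sq_integrable f" "sq_integrable g"
  shows "cinner_L2 (abs_L2 f) (abs_L2 g) = integral\<^sup>L lebesgue (\<lambda>x. cinner_vec (f x) (g x))"
  using assms by (simp add: cinner_L2.abs_eq)

lemma abs_L2_add:
  assumes "sq_integrable f" "sq_integrable g"
  shows "abs_L2 f + abs_L2 g = abs_L2 (\<lambda>x. f x + g x)"
  using assms by (simp add: plus_L2.abs_eq)

lemma cscale_L2_abs:
  assumes "sq_integrable f"
  shows "cscale_L2 c (abs_L2 f) = abs_L2 (\<lambda>x. c *s f x)"
  using assms by (simp add: cscale_L2.abs_eq)

lemma zero_L2_abs: "0 = abs_L2 (\<lambda>x. 0)"
  by (simp add: zero_L2.abs_eq)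

lemma swap_conj_abs:
  assumes "sq_integrable f"
  shows "swap_conj (abs_L2 f) = abs_L2 (\<lambda>x. vec_swap_cnj (f x))"
  using assms by (simp add: swap_conj.abs_eq vec_swap_cnj_def)

lemma norm_abs_L2_diff:
  assumes f: "sq_integrable f" and g: "sq_integrable g"
  shows "norm (abs_L2 f - abs_L2 g) = sqrt (integral\<^sup>L lebesgue (\<lambda>x. (norm (f x - g x))\<^sup>2))"
proof -
  have "sq_integrable (\<lambda>x. (-1) *\<^sub>R g x)" by (rule sq_integrable_linear[OF g linear_scaleR])
  then have "abs_L2 f - abs_L2 g = abs_L2 (\<lambda>x. f x + (-1) *\<^sub>R g x)"
    unfolding minus_L2_def uminus_L2_def using f g
    by (simp add: scaleR_L2.abs_eq plus_L2.abs_eq del: scaleR_minus1_left scaleR_minus_left)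
  moreover have "sq_integrable (\<lambda>x. f x + (-1) *\<^sub>R g x)"
    using \<open>sq_integrable (\<lambda>x. (-1) *\<^sub>R g x)\<close> f by (rule sq_integrable_add[rotated])
  ultimately show ?thesis
    by (simp add: norm_L2_def inner_L2.abs_eq power2_norm_eq_inner)
qed

lemma sq_integrable_bounded:
  fixes w :: "real \<Rightarrow> real"
  assumes "f \<in> borel_measurable lebesgue" "integrable lebesgue (\<lambda>x. (w x)\<^sup>2)" "AE x in lebesgue. norm (f x) \<le> w x"
  shows "sq_integrable f"
  unfolding sq_integrable_def
proof
  show "integrable lebesgue (\<lambda>x. (norm (f x))\<^sup>2)"
  proof (rule Bochner_Integration.integrable_bound[OF assms(2)])
    show "(\<lambda>x. (norm (f x))\<^sup>2) \<in> borel_measurable lebesgue" using assms(1) by measurable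
    show "AE x in lebesgue. norm ((norm (f x))\<^sup>2) \<le> norm ((w x)\<^sup>2)"
      using assms(3) by eventually_elim (simp add: power_mono)
  qed
qed fact

text \<open>Dominated convergence in the Hilbert space; the source of all approximation statements below.\<close>

lemma tendsto_abs_L2_dominated:
  fixes w :: "real \<Rightarrow> real" and f :: "real \<Rightarrow> complex ^ 'n"
  assumes fk: "\<And>k. fk k \<in> borel_measurable lebesgue" and f: "f \<in> borel_measurable lebesgue"
    and w: "integrable lebesgue (\<lambda>x. (w x)\<^sup>2)" 
    and bound: "\<And>k. AE x in lebesgue. norm (fk k x) \<le> w x"
    and lim: "AE x in lebesgue. (\<lambda>k. fk k x) \<longlonglongrightarrow> f x"
  shows "sq_integrable f" "(\<lambda>k. abs_L2 (fk k)) \<longlonglongrightarrow> abs_L2 f"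
proof -
  have "AE x in lebesgue. \<forall>k. norm (fk k x) \<le> w x" using bound by (simp add: AE_all_countable)
  then have fw: "AE x in lebesgue. norm (f x) \<le> w x"
    using lim
  proof eventually_elim
    case (elim x)
    show ?case by (rule LIMSEQ_le_const2[OF tendsto_norm[OF elim(2)]]) (use elim(1) in auto)
  qed
  show sqf: "sq_integrable f" by (rule sq_integrable_bounded[OF f w fw])
  have sqk: "sq_integrable (fk k)" for k by (rule sq_integrable_bounded[OF fk w bound])
  have "(\<lambda>k. integral\<^sup>L lebesgue (\<lambda>x. (norm (fk k x - f x))\<^sup>2)) \<longlonglongrightarrow> integral\<^sup>L lebesgue (\<lambda>x::real. 0::real)"
  proof (rule integral_dominated_convergence[where w = "\<lambda>x. 4 * (w x)\<^sup>2"])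
    show "(\<lambda>x. (norm (fk k x - f x))\<^sup>2) \<in> borel_measurable lebesgue" for k using fk f by measurable
    show "integrable lebesgue (\<lambda>x. 4 * (w x)\<^sup>2)" using w by simp
    show "AE x in lebesgue. (\<lambda>k. (norm (fk k x - f x))\<^sup>2) \<longlonglongrightarrow> 0"
      using lim
    proof eventually_elim
      case (elim x)
      have "(\<lambda>k. (norm (fk k x - f x))\<^sup>2) \<longlonglongrightarrow> (norm (f x - f x))\<^sup>2"
        by (intro tendsto_intros elim)
      then show ?case by simp
    qed
    show "AE x in lebesgue. norm ((norm (fk k x - f x))\<^sup>2) \<le> 4 * (w x)\<^sup>2" for k
      using bound[of k] fw
    proof eventually_elim
      case (elim x)
      have "norm (fk k x - f x) \<le> 2 * w x" using norm_triangle_ineq4[of "fk k x" "f x"] elim by linarith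
      then have "(norm (fk k x - f x))\<^sup>2 \<le> (2 * w x)\<^sup>2" by (intro power_mono) auto
      then show ?case by (simp add: power_mult_distrib)
    qed
  qed auto
  then have "(\<lambda>k. sqrt (integral\<^sup>L lebesgue (\<lambda>x. (norm (fk k x - f x))\<^sup>2))) \<longlonglongrightarrow> sqrt 0"
    by (intro tendsto_real_sqrt) simp
  then have "(\<lambda>k. norm (abs_L2 (fk k) - abs_L2 f)) \<longlonglongrightarrow> 0"
    by (simp add: norm_abs_L2_diff[OF sqk sqf])
  then show "(\<lambda>k. abs_L2 (fk k)) \<longlonglongrightarrow> abs_L2 f"
    by (rule LIM_zero_cancel[OF tendsto_norm_zero_cancel])
qed

lemma integrable_indicat_Icc: "integrable lebesgue (indicat_real {a..b})" for a b :: real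
  by (rule integrable_real_indicator) (use emeasure_lborel_cbox_finite[of a b] in auto)

lemma sq_integrable_imp_L1_loc:
  assumes f: "sq_integrable f" shows "L1_loc f"
  unfolding L1_loc_def set_integrable_def
proof (intro allI)
  fix a b :: real
  show "integrable lebesgue (\<lambda>x. indicat_real {a..b} x *\<^sub>R f x)"
  proof (rule Bochner_Integration.integrable_bound)
    show "integrable lebesgue (\<lambda>x. indicat_real {a..b} x + (norm (f x))\<^sup>2)"
      using f integrable_indicat_Icc by (auto simp: sq_integrable_def)
    show "AE x in lebesgue. norm (indicat_real {a..b} x *\<^sub>R f x) \<le> norm (indicat_real {a..b} x + (norm (f x))\<^sup>2)"
    proof (rule AE_I2)
      fix x
      have "2 * norm (f x) \<le> 1 + (norm (f x))\<^sup>2" using sum_squares_bound[of "1" "norm (f x)"] by simp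
      then have "norm (f x) \<le> 1 + (norm (f x))\<^sup>2" using norm_ge_zero[of "f x"] by linarith
      then show "norm (indicat_real {a..b} x *\<^sub>R f x) \<le> norm (indicat_real {a..b} x + (norm (f x))\<^sup>2)"
        by (auto simp: indicator_def)
    qed
    show "(\<lambda>x. indicat_real {a..b} x *\<^sub>R f x) \<in> borel_measurable lebesgue"
      by (intro borel_measurable_scaleR borel_measurable_indicator sq_integrable_measurable[OF f]) auto
  qed
qed

lemma integrable_cinner_vec:
  assumes f: "sq_integrable f" and g: "sq_integrable g"
  shows "integrable lebesgue (\<lambda>x. cinner_vec (f x) (g x))"
proof -
  obtain K where K: "K > 0" "\<And>u v :: complex ^ 'a. norm (cinner_vec u v) \<le> norm u * norm v * K"
    using cinner_vec.pos_bounded by blast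
  have m: "(\<lambda>x. cinner_vec (f x) (g x)) \<in> borel_measurable lebesgue"
    using sq_integrable_measurable[OF f] sq_integrable_measurable[OF g]
    by (rule borel_measurable_continuous_Pair) (intro cinner_vec.continuous_on continuous_intros)
  show ?thesis
  proof (rule Bochner_Integration.integrable_bound[OF _ m])
    show "integrable lebesgue (\<lambda>x. K * ((norm (f x))\<^sup>2 + (norm (g x))\<^sup>2))"
      using f g by (auto simp: sq_integrable_def)
    show "AE x in lebesgue. norm (cinner_vec (f x) (g x)) \<le> norm (K * ((norm (f x))\<^sup>2 + (norm (g x))\<^sup>2))"
    proof (rule AE_I2)
      fix x
      have "norm (f x) * norm (g x) \<le> (norm (f x))\<^sup>2 + (norm (g x))\<^sup>2"
        using sum_squares_bound[of "norm (f x)" "norm (g x)"] mult_nonneg_nonneg[OF norm_ge_zero[of "f x"] norm_ge_zero[of "g x"]]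
        by linarith
      then have "norm (cinner_vec (f x) (g x)) \<le> ((norm (f x))\<^sup>2 + (norm (g x))\<^sup>2) * K"
        using K by (meson mult_right_mono order_trans less_imp_le)
      then show "norm (cinner_vec (f x) (g x)) \<le> norm (K * ((norm (f x))\<^sup>2 + (norm (g x))\<^sup>2))"
        using K by (simp add: mult.commute)
    qed
  qed
qed

lemma is_conjugation_swap_conj: "is_conjugation (swap_conj :: ('p::finite + 'p) L2 \<Rightarrow> ('p + 'p) L2)"
  unfolding is_conjugation_def
proof (intro conjI allI)
  fix u v :: "('p + 'p) L2" and c
  obtain f where f: "sq_integrable f" "u = abs_L2 f" by (rule L2_cases)
  obtain g where g: "sq_integrable g" "v = abs_L2 g" by (rule L2_cases)
  have s: "sq_integrable (\<lambda>x. vec_swap_cnj (h x))" if "sq_integrable h" for h :: "real \<Rightarrow> complex ^ ('p + 'p)"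
    by (rule sq_integrable_linear[OF that linear_vec_swap_cnj])
  show "swap_conj (u + v) = swap_conj u + swap_conj v"
    using f g s sq_integrable_add[OF f(1) g(1)]
    by (simp add: abs_L2_add swap_conj_abs linear_add[OF linear_vec_swap_cnj])
  show "swap_conj (cscale_L2 c u) = cscale_L2 (cnj c) (swap_conj u)"
  proof -
    have "vec_swap_cnj (c *s w) = cnj c *s vec_swap_cnj w" for w :: "complex ^ ('p + 'p)"
      by (simp add: vec_eq_iff vec_swap_cnj_nth)
    then show ?thesis
      using f s sq_integrable_linear[OF f(1) linear_vector_scalar_mult, of c]
      by (simp add: cscale_L2_abs swap_conj_abs)
  qed
  show "swap_conj (swap_conj u) = u" using f s by (simp add: swap_conj_abs)
  show "cinner_L2 (swap_conj u) v = cinner_L2 (swap_conj v) u"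
    using f g s by (simp add: swap_conj_abs cinner_L2_abs cinner_vec_swap_cnj[of "f _"])
qed

text \<open>This expresses the complex inner product by the real one, which is known to be continuous.\<close>

lemma cinner_L2_conv_inner_right: "cinner_L2 u v = Complex (u \<bullet> v) (u \<bullet> cscale_L2 \<i> v)"
proof -
  obtain f where f: "sq_integrable f" "u = abs_L2 f" by (rule L2_cases)
  obtain g where g: "sq_integrable g" "v = abs_L2 g" by (rule L2_cases)
  have f': "sq_integrable (\<lambda>x. \<i> *s g x)" by (rule sq_integrable_linear[OF g(1) linear_vector_scalar_mult])
  note i = integrable_cinner_vec[OF f(1) g(1)]
  have *: "Im (cinner_vec a b) = a \<bullet> (\<i> *s b)" for a b :: "complex ^ 'a"
    by (simp add: Re_cinner_vec[symmetric] cinner_vec_def sum_negf[symmetric])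
  have "Re (cinner_L2 u v) = u \<bullet> v"
    using f g i by (simp add: cinner_L2_abs inner_L2.abs_eq integral_Re[symmetric] Re_cinner_vec)
  moreover have "Im (cinner_L2 u v) = u \<bullet> cscale_L2 \<i> v"
    using f g i f' by (simp add: cinner_L2_abs inner_L2.abs_eq cscale_L2_abs integral_Im[symmetric] *)
  ultimately show ?thesis by (simp add: complex_eq_iff)
qed

lemma closed_op_adjoint_right:
  "closed {(u, u'). cinner_L2 u' v = cinner_L2 u w}"
proof -
  have "{(u, u'). cinner_L2 u' v = cinner_L2 u w} =
    {p. snd p \<bullet> v = fst p \<bullet> w} \<inter> {p. snd p \<bullet> cscale_L2 \<i> v = fst p \<bullet> cscale_L2 \<i> w}"
    by (auto simp: cinner_L2_conv_inner_right)
  also have "closed \<dots>"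
    by (intro closed_Int closed_Collect_eq continuous_intros)
  finally show ?thesis .
qed

text \<open>Passing from the compactly supported functions to the minimal operator does not change the adjoint.\<close>

lemma op_adjoint_closure: "op_adjoint (closure A) = op_adjoint A"
proof
  show "op_adjoint (closure A) \<subseteq> op_adjoint A"
    using closure_subset[of A] unfolding op_adjoint_def by blast
  show "op_adjoint A \<subseteq> op_adjoint (closure A)"
  proof (clarsimp simp: op_adjoint_def)
    fix v w u u'
    assume "\<forall>(u, u')\<in>A. cinner_L2 u' v = cinner_L2 u w" "(u, u') \<in> closure A"
    moreover from this(1) have "closure A \<subseteq> {(u, u'). cinner_L2 u' v = cinner_L2 u w}"
      by (intro closure_minimal closed_op_adjoint_right) auto
    ultimately show "cinner_L2 u' v = cinner_L2 u w" by blast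
  qed
qed

lemma cinner_L2_cnj: "cinner_L2 u v = cnj (cinner_L2 v u)"
proof -
  obtain f where f: "sq_integrable f" "u = abs_L2 f" by (rule L2_cases)
  obtain g where g: "sq_integrable g" "v = abs_L2 g" by (rule L2_cases)
  have "cinner_vec (f x) (g x) = cnj (cinner_vec (g x) (f x))" for x
    by (simp add: cinner_vec_def mult.commute)
  then show ?thesis
    unfolding f(2) g(2) cinner_L2_abs[OF f(1) g(1)] cinner_L2_abs[OF g(1) f(1)] by simp
qed

lemma closed_op_adjoint: "closed (op_adjoint A)"
proof -
  have "closed {(v, w). cinner_L2 u' v = cinner_L2 u w}" for u u' :: "'a L2"
  proof -
    have "cinner_L2 u' v = cinner_L2 u w \<longleftrightarrow> cinner_L2 v u' = cinner_L2 w u" for v w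
      by (metis cinner_L2_cnj)
    then have "{(v, w). cinner_L2 u' v = cinner_L2 u w} =
      {p. fst p \<bullet> u' = snd p \<bullet> u} \<inter> {p. fst p \<bullet> cscale_L2 \<i> u' = snd p \<bullet> cscale_L2 \<i> u}"
      by (auto simp: cinner_L2_conv_inner_right)
    also have "closed \<dots>" by (intro closed_Int closed_Collect_eq continuous_intros)
    finally show ?thesis .
  qed
  then have "closed (\<Inter>p\<in>A. {(v, w). cinner_L2 (snd p) v = cinner_L2 (fst p) w})" by (intro closed_INT) auto
  also have "(\<Inter>p\<in>A. {(v, w). cinner_L2 (snd p) v = cinner_L2 (fst p) w}) = op_adjoint A"
    unfolding op_adjoint_def by fastforce
  finally show ?thesis .
qed


section \<open>The maximal operator and its restriction to compact supports\<close>

lemma continuous_AE_eq_imp_eq: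
  fixes f g :: "real \<Rightarrow> 'a::euclidean_space"
  assumes "continuous_on UNIV f" "continuous_on UNIV g" "AE x in lebesgue. f x = g x"
  shows "f = g"
proof -
  have "open {x. f x \<noteq> g x}" by (rule open_Collect_neq) fact+
  moreover obtain N where N: "negligible N" "{x. f x \<noteq> g x} \<subseteq> N" by (rule AE_negligibleE[OF assms(3)])
  ultimately have "{x. f x \<noteq> g x} = {}" using open_not_negligible negligible_subset[OF N] by blast
  then show ?thesis by auto
qed

text \<open>Since \<open>J\<close> squares to \<open>-1\<close>, the differential expression can be solved for the derivative of \<open>y\<close>. The
right-hand side is locally integrable because \<open>y\<close> is continuous.\<close>

lemma dirac_rep_iff_local_primitive:
  fixes Q :: "real \<Rightarrow> complex ^ ('p::finite + 'p) ^ ('p + 'p)"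
  assumes Q: "L1_loc Q"
  shows "dirac_rep Q y z \<longleftrightarrow> sq_integrable y \<and> sq_integrable z \<and>
           local_primitive y (\<lambda>x. J_mat *v (Q x *v y x - z x))"
proof -
  have eq: "z' = J_mat *v y' + w \<longleftrightarrow> y' = J_mat *v (w - z')" for z' y' w :: "complex ^ ('p + 'p)"
  proof
    show "y' = J_mat *v (w - z')" if "z' = J_mat *v y' + w" using that by (simp add: matrix_vector.minus_right)
    show "z' = J_mat *v y' + w" if "y' = J_mat *v (w - z')" using that by simp
  qed
  have ae: "(AE x in lebesgue. \<exists>y'. (y has_vector_derivative y') (at x) \<and> z x = J_mat *v y' + Q x *v y x)
     \<longleftrightarrow> (AE x in lebesgue. (y has_vector_derivative J_mat *v (Q x *v y x - z x)) (at x))"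
    unfolding eq by simp
  show ?thesis
  proof
    assume d: "dirac_rep Q y z"
    then have y: "sq_integrable y" "AC_loc y" "sq_integrable z" by (auto simp: dirac_rep_def)
    have "L1_loc (\<lambda>x. J_mat *v (Q x *v y x - z x))"
      by (intro L1_loc_linear[where h = "(*v) J_mat"] L1_loc_diff L1_loc_bilinear_continuous2[OF bounded_bilinear_matrix_vector_mult Q]
          AC_loc_continuous y sq_integrable_imp_L1_loc) simp
    then show "sq_integrable y \<and> sq_integrable z \<and> local_primitive y (\<lambda>x. J_mat *v (Q x *v y x - z x))"
      using d y unfolding dirac_rep_def ae by (auto intro: local_primitiveI_AC_loc)
  next
    assume "sq_integrable y \<and> sq_integrable z \<and> local_primitive y (\<lambda>x. J_mat *v (Q x *v y x - z x))"
    then show "dirac_rep Q y z" unfolding dirac_rep_def ae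
      using local_primitive_AC_loc local_primitive_has_derivative_AE by blast
  qed
qed

lemma dirac_repD:
  assumes "L1_loc Q" "dirac_rep Q y z"
  shows "sq_integrable y" "sq_integrable z" "local_primitive y (\<lambda>x. J_mat *v (Q x *v y x - z x))" "continuous_on UNIV y"
  using assms(2) local_primitive_continuous unfolding dirac_rep_iff_local_primitive[OF assms(1)] by blast+

lemma dirac_rep_AE_eq:
  assumes Q: "L1_loc Q" and "dirac_rep Q y z" "dirac_rep Q y z'"
  shows "AE x in lebesgue. z x = z' x"
proof -
  have "AE x in lebesgue. J_mat *v (Q x *v y x - z x) = J_mat *v (Q x *v y x - z' x)"
    by (rule local_primitive_unique_AE[OF dirac_repD(3)[OF Q assms(2)] dirac_repD(3)[OF Q assms(3)]])
  then show ?thesis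
  proof eventually_elim
    case (elim x)
    then have "J_mat *v (J_mat *v (Q x *v y x - z x)) = J_mat *v (J_mat *v (Q x *v y x - z' x))" by simp
    then show ?case by simp
  qed
qed

lemma L1_loc_mat_adjoint: "L1_loc Q \<Longrightarrow> L1_loc (\<lambda>x. mat_adjoint (Q x))"
  by (rule L1_loc_linear[OF _ linear_mat_adjoint])

lemma L1_loc_swap_transpose: "L1_loc Q \<Longrightarrow> L1_loc (\<lambda>x. swap_transpose (Q x))"
  by (rule L1_loc_linear[OF _ linear_swap_transpose])

lemma abs_L2_in_D_max: "dirac_rep Q y z \<Longrightarrow> (abs_L2 y, abs_L2 z) \<in> D_max Q"
  unfolding D_max_def by blast

lemma dirac_rep_add:
  assumes Q: "L1_loc Q" and d1: "dirac_rep Q y z" and d2: "dirac_rep Q y' z'"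
  shows "dirac_rep Q (\<lambda>x. y x + y' x) (\<lambda>x. z x + z' x)"
proof -
  have "J_mat *v (Q x *v (y x + y' x) - (z x + z' x))
      = J_mat *v (Q x *v y x - z x) + J_mat *v (Q x *v y' x - z' x)" for x
    unfolding matrix_vector.add_right[of "Q x"] add_diff_add by (rule matrix_vector.add_right)
  then show ?thesis
    using local_primitive_add[OF dirac_repD(3)[OF Q d1] dirac_repD(3)[OF Q d2]]
      sq_integrable_add[OF dirac_repD(1)[OF Q d1] dirac_repD(1)[OF Q d2]]
      sq_integrable_add[OF dirac_repD(2)[OF Q d1] dirac_repD(2)[OF Q d2]]
    by (simp add: dirac_rep_iff_local_primitive[OF Q])
qed

lemma matrix_vector_scale: "A *v (c *s v) = c *s (A *v v)" for A :: "complex ^ 'n ^ 'm"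
  by (simp add: vec_eq_iff matrix_vector_mult_def sum_distrib_left algebra_simps)

lemma dirac_rep_scale:
  assumes Q: "L1_loc Q" and d: "dirac_rep Q y z"
  shows "dirac_rep Q (\<lambda>x. c *s y x) (\<lambda>x. c *s z x)"
proof -
  have "J_mat *v (Q x *v (c *s y x) - c *s z x) = c *s (J_mat *v (Q x *v y x - z x))" for x
    unfolding matrix_vector_scale vector_ssub_ldistrib[symmetric] ..
  then show ?thesis
    using local_primitive_linear[OF dirac_repD(3)[OF Q d] linear_vector_scalar_mult[of c]]
      sq_integrable_linear[OF dirac_repD(1)[OF Q d] linear_vector_scalar_mult]
      sq_integrable_linear[OF dirac_repD(2)[OF Q d] linear_vector_scalar_mult]
    by (simp add: dirac_rep_iff_local_primitive[OF Q])
qed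

text \<open>The graph is single-valued because a continuous representative of a class is unique, and its
derivative determines the image.\<close>

lemma is_operator_D_max:
  assumes Q: "L1_loc Q"
  shows "is_operator (D_max Q)"
  unfolding is_operator_def
proof (intro conjI)
  note D = dirac_repD[OF Q]
  show "single_valued (D_max Q)"
  proof (rule single_valuedI)
    fix u v w assume "(u, v) \<in> D_max Q" "(u, w) \<in> D_max Q"
    then obtain y z y' z' where 1: "u = abs_L2 y" "v = abs_L2 z" "dirac_rep Q y z"
      and 2: "u = abs_L2 y'" "w = abs_L2 z'" "dirac_rep Q y' z'" unfolding D_max_def by blast
    have "AE x in lebesgue. y x = y' x"
      using abs_L2_eq_iff[OF D(1)[OF 1(3)] D(1)[OF 2(3)]] 1(1) 2(1) by simp
    then have "y = y'" by (rule continuous_AE_eq_imp_eq[OF D(4)[OF 1(3)] D(4)[OF 2(3)]])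
    then have "dirac_rep Q y z'" using 2(3) by simp
    then show "v = w"
      using dirac_rep_AE_eq[OF Q 1(3)] abs_L2_eq_iff[OF D(2)[OF 1(3)] D(2)[OF 2(3)]] 1(2) 2(2) by simp
  qed
  have "dirac_rep Q (\<lambda>x. 0) (\<lambda>x. 0)"
    by (simp add: dirac_rep_iff_local_primitive[OF Q] sq_integrable_zero local_primitive_const)
  then show "(0, 0) \<in> D_max Q" unfolding zero_L2_abs by (rule abs_L2_in_D_max)
  show "\<forall>(u, u')\<in>D_max Q. \<forall>(v, v')\<in>D_max Q. (u + v, u' + v') \<in> D_max Q"
  proof clarify
    fix u u' v v' assume "(u, u') \<in> D_max Q" "(v, v') \<in> D_max Q"
    then obtain y z y' z' where eq: "u = abs_L2 y" "u' = abs_L2 z" "v = abs_L2 y'" "v' = abs_L2 z'"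
      and 1: "dirac_rep Q y z" and 2: "dirac_rep Q y' z'" unfolding D_max_def by blast
    show "(u + v, u' + v') \<in> D_max Q"
      unfolding eq abs_L2_add[OF D(1)[OF 1] D(1)[OF 2]] abs_L2_add[OF D(2)[OF 1] D(2)[OF 2]]
      by (rule abs_L2_in_D_max[OF dirac_rep_add[OF Q 1 2]])
  qed
  show "\<forall>c. \<forall>(u, u')\<in>D_max Q. (cscale_L2 c u, cscale_L2 c u') \<in> D_max Q"
  proof clarify
    fix c u u' assume "(u, u') \<in> D_max Q"
    then obtain y z where eq: "u = abs_L2 y" "u' = abs_L2 z" and 1: "dirac_rep Q y z" unfolding D_max_def by blast
    show "(cscale_L2 c u, cscale_L2 c u') \<in> D_max Q"
      unfolding eq cscale_L2_abs[OF D(1)[OF 1]] cscale_L2_abs[OF D(2)[OF 1]]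
      by (rule abs_L2_in_D_max[OF dirac_rep_scale[OF Q 1]])
  qed
qed

text \<open>The restriction of the maximal operator to functions of compact support, of which the minimal
operator is the closure.\<close>

definition D_cpt :: "(real \<Rightarrow> complex ^ ('p::finite + 'p) ^ ('p + 'p)) \<Rightarrow> (('p + 'p) L2 \<times> ('p + 'p) L2) set" where
  "D_cpt Q = {(abs_L2 y, abs_L2 z) | y z. dirac_rep Q y z \<and> compact (closure {x. y x \<noteq> 0})}"

lemma D_min_eq_closure: "D_min Q = closure (D_cpt Q)"
  by (simp add: D_min_def D_cpt_def)

lemma D_cptI:
  assumes "dirac_rep Q y z" "\<And>x. x \<notin> {a..b} \<Longrightarrow> y x = 0"
  shows "(abs_L2 y, abs_L2 z) \<in> D_cpt Q"
proof -
  have "{x. y x \<noteq> 0} \<subseteq> {a..b}" using assms(2) by blast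
  then have "bounded {x. y x \<noteq> 0}" by (rule bounded_subset[OF bounded_closed_interval])
  then have "compact (closure {x. y x \<noteq> 0})" by (simp add: compact_closure)
  then show ?thesis using assms(1) unfolding D_cpt_def by blast
qed

lemma D_cptE:
  assumes "(u, u') \<in> D_cpt Q"
  obtains y z n where "u = abs_L2 y" "u' = abs_L2 z" "dirac_rep Q y z" "\<forall>x. real n \<le> \<bar>x\<bar> \<longrightarrow> y x = 0"
proof -
  obtain y z where yz: "u = abs_L2 y" "u' = abs_L2 z" "dirac_rep Q y z" "compact (closure {x. y x \<noteq> 0})"
    using assms unfolding D_cpt_def by blast
  then have "bounded {x. y x \<noteq> 0}" using bounded_subset[OF compact_imp_bounded closure_subset] by blast
  then obtain B where B: "\<forall>x\<in>{x. y x \<noteq> 0}. norm x \<le> B" unfolding bounded_iff by blast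
  obtain n :: nat where "B < real n" using reals_Archimedean2 by blast
  then have "y x = 0" if "real n \<le> \<bar>x\<bar>" for x using B that by (cases "y x = 0") auto
  then show ?thesis using that[OF yz(1-3)] by blast
qed

lemma integral_tendsto_symmetric_intervals:
  fixes k :: "real \<Rightarrow> 'a::euclidean_space"
  assumes "integrable lebesgue k"
  shows "(\<lambda>n. integral {- real n..real n} k) \<longlonglongrightarrow> integral\<^sup>L lebesgue k"
proof -
  have "(\<lambda>n. integral\<^sup>L lebesgue (\<lambda>x. indicator {- real n..real n} x *\<^sub>R k x)) \<longlonglongrightarrow> integral\<^sup>L lebesgue k"
  proof (rule integral_dominated_convergence[where w = "\<lambda>x. norm (k x)"])
    show "AE x in lebesgue. (\<lambda>n. indicator {- real n..real n} x *\<^sub>R k x) \<longlonglongrightarrow> k x"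
    proof (rule AE_I2, rule tendsto_eventually)
      fix x :: real
      show "\<forall>\<^sub>F n in sequentially. indicator {- real n..real n} x *\<^sub>R k x = k x"
        using eventually_ge_at_top[of "nat \<lceil>\<bar>x\<bar>\<rceil>"]
      proof eventually_elim
        case (elim n)
        then have "\<bar>x\<bar> \<le> real n" by (simp add: nat_le_iff ceiling_le_iff)
        then show ?case by (auto simp: indicator_def)
      qed
    qed
    show "(\<lambda>x. indicator {- real n..real n} x *\<^sub>R k x) \<in> borel_measurable lebesgue" for n
      by (intro borel_measurable_scaleR borel_measurable_indicator borel_measurable_integrable[OF assms]) auto
  qed (use assms in \<open>auto simp: indicator_def\<close>)
  moreover have "integral\<^sup>L lebesgue (\<lambda>x. indicator {- real n..real n} x *\<^sub>R k x) = integral {- real n..real n} k" for n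
  proof -
    have "set_integrable lebesgue {- real n..real n} k"
      unfolding set_integrable_def using assms by (intro integrable_mult_indicator) auto
    from set_lebesgue_integral_eq_integral(2)[OF this] show ?thesis by (simp add: set_lebesgue_integral_def)
  qed
  ultimately show ?thesis by simp
qed

text \<open>Lagrange's identity. In the product rule both terms with \<open>Q\<close> cancel, since one contains \<open>Q\<close> and the other its adjoint.\<close>

lemma cinner_vec_dirac_local_primitive:
  assumes Q: "L1_loc Q" and yz: "dirac_rep Q y z" and vw: "dirac_rep (\<lambda>x. mat_adjoint (Q x)) v w"
  shows "local_primitive (\<lambda>x. cinner_vec (J_mat *v y x) (v x)) (\<lambda>x. cinner_vec (z x) (v x) - cinner_vec (y x) (w x))"
proof -
  let ?Y = "\<lambda>x. J_mat *v (Q x *v y x - z x)" and ?V = "\<lambda>x. J_mat *v (mat_adjoint (Q x) *v v x - w x)"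
  have 1: "local_primitive (\<lambda>x. J_mat *v y x) (\<lambda>x. J_mat *v ?Y x)"
    by (rule local_primitive_linear[OF dirac_repD(3)[OF Q yz]]) simp
  have "local_primitive (\<lambda>x. cinner_vec (J_mat *v y x) (v x))
     (\<lambda>x. cinner_vec (J_mat *v y x) (?V x) + cinner_vec (J_mat *v ?Y x) (v x))"
    by (rule local_primitive_bilinear[OF bounded_bilinear_cinner_vec 1 dirac_repD(3)[OF L1_loc_mat_adjoint[OF Q] vw]])
  moreover have "cinner_vec (J_mat *v y x) (?V x) + cinner_vec (J_mat *v ?Y x) (v x)
      = cinner_vec (z x) (v x) - cinner_vec (y x) (w x)" for x
    by (simp add: cinner_vec_J_mat cinner_vec.minus_left cinner_vec.minus_right cinner_vec.diff_left
        cinner_vec.diff_right cinner_vec_mat_adjoint[of "Q x"])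
  ultimately show ?thesis by simp
qed

text \<open>Lagrange's identity integrated over a symmetric interval that contains the support of \<open>y\<close>, so that
there are no boundary terms.\<close>

lemma D_max_mat_adjoint_subset_op_adjoint:
  assumes Q: "L1_loc Q"
  shows "D_max (\<lambda>x. mat_adjoint (Q x)) \<subseteq> op_adjoint (D_cpt Q)"
proof (clarsimp simp: op_adjoint_def)
  fix v' w' u u' assume "(v', w') \<in> D_max (\<lambda>x. mat_adjoint (Q x))" and uu: "(u, u') \<in> D_cpt Q"
  then obtain v w where vw: "v' = abs_L2 v" "w' = abs_L2 w" "dirac_rep (\<lambda>x. mat_adjoint (Q x)) v w"
    unfolding D_max_def by blast
  obtain y z n where yz: "u = abs_L2 y" "u' = abs_L2 z" "dirac_rep Q y z" "\<forall>x. real n \<le> \<bar>x\<bar> \<longrightarrow> y x = 0"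
    by (rule D_cptE[OF uu])
  note y = dirac_repD[OF Q yz(3)] and v = dirac_repD[OF L1_loc_mat_adjoint[OF Q] vw(3)]
  note i = integrable_cinner_vec[OF y(2) v(1)] integrable_cinner_vec[OF y(1) v(2)]
  let ?k = "\<lambda>x. cinner_vec (z x) (v x) - cinner_vec (y x) (w x)"
  have "(\<lambda>m. integral {- real m..real m} ?k) \<longlonglongrightarrow> integral\<^sup>L lebesgue ?k"
    by (rule integral_tendsto_symmetric_intervals) (use i in auto)
  moreover have "\<forall>\<^sub>F m in sequentially. integral {- real m..real m} ?k = 0"
    using eventually_ge_at_top[of n]
  proof eventually_elim
    case (elim m)
    have "integral {- real m..real m} ?k = cinner_vec (J_mat *v y (real m)) (v (real m)) - cinner_vec (J_mat *v y (- real m)) (v (- real m))"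
      by (rule local_primitiveD(2)[OF cinner_vec_dirac_local_primitive[OF Q yz(3) vw(3)]]) simp
    moreover have "y (real m) = 0" "y (- real m) = 0" using yz(4) elim by auto
    ultimately show ?case by (simp add: cinner_vec.zero_left)
  qed
  ultimately have "integral\<^sup>L lebesgue ?k = 0"
    by (blast intro: LIMSEQ_unique tendsto_eventually)
  then show "cinner_L2 u' v' = cinner_L2 u w'"
    unfolding yz(1,2) vw(1,2) cinner_L2_abs[OF y(2) v(1)] cinner_L2_abs[OF y(1) v(2)] using i by simp
qed


section \<open>Fundamental matrices and test functions\<close>

lemma J_mat_cancel: "J_mat ** (J_mat ** A) = - A" for A :: "complex ^ 'n ^ ('p::finite + 'p)"
  by (simp add: matrix_mul_assoc J_mat_mult_J_mat matrix_mult.minus_left)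

lemma local_primitive_zero_const:
  assumes F: "local_primitive F (\<lambda>x. 0)" shows "F x = F y"
proof -
  have "F b = F a" if "a \<le> b" for a b
    using local_primitiveD(2)[OF F that] by simp
  from this[of x y] this[of y x] show ?thesis by (cases "x \<le> y") auto
qed

text \<open>By Lagrange's identity \<open>Z* J Y\<close> is constant, and the initial values make it \<open>J\<close>. As square matrices
have two-sided inverses, this one identity gives both the inverse \<open>W\<close> of \<open>Y\<close> and the identity
\<open>Z J Y* = J\<close>.\<close>

lemma dirac_fundamental_systems:
  fixes Q :: "real \<Rightarrow> complex ^ ('p::finite + 'p) ^ ('p + 'p)"
  assumes Q: "L1_loc Q"
  obtains Y Z W :: "real \<Rightarrow> complex ^ ('p + 'p) ^ ('p + 'p)" where "local_primitive Y (\<lambda>x. J_mat ** Q x ** Y x)"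
    "local_primitive Z (\<lambda>x. J_mat ** mat_adjoint (Q x) ** Z x)"
    "\<forall>x. Z x ** J_mat ** mat_adjoint (Y x) = J_mat"
    "continuous_on UNIV W" "\<forall>x. Y x ** W x = mat 1"
proof -
  have lJ: "linear (\<lambda>A :: complex ^ ('p + 'p) ^ ('p + 'p). J_mat ** A)"
    and rJ: "linear (\<lambda>A :: complex ^ ('p + 'p) ^ ('p + 'p). A ** J_mat)"
    using matrix_mult.bounded_linear_right matrix_mult.bounded_linear_left by (simp_all add: linear_conv_bounded_linear)
  obtain Y where Y0: "Y 0 = mat 1" and Y: "local_primitive Y (\<lambda>x. J_mat ** Q x ** Y x)"
    using linear_ode_exists[OF bounded_bilinear_matrix_mult L1_loc_linear[OF Q lJ]] by blast
  obtain Z where Z0: "Z 0 = mat 1" and Z: "local_primitive Z (\<lambda>x. J_mat ** mat_adjoint (Q x) ** Z x)"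
    using linear_ode_exists[OF bounded_bilinear_matrix_mult L1_loc_linear[OF L1_loc_mat_adjoint[OF Q] lJ]] by blast
  have ZJ: "local_primitive (\<lambda>x. mat_adjoint (Z x) ** J_mat) (\<lambda>x. mat_adjoint (J_mat ** mat_adjoint (Q x) ** Z x) ** J_mat)"
    by (rule local_primitive_linear[OF local_primitive_linear[OF Z linear_mat_adjoint] rJ])
  have "local_primitive (\<lambda>x. mat_adjoint (Z x) ** J_mat ** Y x)
     (\<lambda>x. mat_adjoint (Z x) ** J_mat ** (J_mat ** Q x ** Y x) + mat_adjoint (J_mat ** mat_adjoint (Q x) ** Z x) ** J_mat ** Y x)"
    by (rule local_primitive_bilinear[OF bounded_bilinear_matrix_mult ZJ Y])
  moreover have "mat_adjoint (Z x) ** J_mat ** (J_mat ** Q x ** Y x) + mat_adjoint (J_mat ** mat_adjoint (Q x) ** Z x) ** J_mat ** Y x = 0" for x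
    by (simp add: mat_adjoint_mult matrix_mul_assoc[symmetric] J_mat_cancel mat_adjoint_J_mat
        matrix_mult.minus_left matrix_mult.minus_right)
  ultimately have "local_primitive (\<lambda>x. mat_adjoint (Z x) ** J_mat ** Y x) (\<lambda>x. 0)" by simp
  from local_primitive_zero_const[OF this, of _ 0]
  have "mat_adjoint (Z x) ** J_mat ** Y x = mat_adjoint (mat 1) ** J_mat" for x by (simp add: Y0 Z0)
  moreover have "mat_adjoint (mat 1) = (mat 1 :: complex ^ ('p + 'p) ^ ('p + 'p))"
    by (auto simp: mat_adjoint_def mat_def vec_eq_iff)
  ultimately have R: "mat_adjoint (Z x) ** (J_mat ** Y x) = J_mat" for x by (simp add: matrix_mul_assoc)
  \<comment> \<open>The candidate comes from \<open>Z* J Y = J\<close> and from \<open>-J\<close> being the inverse of \<open>J\<close>.\<close>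
  define W where "W x = - (J_mat ** (mat_adjoint (Z x) ** J_mat))" for x
  have Wc: "continuous_on UNIV W"
    unfolding W_def
    by (intro continuous_intros linear_continuous_on_compose[OF local_primitive_continuous[OF ZJ] lJ])
  have "W x ** Y x = mat 1" for x
    using R[of x] by (simp add: W_def matrix_mul_assoc[symmetric] matrix_mult.minus_left J_mat_mult_J_mat)
  then have YW: "Y x ** W x = mat 1" for x by (rule iffD1[OF matrix_left_right_inverse])
  have "Z x ** J_mat ** mat_adjoint (Y x) = J_mat" for x
  proof -
    have "mat_adjoint (mat_adjoint (Z x) ** (J_mat ** Y x)) = mat_adjoint J_mat" by (simp add: R)
    then have "mat_adjoint (Y x) ** (J_mat ** Z x) = J_mat"
      by (simp add: mat_adjoint_mult mat_adjoint_J_mat matrix_mult.minus_left matrix_mult.minus_right matrix_mul_assoc[symmetric])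
    then have "(- (J_mat ** (mat_adjoint (Y x) ** J_mat))) ** Z x = mat 1"
      by (simp add: matrix_mul_assoc[symmetric] matrix_mult.minus_left J_mat_mult_J_mat)
    then have "Z x ** (- (J_mat ** (mat_adjoint (Y x) ** J_mat))) = mat 1" by (rule iffD1[OF matrix_left_right_inverse])
    then have "Z x ** (- (J_mat ** (mat_adjoint (Y x) ** J_mat))) ** J_mat = J_mat" by simp
    then show ?thesis
      by (simp add: matrix_mul_assoc[symmetric] matrix_mult.minus_left matrix_mult.minus_right J_mat_mult_J_mat)
  qed
  then show ?thesis using YW by (intro that[OF Y Z _ Wc]) auto
qed

lemma sq_integrable_bounded_compact_support:
  assumes "f \<in> borel_measurable lebesgue" "\<And>x. norm (f x) \<le> C" "\<And>x. x \<notin> {a..b} \<Longrightarrow> f x = 0"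
  shows "sq_integrable f"
proof (rule sq_integrable_bounded[OF assms(1)])
  have "integrable lebesgue (\<lambda>x. C\<^sup>2 * indicat_real {a..b} x)"
    using integrable_indicat_Icc by (rule integrable_mult_right)
  moreover have "(\<lambda>x. (C * indicat_real {a..b} x)\<^sup>2) = (\<lambda>x. C\<^sup>2 * indicat_real {a..b} x)"
    by (auto simp: fun_eq_iff indicator_def)
  ultimately show "integrable lebesgue (\<lambda>x. (C * indicat_real {a..b} x)\<^sup>2)" by (simp only:)
  show "AE x in lebesgue. norm (f x) \<le> C * indicat_real {a..b} x"
    using assms(2,3) by (intro AE_I2) (auto simp: indicator_def)
qed

lemma continuous_compact_support_bounded:
  fixes f :: "real \<Rightarrow> 'a::real_normed_vector"
  assumes "continuous_on UNIV f" "\<And>x. x \<notin> {a..b} \<Longrightarrow> f x = 0"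
  obtains C where "\<forall>x. norm (f x) \<le> C"
proof -
  have "bounded (f ` {a..b})"
    by (intro compact_imp_bounded compact_continuous_image continuous_on_subset[OF assms(1)]) auto
  then obtain B where "\<forall>v\<in>f ` {a..b}. norm v \<le> B" unfolding bounded_iff by blast
  then have "\<forall>x. norm (f x) \<le> max B 0" using assms(2) by (metis image_eqI le_max_iff_disj norm_zero order_refl)
  then show ?thesis by (rule that)
qed

lemma sq_integrable_continuous_compact_support:
  fixes f :: "real \<Rightarrow> complex ^ 'n"
  assumes "continuous_on UNIV f" "\<And>x. x \<notin> {a..b} \<Longrightarrow> f x = 0"
  shows "sq_integrable f"
proof -
  obtain C where C: "\<forall>x. norm (f x) \<le> C" by (rule continuous_compact_support_bounded[OF assms])
  show ?thesis
    by (rule sq_integrable_bounded_compact_support[where a=a and b=b and C=C])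
      (use L1_loc_borel_measurable[OF L1_loc_continuous[OF assms(1)]] assms(2) C in auto)
qed

lemma borel_measurable_matrix_vector_mult:
  fixes M :: "real \<Rightarrow> complex ^ 'n ^ 'm"
  assumes "M \<in> borel_measurable lebesgue" "f \<in> borel_measurable lebesgue"
  shows "(\<lambda>x. M x *v f x) \<in> borel_measurable lebesgue"
  using assms by (rule borel_measurable_continuous_Pair) (intro matrix_vector.continuous_on continuous_intros)

lemma sq_integrable_continuous_mult:
  fixes M :: "real \<Rightarrow> complex ^ 'n ^ 'm"
  assumes M: "continuous_on UNIV M" and f: "sq_integrable f" and supp: "\<And>x. x \<notin> {a..b} \<Longrightarrow> f x = 0"
  shows "sq_integrable (\<lambda>x. M x *v f x)"
proof -
  obtain K where K: "K > 0" "\<And>(A :: complex ^ 'n ^ 'm) v. norm (A *v v) \<le> norm A * norm v * K"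
    using matrix_vector.pos_bounded by blast
  have "bounded (M ` {a..b})"
    by (intro compact_imp_bounded compact_continuous_image continuous_on_subset[OF M]) auto
  then obtain B where B: "\<forall>v\<in>M ` {a..b}. norm v \<le> B" unfolding bounded_iff by blast
  show ?thesis
  proof (rule sq_integrable_bounded)
    show "(\<lambda>x. M x *v f x) \<in> borel_measurable lebesgue"
      by (rule borel_measurable_matrix_vector_mult[OF L1_loc_borel_measurable[OF L1_loc_continuous[OF M]] sq_integrable_measurable[OF f]])
    show "integrable lebesgue (\<lambda>x. (B * K * norm (f x))\<^sup>2)"
      using f by (simp add: sq_integrable_def power_mult_distrib)
    show "AE x in lebesgue. norm (M x *v f x) \<le> B * K * norm (f x)"
    proof (rule AE_I2)
      fix x
      show "norm (M x *v f x) \<le> B * K * norm (f x)"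
      proof (cases "x \<in> {a..b}")
        case True
        then have "norm (M x) * norm (f x) * K \<le> B * norm (f x) * K" using B K by (intro mult_right_mono) auto
        then show ?thesis using K(2)[of "M x" "f x"] by (simp add: mult.commute mult.left_commute)
      qed (simp add: supp)
    qed
  qed
qed

text \<open>Variation of constants: the coefficient \<open>Q\<close> enters the image only through \<open>Y\<close>, so that the image is
square-integrable even if \<open>Q\<close> is not locally square-integrable.\<close>

lemma dirac_rep_fundamental_mult:
  fixes Q :: "real \<Rightarrow> complex ^ ('p::finite + 'p) ^ ('p + 'p)"
  assumes Q: "L1_loc Q" and Y: "local_primitive Y (\<lambda>x. J_mat ** Q x ** Y x)"
    and \<eta>: "local_primitive \<eta> \<eta>'" and \<eta>': "sq_integrable \<eta>'"
    and supp: "\<And>x. x \<notin> {a..b} \<Longrightarrow> \<eta> x = 0" "\<And>x. x \<notin> {a..b} \<Longrightarrow> \<eta>' x = 0"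
  shows "dirac_rep Q (\<lambda>x. Y x *v \<eta> x) (\<lambda>x. J_mat *v (Y x *v \<eta>' x))"
  unfolding dirac_rep_iff_local_primitive[OF Q]
proof (intro conjI)
  note Yc = local_primitive_continuous[OF Y]
  show "sq_integrable (\<lambda>x. Y x *v \<eta> x)"
    by (rule sq_integrable_continuous_mult[OF Yc sq_integrable_continuous_compact_support[OF local_primitive_continuous[OF \<eta>] supp(1)] supp(1)])
  show "sq_integrable (\<lambda>x. J_mat *v (Y x *v \<eta>' x))"
    by (rule sq_integrable_linear[OF sq_integrable_continuous_mult[where a=a and b=b, OF Yc \<eta>' supp(2)]]) simp_all
  have "local_primitive (\<lambda>x. Y x *v \<eta> x) (\<lambda>x. Y x *v \<eta>' x + (J_mat ** Q x ** Y x) *v \<eta> x)"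
    by (rule local_primitive_bilinear[OF bounded_bilinear_matrix_vector_mult Y \<eta>])
  moreover have "Y x *v \<eta>' x + (J_mat ** Q x ** Y x) *v \<eta> x = J_mat *v (Q x *v (Y x *v \<eta> x) - J_mat *v (Y x *v \<eta>' x))" for x
    by (simp add: matrix_vector.diff_right matrix_vector_mul_assoc[symmetric])
  ultimately show "local_primitive (\<lambda>x. Y x *v \<eta> x) (\<lambda>x. J_mat *v (Q x *v (Y x *v \<eta> x) - J_mat *v (Y x *v \<eta>' x)))" by simp
qed

lemma local_primitive_ramp:
  assumes "\<epsilon> > 0"
  shows "local_primitive (\<lambda>x. max 0 (min \<epsilon> (x - s))) (indicat_real {s<..<s + \<epsilon>})"
proof (rule local_primitiveI_AC_loc)
  show "AC_loc (\<lambda>x. max 0 (min \<epsilon> (x - s)))"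
    unfolding AC_loc_def
  proof (intro allI)
    fix a b
    show "AC_on {a..b} (\<lambda>x. max 0 (min \<epsilon> (x - s)))"
      by (rule AC_on_dominated[OF AC_on_ident AC_on_ident, where C = 1]) (auto simp: max_def min_def)
  qed
  show "L1_loc (indicat_real {s<..<s + \<epsilon>})"
    unfolding L1_loc_def
  proof (intro allI, unfold set_integrable_def, intro integrable_mult_indicator)
    show "integrable lebesgue (indicat_real {s<..<s + \<epsilon>})"
      by (rule integrable_real_indicator) (use emeasure_lborel_box_finite[of s "s + \<epsilon>"] in auto)
  qed auto
  have "AE x in lebesgue. x \<notin> {s, s + \<epsilon>}"
    by (intro AE_not_in) (simp add: negligible_iff_null_sets[symmetric])
  then show "AE x in lebesgue. ((\<lambda>x. max 0 (min \<epsilon> (x - s))) has_vector_derivative indicat_real {s<..<s + \<epsilon>} x) (at x)"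
  proof eventually_elim
    case (elim x)
    consider "x \<in> {..<s}" | "x \<in> {s<..<s+\<epsilon>}" | "x \<in> {s+\<epsilon><..}" using elim by fastforce
    then show ?case
    proof cases
      case 1
      have "((\<lambda>x. 0::real) has_vector_derivative 0) (at x)" by simp
      from has_vector_derivative_transform_within_open[OF this _ 1] show ?thesis using 1 assms by auto
    next
      case 2
      have "((\<lambda>x. x - s) has_vector_derivative 1) (at x)"
        by (auto intro!: derivative_eq_intros)
      from has_vector_derivative_transform_within_open[OF this _ 2, of "\<lambda>x. max 0 (min \<epsilon> (x - s))"] show ?thesis using 2 by auto
    next
      case 3
      have "((\<lambda>x. \<epsilon>) has_vector_derivative 0) (at x)" by simp
      from has_vector_derivative_transform_within_open[OF this _ 3, of "\<lambda>x. max 0 (min \<epsilon> (x - s))"] show ?thesis using 3 assms by auto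
    qed
  qed
qed

lemma has_integral_indicator_open_interval:
  fixes G :: "real \<Rightarrow> 'a::euclidean_space"
  assumes "(G has_integral I) {s..t}" "{s..t} \<subseteq> {a..b}"
  shows "((\<lambda>x. indicat_real {s<..<t} x *\<^sub>R G x) has_integral I) {a..b}"
proof -
  have "((\<lambda>x. if x \<in> {s..t} then G x else 0) has_integral I) {a..b}"
    using assms has_integral_restrict by blast
  then show ?thesis
    by (rule has_integral_spike[of "{s, t}", rotated 2]) (auto simp: indicator_def)
qed

text \<open>If the increments of \<open>P\<close> do not depend on the base point, then neither does its derivative, which is
\<open>G\<close> almost everywhere.\<close>

lemma primitive_increments_const_imp_const_AE:
  fixes G :: "real \<Rightarrow> 'a::euclidean_space"
  assumes P: "local_primitive P G"
    and inc: "\<And>s t \<epsilon>. \<epsilon> > 0 \<Longrightarrow> P (s + \<epsilon>) - P s = P (t + \<epsilon>) - P t"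
  obtains c where "AE x in lebesgue. G x = c"
proof -
  note ae = local_primitive_has_derivative_AE[OF P]
  then obtain N where N: "negligible N" "{x. \<not> (P has_vector_derivative G x) (at x)} \<subseteq> N"
    by (rule AE_negligibleE)
  have "N \<noteq> UNIV" using N(1) non_negligible_UNIV by blast
  then obtain x0 where x0: "(P has_vector_derivative G x0) (at x0)" using N(2) by blast
  \<comment> \<open>Negative increments are obtained by exchanging the end points.\<close>
  have inc': "P (s + \<epsilon>) - P s = P (t + \<epsilon>) - P t" for s t \<epsilon>
  proof (cases "\<epsilon> > 0")
    case False
    then show ?thesis
      using inc[of "- \<epsilon>" "s + \<epsilon>" "t + \<epsilon>"] by (cases "\<epsilon> = 0") (auto simp: algebra_simps)
  qed (rule inc)
  have "AE x in lebesgue. G x = G x0"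
    using ae
  proof eventually_elim
    case (elim x)
    have "((\<lambda>y. x0 + (y - x)) has_vector_derivative 1) (at x)" by (auto intro!: derivative_eq_intros)
    moreover have "(P has_vector_derivative G x0) (at (x0 + (x - x)))" using x0 by simp
    ultimately have "((P \<circ> (\<lambda>y. x0 + (y - x))) has_vector_derivative 1 *\<^sub>R G x0) (at x)" by (rule vector_diff_chain_at)
    then have "((\<lambda>y. P (x0 + (y - x)) + (P x - P x0)) has_vector_derivative G x0 + 0) (at x)"
      by (intro has_vector_derivative_add has_vector_derivative_const) (simp add: o_def)
    moreover have "P (x0 + (y - x)) + (P x - P x0) = P y" for y
      using inc'[of x "y - x" x0] by (simp add: algebra_simps)
    ultimately have "(P has_vector_derivative G x0) (at x)" by simp
    with elim show ?case by (rule vector_derivative_unique_at)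
  qed
  then show ?thesis by (rule that)
qed


section \<open>The adjoint\<close>

lemma has_integral_lebesgue_compact_support:
  fixes k :: "real \<Rightarrow> 'a::euclidean_space"
  assumes "integrable lebesgue k" "\<And>x. x \<notin> {a..b} \<Longrightarrow> k x = 0"
  shows "(k has_integral integral\<^sup>L lebesgue k) {a..b}"
proof -
  have "((\<lambda>x. if x \<in> {a..b} then k x else 0) has_integral integral\<^sup>L lebesgue k) UNIV"
    by (rule has_integral_eq[OF _ has_integral_integral_lebesgue[OF assms(1)]]) (use assms(2) in auto)
  then show ?thesis unfolding has_integral_restrict_UNIV .
qed

text \<open>The lemma of du Bois-Reymond, tested with trapezoids. Take \<open>\<eta> = \<theta> u\<close>, where \<open>\<theta>\<close> is the difference
of two ramps that rise from \<open>0\<close> to \<open>\<epsilon>\<close> on intervals of length \<open>\<epsilon>\<close>. Integrating by parts moves the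
derivative away from the primitive \<open>H\<close> of \<open>h\<close>, and there remains the difference of the integrals of
\<open>g + H\<close> over the two intervals.\<close>

lemma op_adjoint_D_cpt_increments:
  fixes Q :: "real \<Rightarrow> complex ^ ('p::finite + 'p) ^ ('p + 'p)"
  assumes Q: "L1_loc Q" and Y: "local_primitive Y (\<lambda>x. J_mat ** Q x ** Y x)"
    and v: "sq_integrable v" and w: "sq_integrable w" and adj: "(abs_L2 v, abs_L2 w) \<in> op_adjoint (D_cpt Q)"
    and H: "local_primitive H (\<lambda>x. mat_adjoint (Y x) *v w x)"
    and P: "local_primitive P (\<lambda>x. - (mat_adjoint (Y x) *v (J_mat *v v x)) + H x)"
    and "\<epsilon> > 0"
  shows "P (s + \<epsilon>) - P s = P (t + \<epsilon>) - P t"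
proof -
  define g where "g = (\<lambda>x. - (mat_adjoint (Y x) *v (J_mat *v v x)))"
  define h where "h = (\<lambda>x. mat_adjoint (Y x) *v w x)"
  \<comment> \<open>Ramps with the corners at \<open>s\<close>, \<open>s + \<epsilon>\<close> and at \<open>t\<close>, \<open>t + \<epsilon>\<close>; their difference has compact support.\<close>
  define \<theta> where "\<theta> = (\<lambda>x. max 0 (min \<epsilon> (x - s)) + - max 0 (min \<epsilon> (x - t)))"
  define \<psi> where "\<psi> = (\<lambda>x. indicat_real {s<..<s + \<epsilon>} x + - indicat_real {t<..<t + \<epsilon>} x)"
  have \<theta>: "local_primitive \<theta> \<psi>"
    unfolding \<theta>_def \<psi>_def using \<open>\<epsilon> > 0\<close>
    by (intro local_primitive_add local_primitive_ramp local_primitive_linear[where h = uminus]) (auto simp: linear_iff)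
  define a where "a = min s t"
  define b where "b = max s t + \<epsilon>"
  have supp: "\<theta> x = 0" "\<psi> x = 0" if "x \<notin> {a..b}" for x
  proof -
    have "(x < s \<and> x < t) \<or> (s + \<epsilon> < x \<and> t + \<epsilon> < x)" using that \<open>\<epsilon> > 0\<close> by (auto simp: a_def b_def)
    then show "\<theta> x = 0" "\<psi> x = 0" using \<open>\<epsilon> > 0\<close> by (auto simp: \<theta>_def \<psi>_def indicator_def)
  qed
  have ends: "\<theta> a = 0" "\<theta> b = 0" and ab: "a \<le> b"
    using \<open>\<epsilon> > 0\<close> by (auto simp: \<theta>_def a_def b_def max_def min_def)
  have "cinner_vec u ((P (s + \<epsilon>) - P s) - (P (t + \<epsilon>) - P t)) = 0" for u
  proof -
    have lu: "linear (\<lambda>r :: real. r *\<^sub>R u)" by (simp add: linear_iff algebra_simps)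
    have \<eta>: "local_primitive (\<lambda>x. \<theta> x *\<^sub>R u) (\<lambda>x. \<psi> x *\<^sub>R u)" by (rule local_primitive_linear[OF \<theta> lu])
    have sq: "sq_integrable (\<lambda>x. \<psi> x *\<^sub>R u)"
    proof (rule sq_integrable_bounded_compact_support)
      show "(\<lambda>x. \<psi> x *\<^sub>R u) \<in> borel_measurable lebesgue"
        by (rule L1_loc_borel_measurable[OF local_primitive_L1_loc[OF \<eta>]])
      show "norm (\<psi> x *\<^sub>R u) \<le> 1 * norm u" for x
        unfolding norm_scaleR by (rule mult_right_mono) (auto simp: \<psi>_def indicator_def)
      show "\<psi> x *\<^sub>R u = 0" if "x \<notin> {a..b}" for x using supp(2)[OF that] by simp
    qed
    let ?y = "\<lambda>x. Y x *v (\<theta> x *\<^sub>R u)" and ?z = "\<lambda>x. J_mat *v (Y x *v (\<psi> x *\<^sub>R u))"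
    have d: "dirac_rep Q ?y ?z"
      by (rule dirac_rep_fundamental_mult[OF Q Y \<eta> sq, of a b]) (simp_all add: supp)
    have "(abs_L2 ?y, abs_L2 ?z) \<in> D_cpt Q"
      by (rule D_cptI[OF d, of a b]) (simp add: supp matrix_vector.zero_right)
    then have "cinner_L2 (abs_L2 ?z) (abs_L2 v) = cinner_L2 (abs_L2 ?y) (abs_L2 w)"
      using adj unfolding op_adjoint_def by blast
    then have eq: "integral\<^sup>L lebesgue (\<lambda>x. cinner_vec (?z x) (v x)) = integral\<^sup>L lebesgue (\<lambda>x. cinner_vec (?y x) (w x))"
      using dirac_repD[OF Q d] v w by (simp add: cinner_L2_abs)
    have "((\<lambda>x. cinner_vec (?z x) (v x)) has_integral integral\<^sup>L lebesgue (\<lambda>x. cinner_vec (?z x) (v x))) {a..b}"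
      by (intro has_integral_lebesgue_compact_support integrable_cinner_vec dirac_repD(2)[OF Q d] v)
        (simp add: supp cinner_vec.zero_left matrix_vector.zero_right)
    then have 1: "((\<lambda>x. \<psi> x *\<^sub>R cinner_vec u (g x)) has_integral integral\<^sup>L lebesgue (\<lambda>x. cinner_vec (?y x) (w x))) {a..b}"
      unfolding eq by (simp add: cinner_vec_J_mat cinner_vec_mat_adjoint[of "Y _"] cinner_vec.scaleR_left g_def cinner_vec.minus_right)
    have "((\<lambda>x. cinner_vec (?y x) (w x)) has_integral integral\<^sup>L lebesgue (\<lambda>x. cinner_vec (?y x) (w x))) {a..b}"
      by (intro has_integral_lebesgue_compact_support integrable_cinner_vec dirac_repD(1)[OF Q d] w)
        (simp add: supp cinner_vec.zero_left matrix_vector.zero_right)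
    then have 2: "((\<lambda>x. cinner_vec (\<theta> x *\<^sub>R u) (h x)) has_integral integral\<^sup>L lebesgue (\<lambda>x. cinner_vec (?y x) (w x))) {a..b}"
      by (simp add: cinner_vec_mat_adjoint[of "Y _"] h_def)
    have "local_primitive (\<lambda>x. cinner_vec (\<theta> x *\<^sub>R u) (H x)) (\<lambda>x. cinner_vec (\<theta> x *\<^sub>R u) (h x) + cinner_vec (\<psi> x *\<^sub>R u) (H x))"
      unfolding h_def by (rule local_primitive_bilinear[OF bounded_bilinear_cinner_vec \<eta> H])
    from local_primitiveD(1)[OF this ab]
    have 3: "((\<lambda>x. cinner_vec (\<theta> x *\<^sub>R u) (h x) + cinner_vec (\<psi> x *\<^sub>R u) (H x)) has_integral 0) {a..b}"
      by (simp add: ends cinner_vec.zero_left)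
    from has_integral_add[OF has_integral_diff[OF 1 2] 3]
    have 4: "((\<lambda>x. \<psi> x *\<^sub>R cinner_vec u (g x + H x)) has_integral 0) {a..b}"
      by (simp add: cinner_vec.scaleR_left cinner_vec.add_right scaleR_add_right)
    have P': "((\<lambda>x. g x + H x) has_integral P (r + \<epsilon>) - P r) {r..r + \<epsilon>}" for r
      using P \<open>\<epsilon> > 0\<close> unfolding g_def by (intro local_primitiveD(1)) auto
    have "((\<lambda>x. indicat_real {s<..<s + \<epsilon>} x *\<^sub>R (g x + H x) - indicat_real {t<..<t + \<epsilon>} x *\<^sub>R (g x + H x))
        has_integral (P (s + \<epsilon>) - P s) - (P (t + \<epsilon>) - P t)) {a..b}"
      using \<open>\<epsilon> > 0\<close> by (intro has_integral_diff has_integral_indicator_open_interval P') (auto simp: a_def b_def)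
    from has_integral_linear[OF this cinner_vec.bounded_linear_right[of u]]
    have "((\<lambda>x. \<psi> x *\<^sub>R cinner_vec u (g x + H x)) has_integral cinner_vec u ((P (s + \<epsilon>) - P s) - (P (t + \<epsilon>) - P t))) {a..b}"
      by (simp add: o_def \<psi>_def cinner_vec.diff_right cinner_vec.scaleR_right scaleR_diff_left)
    from has_integral_unique[OF this 4] show ?thesis .
  qed
  then have "(P (s + \<epsilon>) - P s) - (P (t + \<epsilon>) - P t) = 0" by (rule cinner_vec_eq_0_imp_eq_0)
  then show ?thesis by simp
qed

text \<open>Here \<open>v1\<close> is the locally absolutely continuous representative of \<open>v\<close>: the lemma of
du Bois-Reymond gives \<open>g = c - H\<close> almost everywhere, and \<open>v = Z J g\<close> because \<open>Z J Y* = J\<close>.\<close>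

lemma op_adjoint_D_cpt_subset:
  fixes Q :: "real \<Rightarrow> complex ^ ('p::finite + 'p) ^ ('p + 'p)"
  assumes Q: "L1_loc Q"
  shows "op_adjoint (D_cpt Q) \<subseteq> D_max (\<lambda>x. mat_adjoint (Q x))"
proof clarify
  fix v' w' assume adj': "(v', w') \<in> op_adjoint (D_cpt Q)"
  obtain v where v: "sq_integrable v" "v' = abs_L2 v" by (rule L2_cases)
  obtain w where w: "sq_integrable w" "w' = abs_L2 w" by (rule L2_cases)
  have adj: "(abs_L2 v, abs_L2 w) \<in> op_adjoint (D_cpt Q)" using adj' v w by simp
  obtain Y Z W :: "real \<Rightarrow> complex ^ ('p + 'p) ^ ('p + 'p)"
    where Y: "local_primitive Y (\<lambda>x. J_mat ** Q x ** Y x)"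
      and Z: "local_primitive Z (\<lambda>x. J_mat ** mat_adjoint (Q x) ** Z x)"
      and ZJY: "\<forall>x. Z x ** J_mat ** mat_adjoint (Y x) = J_mat"
    by (rule dirac_fundamental_systems[OF Q])
  have ZJY': "Z x *v (J_mat *v (mat_adjoint (Y x) *v u)) = J_mat *v u" for x u
    using ZJY by (simp add: matrix_vector_mul_assoc matrix_mul_assoc)
  have Yac: "continuous_on UNIV (\<lambda>x. mat_adjoint (Y x))"
    by (rule local_primitive_continuous[OF local_primitive_linear[OF Y linear_mat_adjoint]])
  have hL: "L1_loc (\<lambda>x. mat_adjoint (Y x) *v w x)"
    by (rule L1_loc_bilinear_continuous[OF bounded_bilinear_matrix_vector_mult Yac sq_integrable_imp_L1_loc[OF w(1)]])
  obtain H where H: "local_primitive H (\<lambda>x. mat_adjoint (Y x) *v w x)"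
    using local_primitive_exists[OF hL] by blast
  have "L1_loc (\<lambda>x. mat_adjoint (Y x) *v (J_mat *v v x))"
    by (rule L1_loc_bilinear_continuous[OF bounded_bilinear_matrix_vector_mult Yac L1_loc_linear[OF sq_integrable_imp_L1_loc[OF v(1)]]]) simp
  from L1_loc_linear[OF this, of uminus]
  have gL: "L1_loc (\<lambda>x. - (mat_adjoint (Y x) *v (J_mat *v v x)) + H x)"
    by (intro L1_loc_add L1_loc_continuous[OF local_primitive_continuous[OF H]]) (simp add: linear_iff)
  obtain P where P: "local_primitive P (\<lambda>x. - (mat_adjoint (Y x) *v (J_mat *v v x)) + H x)"
    using local_primitive_exists[OF gL] by blast
  obtain c where c: "AE x in lebesgue. - (mat_adjoint (Y x) *v (J_mat *v v x)) + H x = c"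
    using primitive_increments_const_imp_const_AE[OF P op_adjoint_D_cpt_increments[OF Q Y v(1) w(1) adj H P]] by blast
  define v1 where "v1 x = Z x *v (J_mat *v (c + - H x))" for x
  have ae: "AE x in lebesgue. v1 x = v x"
    using c
  proof eventually_elim
    case (elim x)
    then have "c + - H x = - (mat_adjoint (Y x) *v (J_mat *v v x))" by (simp add: algebra_simps)
    then show ?case by (simp add: v1_def matrix_vector.minus_right ZJY')
  qed
  have "linear (\<lambda>u :: complex ^ ('p + 'p). J_mat *v (- u))"
    by (simp add: linear_iff matrix_vector.minus_right matrix_vector.add_right matrix_vector.scaleR_right)
  from local_primitive_linear[OF H this]
  have "local_primitive (\<lambda>x. J_mat *v (- H x)) (\<lambda>x. J_mat *v (- (mat_adjoint (Y x) *v w x)))" .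
  from local_primitive_add[OF local_primitive_const[of "J_mat *v c"] this]
  have JH: "local_primitive (\<lambda>x. J_mat *v (c + - H x)) (\<lambda>x. J_mat *v (- (mat_adjoint (Y x) *v w x)))"
    by (simp only: matrix_vector.add_right add_0_left)
  have "local_primitive v1 (\<lambda>x. Z x *v (J_mat *v (- (mat_adjoint (Y x) *v w x)))
      + (J_mat ** mat_adjoint (Q x) ** Z x) *v (J_mat *v (c + - H x)))"
    unfolding v1_def by (rule local_primitive_bilinear[OF bounded_bilinear_matrix_vector_mult Z JH])
  moreover have "Z x *v (J_mat *v (- (mat_adjoint (Y x) *v w x)))
      + (J_mat ** mat_adjoint (Q x) ** Z x) *v (J_mat *v (c + - H x)) = J_mat *v (mat_adjoint (Q x) *v v1 x - w x)" for x
    by (simp add: v1_def matrix_vector.minus_right ZJY' matrix_vector.diff_right matrix_vector_mul_assoc[symmetric])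
  ultimately have prim: "local_primitive v1 (\<lambda>x. J_mat *v (mat_adjoint (Q x) *v v1 x - w x))" by simp
  have m1: "v1 \<in> borel_measurable lebesgue"
    by (rule L1_loc_borel_measurable[OF L1_loc_continuous[OF local_primitive_continuous[OF prim]]])
  have sq1: "sq_integrable v1"
  proof (rule sq_integrable_bounded[OF m1])
    show "integrable lebesgue (\<lambda>x. (norm (v x))\<^sup>2)" using v(1) by (simp add: sq_integrable_def)
    show "AE x in lebesgue. norm (v1 x) \<le> norm (v x)" using ae by eventually_elim simp
  qed
  have "dirac_rep (\<lambda>x. mat_adjoint (Q x)) v1 w"
    using prim sq1 w(1) by (simp add: dirac_rep_iff_local_primitive[OF L1_loc_mat_adjoint[OF Q]])
  then have "(abs_L2 v1, abs_L2 w) \<in> D_max (\<lambda>x. mat_adjoint (Q x))" by (rule abs_L2_in_D_max)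
  moreover have "abs_L2 v1 = abs_L2 v" using ae abs_L2_eq_iff[OF sq1 v(1)] by simp
  ultimately show "(v', w') \<in> D_max (\<lambda>x. mat_adjoint (Q x))" using v w by simp
qed

theorem op_adjoint_D_cpt:
  assumes "L1_loc Q"
  shows "op_adjoint (D_cpt Q) = D_max (\<lambda>x. mat_adjoint (Q x))"
  using op_adjoint_D_cpt_subset[OF assms] D_max_mat_adjoint_subset_op_adjoint[OF assms] by blast


section \<open>Cutoffs and the equality of minimal and maximal operator\<close>

text \<open>It is the adjoint of the compactly supported restriction for \<open>Q*\<close>.\<close>

lemma closed_D_max:
  assumes Q: "L1_loc Q" shows "closed (D_max Q)"
  using closed_op_adjoint[of "D_cpt (\<lambda>x. mat_adjoint (Q x))"] op_adjoint_D_cpt[OF L1_loc_mat_adjoint[OF Q]] by simp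

lemma D_min_subset_D_max:
  assumes Q: "L1_loc Q" shows "D_min Q \<subseteq> D_max Q"
  unfolding D_min_eq_closure
  by (rule closure_minimal[OF _ closed_D_max[OF Q]]) (auto simp: D_cpt_def D_max_def)

lemma local_primitive_C1:
  fixes F :: "real \<Rightarrow> 'a::euclidean_space"
  assumes "\<And>x. (F has_vector_derivative f x) (at x)" "continuous_on UNIV f"
  shows "local_primitive F f"
  unfolding local_primitive_def
  using assms by (auto intro!: L1_loc_continuous fundamental_theorem_of_calculus intro: has_vector_derivative_at_within)

lemma max_0_square_has_real_derivative:
  "((\<lambda>t. (max 0 t)\<^sup>2) has_real_derivative 2 * max 0 t) (at t)" for t :: real
proof -
  consider "t \<in> {..<0}" | "t = 0" | "t \<in> {0<..}" by fastforce
  then show ?thesis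
  proof cases
    case 1
    have "((\<lambda>t. 0::real) has_real_derivative 0) (at t)" by simp
    from has_field_derivative_transform_within_open[OF this _ 1, of "\<lambda>t. (max 0 t)\<^sup>2"] show ?thesis using 1 by auto
  next
    case 2
    have "((\<lambda>t. (max 0 t)\<^sup>2) has_derivative (\<lambda>h. 0)) (at (0::real))"
      unfolding has_derivative_at_alt
    proof (intro conjI allI impI bounded_linear_zero)
      fix e :: real assume "e > 0"
      have "norm ((max 0 y)\<^sup>2 - (max 0 0)\<^sup>2 - 0) \<le> e * norm (y - 0)" if "norm (y - 0) < e" for y :: real
      proof (cases "y \<le> 0")
        case True
        then show ?thesis using \<open>e > 0\<close> by (simp add: max_absorb1 mult_le_0_iff)
      next
        case False
        then show ?thesis using that mult_right_mono[of y e y] by (simp add: power2_eq_square max_absorb2)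
      qed
      then show "\<exists>d>0. \<forall>y::real. norm (y - 0) < d \<longrightarrow> norm ((max 0 y)\<^sup>2 - (max 0 0)\<^sup>2 - 0) \<le> e * norm (y - 0)"
        using \<open>e > 0\<close> by blast
    qed
    moreover have "(*) 0 = (\<lambda>h :: real. 0)" by auto
    ultimately show ?thesis using 2 by (simp add: has_field_derivative_def)
  next
    case 3
    have "((\<lambda>t. t\<^sup>2) has_real_derivative 2 * t) (at t)" by (auto intro!: derivative_eq_intros)
    from has_field_derivative_transform_within_open[OF this _ 3, of "\<lambda>t. (max 0 t)\<^sup>2"] show ?thesis using 3 by auto
  qed
qed

text \<open>A continuously differentiable bump, so that no exceptional set has to be carried along; it is positive
inside its support, which suffices in place of being constant there.\<close>

definition cutoff :: "nat \<Rightarrow> real \<Rightarrow> real" where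
  "cutoff k x = (max 0 (1 - (x / (real k + 1))\<^sup>2))\<^sup>2"

definition cutoff_deriv :: "nat \<Rightarrow> real \<Rightarrow> real" where
  "cutoff_deriv k x = - 4 * (x / (real k + 1)) * max 0 (1 - (x / (real k + 1))\<^sup>2) / (real k + 1)"

lemma local_primitive_cutoff: "local_primitive (cutoff k) (cutoff_deriv k)"
proof (rule local_primitive_C1)
  fix x
  have "((\<lambda>x. 1 - (x / (real k + 1))\<^sup>2) has_real_derivative - 2 * (x / (real k + 1)) / (real k + 1)) (at x)"
    by (auto intro!: derivative_eq_intros)
  from DERIV_chain2[OF max_0_square_has_real_derivative this]
  show "(cutoff k has_vector_derivative cutoff_deriv k x) (at x)"
    unfolding cutoff_def[abs_def] cutoff_deriv_def
    by (simp add: has_real_derivative_iff_has_vector_derivative[symmetric] algebra_simps)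
next
  show "continuous_on UNIV (cutoff_deriv k)" unfolding cutoff_deriv_def[abs_def] by (intro continuous_intros) auto
qed

lemma cutoff_bounds: "0 \<le> cutoff k x" "cutoff k x \<le> 1"
  by (auto simp: cutoff_def intro!: power_le_one)

lemma cutoff_eq_0: assumes "x \<notin> {- (real k + 1)..real k + 1}" shows "cutoff k x = 0"
proof -
  have "1 \<le> \<bar>x / (real k + 1)\<bar>" using assms by (auto simp: abs_if field_simps)
  then have "1 \<le> (x / (real k + 1))\<^sup>2" by (metis abs_le_square_iff abs_one one_power2)
  then show ?thesis by (simp add: cutoff_def)
qed

lemma cutoff_deriv_eq_0: assumes "x \<notin> {- (real k + 1)..real k + 1}" shows "cutoff_deriv k x = 0"
proof -
  have "1 \<le> \<bar>x / (real k + 1)\<bar>" using assms by (auto simp: abs_if field_simps)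
  then have "1 \<le> (x / (real k + 1))\<^sup>2" by (metis abs_le_square_iff abs_one one_power2)
  then show ?thesis by (simp add: cutoff_deriv_def)
qed

lemma cutoff_pos: assumes "\<bar>x\<bar> < real k + 1" shows "cutoff k x > 0"
proof -
  have "\<bar>x / (real k + 1)\<bar> < 1" using assms by (auto simp: abs_if field_simps)
  then have "(x / (real k + 1))\<^sup>2 < 1" by (metis abs_square_less_1)
  then show ?thesis by (simp add: cutoff_def)
qed

lemma cutoff_deriv_bound: "\<bar>cutoff_deriv k x\<bar> \<le> 4 / (real k + 1)"
proof -
  have "\<bar>t\<bar> * max 0 (1 - t\<^sup>2) \<le> 1" for t :: real
  proof (cases "\<bar>t\<bar> \<le> 1")
    case True
    then show ?thesis using mult_mono[of "\<bar>t\<bar>" 1 "max 0 (1 - t\<^sup>2)" 1] by auto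
  next
    case False
    then have "1 \<le> t\<^sup>2" by (metis abs_le_square_iff abs_one one_power2 linear)
    then show ?thesis by simp
  qed
  from mult_left_mono[OF this[of "x / (real k + 1)"], of "4 / (real k + 1)"]
  show ?thesis by (simp add: cutoff_deriv_def abs_mult divide_simps)
qed

lemma tendsto_divide_Suc: "(\<lambda>k. x / (real k + 1)) \<longlonglongrightarrow> 0"
  using tendsto_mult[OF tendsto_const[of x] LIMSEQ_inverse_real_of_nat] by (simp add: divide_inverse add.commute)

lemma cutoff_tendsto_1: "(\<lambda>k. cutoff k x) \<longlonglongrightarrow> 1"
proof -
  have "(\<lambda>k. cutoff k x) \<longlonglongrightarrow> (max 0 (1 - 0\<^sup>2))\<^sup>2"
    unfolding cutoff_def by (intro tendsto_intros tendsto_divide_Suc)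
  then show ?thesis by simp
qed

lemma cutoff_deriv_tendsto_0: "(\<lambda>k. cutoff_deriv k x) \<longlonglongrightarrow> 0"
  by (rule Lim_null_comparison[OF _ tendsto_divide_Suc[of 4]]) (simp add: cutoff_deriv_bound)

lemma sq_integrable_scale_bounded:
  assumes y: "sq_integrable y" and m: "\<phi> \<in> borel_measurable lebesgue" and b: "\<And>x. \<bar>\<phi> x\<bar> \<le> C"
  shows "sq_integrable (\<lambda>x. \<phi> x *\<^sub>R y x)"
proof (rule sq_integrable_bounded)
  show "(\<lambda>x. \<phi> x *\<^sub>R y x) \<in> borel_measurable lebesgue"
    by (rule borel_measurable_scaleR[OF m sq_integrable_measurable[OF y]])
  show "integrable lebesgue (\<lambda>x. (C * norm (y x))\<^sup>2)" using y by (simp add: sq_integrable_def power_mult_distrib)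
  show "AE x in lebesgue. norm (\<phi> x *\<^sub>R y x) \<le> C * norm (y x)"
    by (intro AE_I2) (auto intro!: mult_right_mono b)
qed

lemma cutoff_measurable: "cutoff k \<in> borel_measurable lebesgue" "cutoff_deriv k \<in> borel_measurable lebesgue"
  by (intro L1_loc_borel_measurable L1_loc_continuous local_primitive_continuous[OF local_primitive_cutoff])
     (rule L1_loc_borel_measurable[OF local_primitive_L1_loc[OF local_primitive_cutoff]])

text \<open>The commutator of the differential expression with a scalar function is a bounded multiplication operator.\<close>

lemma dirac_rep_cutoff:
  assumes Q: "L1_loc Q" and d: "dirac_rep Q y z"
  shows "dirac_rep Q (\<lambda>x. cutoff k x *\<^sub>R y x) (\<lambda>x. cutoff k x *\<^sub>R z x + cutoff_deriv k x *\<^sub>R (J_mat *v y x))"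
  unfolding dirac_rep_iff_local_primitive[OF Q]
proof (intro conjI)
  note D = dirac_repD[OF Q d]
  have Jy: "sq_integrable (\<lambda>x. J_mat *v y x)" by (rule sq_integrable_linear[OF D(1)]) simp
  show "sq_integrable (\<lambda>x. cutoff k x *\<^sub>R y x)"
    using cutoff_bounds by (intro sq_integrable_scale_bounded[where C = 1] D cutoff_measurable) auto
  show "sq_integrable (\<lambda>x. cutoff k x *\<^sub>R z x + cutoff_deriv k x *\<^sub>R (J_mat *v y x))"
    using cutoff_bounds cutoff_deriv_bound
    by (intro sq_integrable_add sq_integrable_scale_bounded[where C = 1] sq_integrable_scale_bounded[where C = "4 / (real k + 1)"] D Jy cutoff_measurable) auto
  have "local_primitive (\<lambda>x. cutoff k x *\<^sub>R y x) (\<lambda>x. cutoff k x *\<^sub>R (J_mat *v (Q x *v y x - z x)) + cutoff_deriv k x *\<^sub>R y x)"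
    by (rule local_primitive_bilinear[OF bounded_bilinear_scaleR local_primitive_cutoff D(3)])
  moreover have "cutoff k x *\<^sub>R (J_mat *v (Q x *v y x - z x)) + cutoff_deriv k x *\<^sub>R y x =
      J_mat *v (Q x *v (cutoff k x *\<^sub>R y x) - (cutoff k x *\<^sub>R z x + cutoff_deriv k x *\<^sub>R (J_mat *v y x)))" for x
    by (simp add: matrix_vector.scaleR_right matrix_vector.diff_right matrix_vector.add_right scaleR_diff_right)
  ultimately show "local_primitive (\<lambda>x. cutoff k x *\<^sub>R y x)
      (\<lambda>x. J_mat *v (Q x *v (cutoff k x *\<^sub>R y x) - (cutoff k x *\<^sub>R z x + cutoff_deriv k x *\<^sub>R (J_mat *v y x))))" by simp
qed

lemma tendsto_abs_L2_scale:
  assumes y: "sq_integrable y" and m: "\<And>k. \<phi> k \<in> borel_measurable lebesgue" and b: "\<And>k x. \<bar>\<phi> k x\<bar> \<le> C"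
    and lim: "\<And>x. (\<lambda>k. \<phi> k x) \<longlonglongrightarrow> c"
  shows "(\<lambda>k. abs_L2 (\<lambda>x. \<phi> k x *\<^sub>R y x)) \<longlonglongrightarrow> abs_L2 (\<lambda>x. c *\<^sub>R y x)"
proof (rule tendsto_abs_L2_dominated(2))
  show "(\<lambda>x. \<phi> k x *\<^sub>R y x) \<in> borel_measurable lebesgue" for k
    by (rule borel_measurable_scaleR[OF m sq_integrable_measurable[OF y]])
  show "(\<lambda>x. c *\<^sub>R y x) \<in> borel_measurable lebesgue"
    by (intro borel_measurable_scaleR borel_measurable_const sq_integrable_measurable[OF y])
  show "integrable lebesgue (\<lambda>x. (C * norm (y x))\<^sup>2)" using y by (simp add: sq_integrable_def power_mult_distrib)
  show "AE x in lebesgue. norm (\<phi> k x *\<^sub>R y x) \<le> C * norm (y x)" for k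
    by (intro AE_I2) (auto intro!: mult_right_mono b)
  show "AE x in lebesgue. (\<lambda>k. \<phi> k x *\<^sub>R y x) \<longlonglongrightarrow> c *\<^sub>R y x"
    by (intro AE_I2 tendsto_intros lim)
qed

lemma D_max_subset_D_min:
  assumes Q: "L1_loc Q" shows "D_max Q \<subseteq> D_min Q"
proof clarify
  fix u u' assume "(u, u') \<in> D_max Q"
  then obtain y z where yz: "u = abs_L2 y" "u' = abs_L2 z" and d: "dirac_rep Q y z" unfolding D_max_def by blast
  note D = dirac_repD[OF Q d]
  have Jy: "sq_integrable (\<lambda>x. J_mat *v y x)" by (rule sq_integrable_linear[OF D(1)]) simp
  have b1: "\<bar>cutoff k x\<bar> \<le> 1" for k x using cutoff_bounds[of k x] by simp
  have b4: "\<bar>cutoff_deriv k x\<bar> \<le> 4" for k x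
  proof -
    have "4 / (real k + 1) \<le> 4" by (simp add: field_simps)
    then show ?thesis using cutoff_deriv_bound[of k x] by linarith
  qed
  have 1: "(\<lambda>k. abs_L2 (\<lambda>x. cutoff k x *\<^sub>R y x)) \<longlonglongrightarrow> u"
    using tendsto_abs_L2_scale[OF D(1) cutoff_measurable(1) b1 cutoff_tendsto_1] yz by simp
  have "(\<lambda>k. abs_L2 (\<lambda>x. cutoff k x *\<^sub>R z x)) \<longlonglongrightarrow> u'"
    using tendsto_abs_L2_scale[OF D(2) cutoff_measurable(1) b1 cutoff_tendsto_1] yz by simp
  moreover have "(\<lambda>k. abs_L2 (\<lambda>x. cutoff_deriv k x *\<^sub>R (J_mat *v y x))) \<longlonglongrightarrow> 0"
    using tendsto_abs_L2_scale[OF Jy cutoff_measurable(2) b4 cutoff_deriv_tendsto_0] by (simp add: zero_L2_abs)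
  ultimately have "(\<lambda>k. abs_L2 (\<lambda>x. cutoff k x *\<^sub>R z x) + abs_L2 (\<lambda>x. cutoff_deriv k x *\<^sub>R (J_mat *v y x))) \<longlonglongrightarrow> u' + 0"
    by (rule tendsto_add)
  moreover have "abs_L2 (\<lambda>x. cutoff k x *\<^sub>R z x) + abs_L2 (\<lambda>x. cutoff_deriv k x *\<^sub>R (J_mat *v y x))
      = abs_L2 (\<lambda>x. cutoff k x *\<^sub>R z x + cutoff_deriv k x *\<^sub>R (J_mat *v y x))" for k
    by (intro abs_L2_add sq_integrable_scale_bounded[OF D(2) cutoff_measurable(1) b1]
        sq_integrable_scale_bounded[OF Jy cutoff_measurable(2) b4])
  ultimately have 2: "(\<lambda>k. abs_L2 (\<lambda>x. cutoff k x *\<^sub>R z x + cutoff_deriv k x *\<^sub>R (J_mat *v y x))) \<longlonglongrightarrow> u'" by simp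
  show "(u, u') \<in> D_min Q"
    unfolding D_min_eq_closure closure_sequential
  proof (intro exI conjI allI)
    show "(\<lambda>k. (abs_L2 (\<lambda>x. cutoff k x *\<^sub>R y x), abs_L2 (\<lambda>x. cutoff k x *\<^sub>R z x + cutoff_deriv k x *\<^sub>R (J_mat *v y x)))) \<longlonglongrightarrow> (u, u')"
      by (rule tendsto_Pair[OF 1 2])
    show "(abs_L2 (\<lambda>x. cutoff k x *\<^sub>R y x), abs_L2 (\<lambda>x. cutoff k x *\<^sub>R z x + cutoff_deriv k x *\<^sub>R (J_mat *v y x))) \<in> D_cpt Q" for k
      by (rule D_cptI[where a = "- (real k + 1)" and b = "real k + 1", OF dirac_rep_cutoff[OF Q d]])
        (simp add: cutoff_eq_0 del: atLeastAtMost_iff)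
  qed
qed

theorem D_min_eq_D_max:
  assumes "L1_loc Q" shows "D_min Q = D_max Q"
  using D_min_subset_D_max[OF assms] D_max_subset_D_min[OF assms] by blast


section \<open>Density of the domain\<close>

lemma local_primitive_shift:
  fixes F :: "real \<Rightarrow> 'a::euclidean_space"
  assumes F: "local_primitive F f"
  shows "local_primitive (\<lambda>x. F (x + d)) (\<lambda>x. f (x + d))"
proof -
  have sh: "((\<lambda>x. g (x + d)) has_integral I) {a..b}" if "(g has_integral I) {a + d..b + d}"
    for g :: "real \<Rightarrow> 'c::euclidean_space" and I a b
    using that has_integral_shift_Icc_real[of g d I a b] by (simp add: o_def add.commute)
  have L: "L1_loc f" by (rule local_primitive_L1_loc[OF F])
  have "L1_loc (\<lambda>x. f (x + d))"
    unfolding L1_loc_def absolutely_integrable_on_def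
  proof (intro allI conjI)
    fix a b
    show "(\<lambda>x. f (x + d)) integrable_on {a..b}"
      using sh[OF integrable_integral[OF L1_loc_integrable_on[OF L]]] by blast
    show "(\<lambda>x. norm (f (x + d))) integrable_on {a..b}"
      using sh[OF integrable_integral[OF L1_loc_integrable_on[OF L1_loc_norm[OF L]]]] by blast
  qed
  moreover have "((\<lambda>x. f (x + d)) has_integral F (b + d) - F (a + d)) {a..b}" if "a \<le> b" for a b
    using that by (intro sh local_primitiveD(1)[OF F]) simp
  ultimately show ?thesis unfolding local_primitive_def by blast
qed

lemma has_vector_derivative_difference_quotient:
  assumes "(P has_vector_derivative u) (at x)"
  shows "(\<lambda>k. (real k + 1) *\<^sub>R (P (x + 1 / (real k + 1)) - P x)) \<longlonglongrightarrow> u"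
proof -
  have "((\<lambda>h. norm (P (x + h) - P x - h *\<^sub>R u) / norm h) \<longlongrightarrow> 0) (at 0)"
    using assms unfolding has_vector_derivative_def has_derivative_at by blast
  moreover have "filterlim (\<lambda>k. 1 / (real k + 1)) (at 0) sequentially"
    unfolding filterlim_at using tendsto_divide_Suc[of 1] by auto
  ultimately have *: "(\<lambda>k. norm (P (x + 1 / (real k + 1)) - P x - (1 / (real k + 1)) *\<^sub>R u) / norm (1 / (real k + 1))) \<longlonglongrightarrow> 0"
    by (rule filterlim_compose)
  have "norm (P (x + 1 / (real k + 1)) - P x - (1 / (real k + 1)) *\<^sub>R u) / norm (1 / (real k + 1))
      = norm ((real k + 1) *\<^sub>R (P (x + 1 / (real k + 1)) - P x) - u)" for k
  proof -
    have "(real k + 1) *\<^sub>R (P (x + 1 / (real k + 1)) - P x) - u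
      = (real k + 1) *\<^sub>R (P (x + 1 / (real k + 1)) - P x - (1 / (real k + 1)) *\<^sub>R u)"
      by (simp add: scaleR_diff_right)
    then show ?thesis by simp
  qed
  then have "(\<lambda>k. norm ((real k + 1) *\<^sub>R (P (x + 1 / (real k + 1)) - P x) - u)) \<longlonglongrightarrow> 0"
    using * by (simp only:)
  then show ?thesis by (rule LIM_zero_cancel[OF tendsto_norm_zero_cancel])
qed

text \<open>The difference quotients \<open>\<eta>\<close> of a primitive of \<open>u\<close> are Lipschitz with compact support, are bounded
by the bound for \<open>u\<close>, and converge to \<open>u\<close> almost everywhere by Lebesgue's differentiation theorem.\<close>

lemma fundamental_mult_in_closure_Domain:
  fixes Q Y :: "real \<Rightarrow> complex ^ ('p::finite + 'p) ^ ('p + 'p)"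
  assumes Q: "L1_loc Q" and Y: "local_primitive Y (\<lambda>x. J_mat ** Q x ** Y x)"
    and um: "u \<in> borel_measurable lebesgue" and ub: "\<And>x. norm (u x) \<le> C" and us: "\<And>x. x \<notin> {a..b} \<Longrightarrow> u x = 0"
  shows "abs_L2 (\<lambda>x. Y x *v u x) \<in> closure (Domain (D_cpt Q))"
proof -
  note Yc = local_primitive_continuous[OF Y]
  have usq: "sq_integrable u" by (rule sq_integrable_bounded_compact_support[OF um ub us])
  have uL: "L1_loc u" by (rule sq_integrable_imp_L1_loc[OF usq])
  obtain P where P: "local_primitive P u" using local_primitive_exists[OF uL] by blast
  define h where "h k = 1 / (real k + 1)" for k :: nat
  have h: "0 < h k" "h k \<le> 1" for k by (auto simp: h_def field_simps)
  define \<eta> where "\<eta> k x = (real k + 1) *\<^sub>R (P (x + h k) - P x)" for k x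
  define \<eta>' where "\<eta>' k x = (real k + 1) *\<^sub>R (u (x + h k) - u x)" for k x
  have "local_primitive (\<lambda>x. P (x + h k) + - P x) (\<lambda>x. u (x + h k) + - u x)" for k
    by (intro local_primitive_add local_primitive_shift P local_primitive_linear[where h = uminus, OF P]) (simp add: linear_iff)
  then have \<eta>: "local_primitive (\<eta> k) (\<eta>' k)" for k
    unfolding \<eta>_def[abs_def] \<eta>'_def[abs_def] using local_primitive_linear[OF _ linear_scaleR] by fastforce
  have \<eta>_int: "(u has_integral P (x + h k) - P x) {x..x + h k}" for x k
    using h[of k] by (intro local_primitiveD(1)[OF P]) simp
  have C0: "C \<ge> 0" using ub[of 0] norm_ge_zero order_trans by blast
  have \<eta>b: "norm (\<eta> k x) \<le> C" for k x
  proof -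
    have "norm (P (x + h k) - P x) \<le> C * measure lborel {x..x + h k}"
      by (rule has_integral_bound_real[OF C0 _ \<eta>_int, of "{}"]) (auto simp: ub)
    then have "norm (P (x + h k) - P x) \<le> C * h k" using h[of k] by simp
    from mult_left_mono[OF this, of "real k + 1"] show ?thesis by (simp add: \<eta>_def h_def)
  qed
  have \<eta>s: "\<eta> k x = 0" if "x \<notin> {a - 1..b}" for k x
  proof -
    have "(u has_integral 0) {x..x + h k}"
      by (rule has_integral_is_0) (use that h[of k] us in force)
    from has_integral_unique[OF \<eta>_int this] show ?thesis by (simp add: \<eta>_def)
  qed
  have \<eta>'s: "\<eta>' k x = 0" if "x \<notin> {a - 1..b}" for k x
  proof -
    have "x + h k \<notin> {a..b}" "x \<notin> {a..b}" using that h[of k] by auto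
    then show ?thesis by (simp add: \<eta>'_def us)
  qed
  have \<eta>'sq: "sq_integrable (\<eta>' k)" for k
  proof (rule sq_integrable_bounded_compact_support[OF _ _ \<eta>'s])
    show "\<eta>' k \<in> borel_measurable lebesgue" by (rule L1_loc_borel_measurable[OF local_primitive_L1_loc[OF \<eta>]])
    show "norm (\<eta>' k x) \<le> (real k + 1) * (C + C)" for x
      using norm_triangle_ineq4[of "u (x + h k)" "u x"] ub[of x] ub[of "x + h k"]
      by (auto simp: \<eta>'_def intro!: mult_left_mono)
  qed auto
  have mem: "abs_L2 (\<lambda>x. Y x *v \<eta> k x) \<in> Domain (D_cpt Q)" for k
  proof -
    have "dirac_rep Q (\<lambda>x. Y x *v \<eta> k x) (\<lambda>x. J_mat *v (Y x *v \<eta>' k x))"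
      by (rule dirac_rep_fundamental_mult[OF Q Y \<eta> \<eta>'sq \<eta>s \<eta>'s]) auto
    then have "(abs_L2 (\<lambda>x. Y x *v \<eta> k x), abs_L2 (\<lambda>x. J_mat *v (Y x *v \<eta>' k x))) \<in> D_cpt Q"
      by (rule D_cptI[of _ _ _ "a - 1" b]) (simp add: \<eta>s matrix_vector.zero_right del: atLeastAtMost_iff)
    then show ?thesis by blast
  qed
  obtain K where K: "K > 0" "\<And>(A :: complex ^ ('p + 'p) ^ ('p + 'p)) v :: complex ^ ('p + 'p). norm (A *v v) \<le> norm A * norm v * K"
    using matrix_vector.pos_bounded by blast
  have "bounded (Y ` {a - 1..b})"
    by (intro compact_imp_bounded compact_continuous_image continuous_on_subset[OF Yc]) auto
  then obtain B where B: "\<forall>v\<in>Y ` {a - 1..b}. norm v \<le> B" unfolding bounded_iff by blast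
  note meas = borel_measurable_matrix_vector_mult[OF L1_loc_borel_measurable[OF L1_loc_continuous[OF Yc]]]
  have "(\<lambda>k. abs_L2 (\<lambda>x. Y x *v \<eta> k x)) \<longlonglongrightarrow> abs_L2 (\<lambda>x. Y x *v u x)"
  proof (rule tendsto_abs_L2_dominated(2))
    show "(\<lambda>x. Y x *v \<eta> k x) \<in> borel_measurable lebesgue" for k
      by (rule meas[OF L1_loc_borel_measurable[OF L1_loc_continuous[OF local_primitive_continuous[OF \<eta>]]]])
    show "(\<lambda>x. Y x *v u x) \<in> borel_measurable lebesgue" by (rule meas[OF um])
    have "integrable lebesgue (\<lambda>x. (B * C * K)\<^sup>2 * indicat_real {a - 1..b} x)"
      using integrable_indicat_Icc by (rule integrable_mult_right)
    moreover have "(\<lambda>x. (B * C * K * indicat_real {a - 1..b} x)\<^sup>2) = (\<lambda>x. (B * C * K)\<^sup>2 * indicat_real {a - 1..b} x)"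
      by (auto simp: fun_eq_iff indicator_def)
    ultimately show "integrable lebesgue (\<lambda>x. (B * C * K * indicat_real {a - 1..b} x)\<^sup>2)" by (simp only:)
    show "AE x in lebesgue. norm (Y x *v \<eta> k x) \<le> B * C * K * indicat_real {a - 1..b} x" for k
    proof (rule AE_I2)
      fix x
      show "norm (Y x *v \<eta> k x) \<le> B * C * K * indicat_real {a - 1..b} x"
      proof (cases "x \<in> {a - 1..b}")
        case True
        then have Bx: "norm (Y x) \<le> B" using B by blast
        have "norm (Y x *v \<eta> k x) \<le> norm (Y x) * norm (\<eta> k x) * K" by (rule K)
        also have "\<dots> \<le> B * C * K"
          using Bx \<eta>b[of k x] K(1) C0 order_trans[OF norm_ge_zero Bx] by (intro mult_right_mono mult_mono) auto
        finally show ?thesis using True by simp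
      next
        case False
        then show ?thesis using \<eta>s[OF False, of k] by simp
      qed
    qed
    show "AE x in lebesgue. (\<lambda>k. Y x *v \<eta> k x) \<longlonglongrightarrow> Y x *v u x"
      using local_primitive_has_derivative_AE[OF P]
    proof eventually_elim
      case (elim x)
      show ?case unfolding \<eta>_def h_def
        by (rule matrix_vector.tendsto[OF tendsto_const has_vector_derivative_difference_quotient[OF elim]])
    qed
  qed
  then show ?thesis
    unfolding closure_sequential by (intro exI[of _ "\<lambda>k. abs_L2 (\<lambda>x. Y x *v \<eta> k x)"]) (simp add: mem)
qed

text \<open>Truncation reduces to bounded functions of compact support, and these have the form \<open>Y u\<close> with
\<open>u = W f\<close> of the same kind.\<close>

lemma Domain_D_cpt_dense:
  fixes Q :: "real \<Rightarrow> complex ^ ('p::finite + 'p) ^ ('p + 'p)"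
  assumes Q: "L1_loc Q"
  shows "closure (Domain (D_cpt Q)) = UNIV"
proof -
  obtain Y Z W :: "real \<Rightarrow> complex ^ ('p + 'p) ^ ('p + 'p)"
    where Y: "local_primitive Y (\<lambda>x. J_mat ** Q x ** Y x)"
      and Wc: "continuous_on UNIV W" and YW: "\<forall>x. Y x ** W x = mat 1"
    by (rule dirac_fundamental_systems[OF Q])
  have "v \<in> closure (Domain (D_cpt Q))" for v
  proof -
    obtain f where f: "sq_integrable f" "v = abs_L2 f" by (rule L2_cases)
    note fm = sq_integrable_measurable[OF f(1)]
    define S where "S n = {x. \<bar>x\<bar> \<le> real n \<and> norm (f x) \<le> real n}" for n
    define fn where "fn n x = indicat_real (S n) x *\<^sub>R f x" for n x
    have "S n = {- real n..real n} \<inter> {x \<in> space lebesgue. norm (f x) \<le> real n}" for n by (auto simp: S_def)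
    moreover have "{x \<in> space lebesgue. norm (f x) \<le> real n} \<in> sets lebesgue" for n
      using fm by measurable
    ultimately have S: "S n \<in> sets lebesgue" for n by auto
    have fnm: "fn n \<in> borel_measurable lebesgue" for n
      unfolding fn_def[abs_def] by (intro borel_measurable_scaleR borel_measurable_indicator S fm)
    have fnb: "norm (fn n x) \<le> real n" for n x by (auto simp: fn_def S_def indicator_def)
    have fns: "fn n x = 0" if "x \<notin> {- real n..real n}" for n x using that by (auto simp: fn_def S_def)
    have mem: "abs_L2 (fn n) \<in> closure (Domain (D_cpt Q))" for n
    proof -
      obtain K where K: "K > 0" "\<And>(A :: complex ^ ('p + 'p) ^ ('p + 'p)) v :: complex ^ ('p + 'p). norm (A *v v) \<le> norm A * norm v * K"
        using matrix_vector.pos_bounded by blast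
      have "bounded (W ` {- real n..real n})"
        by (intro compact_imp_bounded compact_continuous_image continuous_on_subset[OF Wc]) auto
      then obtain B where B: "\<forall>v\<in>W ` {- real n..real n}. norm v \<le> B" unfolding bounded_iff by blast
      have "norm (W x *v fn n x) \<le> max 0 (B * real n * K)" for x
      proof (cases "x \<in> {- real n..real n}")
        case True
        then have Bx: "norm (W x) \<le> B" using B by blast
        have "norm (W x *v fn n x) \<le> norm (W x) * norm (fn n x) * K" by (rule K)
        also have "\<dots> \<le> B * real n * K"
          using Bx fnb[of n x] K(1) order_trans[OF norm_ge_zero Bx] by (intro mult_right_mono mult_mono) auto
        finally show ?thesis by simp
      next
        case False
        then show ?thesis using fns[OF False] by simp
      qed
      moreover have "(\<lambda>x. W x *v fn n x) \<in> borel_measurable lebesgue"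
        by (rule borel_measurable_matrix_vector_mult[OF L1_loc_borel_measurable[OF L1_loc_continuous[OF Wc]] fnm])
      ultimately have "abs_L2 (\<lambda>x. Y x *v (W x *v fn n x)) \<in> closure (Domain (D_cpt Q))"
        by (intro fundamental_mult_in_closure_Domain[OF Q Y, where a = "- real n" and b = "real n"]) (auto simp: fns)
      then show ?thesis using YW by (simp add: matrix_vector_mul_assoc)
    qed
    have "(\<lambda>n. abs_L2 (fn n)) \<longlonglongrightarrow> abs_L2 f"
    proof (rule tendsto_abs_L2_dominated(2)[OF fnm fm])
      show "integrable lebesgue (\<lambda>x. (norm (f x))\<^sup>2)" using f(1) by (simp add: sq_integrable_def)
      show "AE x in lebesgue. norm (fn n x) \<le> norm (f x)" for n by (intro AE_I2) (auto simp: fn_def indicator_def)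
      show "AE x in lebesgue. (\<lambda>n. fn n x) \<longlonglongrightarrow> f x"
      proof (rule AE_I2, rule tendsto_eventually)
        fix x
        show "\<forall>\<^sub>F n in sequentially. fn n x = f x"
          using eventually_ge_at_top[of "nat \<lceil>max \<bar>x\<bar> (norm (f x))\<rceil>"]
        proof eventually_elim
          case (elim n)
          then have "max \<bar>x\<bar> (norm (f x)) \<le> real n" unfolding nat_le_iff ceiling_le_iff by simp
          then show ?case by (simp add: fn_def S_def)
        qed
      qed
    qed
    then show ?thesis
      unfolding f(2) using mem by (rule closed_sequentially[OF closed_closure, rotated])
  qed
  then show ?thesis by blast
qed


section \<open>Conjugating the adjoint\<close>

lemma dirac_rep_vec_swap_cnj:
  assumes Q: "L1_loc Q" and d: "dirac_rep Q y z"
  shows "dirac_rep (\<lambda>x. swap_transpose (mat_adjoint (Q x))) (\<lambda>x. vec_swap_cnj (y x)) (\<lambda>x. vec_swap_cnj (z x))"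
proof -
  have "vec_swap_cnj (J_mat *v (Q x *v y x - z x))
      = J_mat *v (swap_transpose (mat_adjoint (Q x)) *v vec_swap_cnj (y x) - vec_swap_cnj (z x))" for x
    by (simp add: vec_swap_cnj_J_mat linear_diff[OF linear_vec_swap_cnj] vec_swap_cnj_mult[of "Q x"])
  then show ?thesis
    using local_primitive_linear[OF dirac_repD(3)[OF Q d] linear_vec_swap_cnj]
      sq_integrable_linear[OF dirac_repD(1)[OF Q d] linear_vec_swap_cnj]
      sq_integrable_linear[OF dirac_repD(2)[OF Q d] linear_vec_swap_cnj]
    by (simp add: dirac_rep_iff_local_primitive[OF L1_loc_swap_transpose[OF L1_loc_mat_adjoint[OF Q]]])
qed

text \<open>The conjugation carries solutions for \<open>Q*\<close> to solutions for \<open>S Q^T S\<close>; the correspondence is onto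
because it is an involution.\<close>

lemma swap_conj_D_max:
  assumes Q: "L1_loc Q"
  shows "{(u, swap_conj v) | u v. (swap_conj u, v) \<in> D_max (\<lambda>x. mat_adjoint (Q x))} = D_max (\<lambda>x. swap_transpose (Q x))"
proof -
  have inv: "swap_conj (swap_conj u) = u" for u :: "('a + 'a) L2"
    using is_conjugation_swap_conj by (auto simp: is_conjugation_def)
  have gen: "(swap_conj u, swap_conj v) \<in> D_max (\<lambda>x. swap_transpose (mat_adjoint (R x)))"
    if R: "L1_loc R" and uv: "(u, v) \<in> D_max R" for u v and R :: "real \<Rightarrow> complex ^ ('a + 'a) ^ ('a + 'a)"
  proof -
    obtain y z where yz: "u = abs_L2 y" "v = abs_L2 z" "dirac_rep R y z" using uv unfolding D_max_def by blast
    show ?thesis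
      unfolding yz(1,2) swap_conj_abs[OF dirac_repD(1)[OF R yz(3)]] swap_conj_abs[OF dirac_repD(2)[OF R yz(3)]]
      by (rule abs_L2_in_D_max[OF dirac_rep_vec_swap_cnj[OF R yz(3)]])
  qed
  show ?thesis
  proof (intro set_eqI iffI)
    fix p assume "p \<in> {(u, swap_conj v) | u v. (swap_conj u, v) \<in> D_max (\<lambda>x. mat_adjoint (Q x))}"
    then obtain u v where p: "p = (u, swap_conj v)" and uv: "(swap_conj u, v) \<in> D_max (\<lambda>x. mat_adjoint (Q x))" by blast
    from gen[OF L1_loc_mat_adjoint[OF Q] uv] show "p \<in> D_max (\<lambda>x. swap_transpose (Q x))" by (simp add: p inv)
  next
    fix p assume p: "p \<in> D_max (\<lambda>x. swap_transpose (Q x))"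
    then have "(fst p, snd p) \<in> D_max (\<lambda>x. swap_transpose (Q x))" by simp
    from gen[OF L1_loc_swap_transpose[OF Q] this]
    have "(swap_conj (fst p), swap_conj (snd p)) \<in> D_max (\<lambda>x. mat_adjoint (Q x))"
      by (simp add: mat_adjoint_swap_transpose)
    moreover have "p = (fst p, swap_conj (swap_conj (snd p)))" by (simp add: inv)
    ultimately show "p \<in> {(u, swap_conj v) | u v. (swap_conj u, v) \<in> D_max (\<lambda>x. mat_adjoint (Q x))}" by blast
  qed
qed

theorem j_selfadjoint_D_min_iff:
  fixes Q :: "real \<Rightarrow> complex ^ ('p::finite + 'p) ^ ('p + 'p)"
  assumes Q: "L1_loc Q"
  shows "j_selfadjoint swap_conj (D_min Q) \<longleftrightarrow> D_max Q = D_max (\<lambda>x. swap_transpose (Q x))"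
proof -
  have "is_operator (D_min Q)" using is_operator_D_max[OF Q] by (simp add: D_min_eq_D_max[OF Q])
  moreover have "closure (Domain (D_cpt Q)) \<subseteq> closure (Domain (D_min Q))"
    unfolding D_min_eq_closure by (intro closure_mono Domain_mono closure_subset)
  then have "densely_defined (D_min Q)" unfolding densely_defined_def Domain_D_cpt_dense[OF Q] by blast
  moreover have "op_adjoint (D_min Q) = D_max (\<lambda>x. mat_adjoint (Q x))"
    by (simp add: D_min_eq_closure op_adjoint_closure op_adjoint_D_cpt[OF Q])
  ultimately show ?thesis
    by (simp add: j_selfadjoint_def is_conjugation_swap_conj swap_conj_D_max[OF Q] D_min_eq_D_max[OF Q])
qed

lemma D_max_cong_AE:
  assumes "AE x in lebesgue. Q x = R x" shows "D_max Q = D_max R"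
proof -
  have "(AE x in lebesgue. \<exists>y'. (y has_vector_derivative y') (at x) \<and> z x = J_mat *v y' + Q x *v y x) \<longleftrightarrow>
      (AE x in lebesgue. \<exists>y'. (y has_vector_derivative y') (at x) \<and> z x = J_mat *v y' + R x *v y x)" for y z
  proof
    assume "AE x in lebesgue. \<exists>y'. (y has_vector_derivative y') (at x) \<and> z x = J_mat *v y' + Q x *v y x"
    then show "AE x in lebesgue. \<exists>y'. (y has_vector_derivative y') (at x) \<and> z x = J_mat *v y' + R x *v y x"
      using assms by eventually_elim simp
  next
    assume "AE x in lebesgue. \<exists>y'. (y has_vector_derivative y') (at x) \<and> z x = J_mat *v y' + R x *v y x"
    then show "AE x in lebesgue. \<exists>y'. (y has_vector_derivative y') (at x) \<and> z x = J_mat *v y' + Q x *v y x"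
      using assms by eventually_elim simp
  qed
  then show ?thesis unfolding D_max_def dirac_rep_def by simp
qed


section \<open>Recovering the potential from the operator\<close>

text \<open>Local square-integrability of \<open>Q\<close> is what places a cutoff times a constant vector in the domain. Both
operators then give it the same image, and the derivative term is common to both.\<close>

lemma D_max_subset_imp_eq_AE:
  fixes Q R :: "real \<Rightarrow> complex ^ ('p::finite + 'p) ^ ('p + 'p)"
  assumes Q: "L1_loc Q" and R: "L1_loc R" and Q2: "L2_loc Q" and sub: "D_max Q \<subseteq> D_max R"
  shows "AE x in lebesgue. Q x = R x"
proof -
  have *: "AE x in lebesgue. cutoff k x *\<^sub>R (Q x *v e) = cutoff k x *\<^sub>R (R x *v e)" for k e
  proof -
    let ?y = "\<lambda>x. cutoff k x *\<^sub>R e"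
    let ?z = "\<lambda>x. cutoff_deriv k x *\<^sub>R (J_mat *v e) + Q x *v ?y x"
    have y: "local_primitive ?y (\<lambda>x. cutoff_deriv k x *\<^sub>R e)"
      using local_primitive_cutoff by (rule local_primitive_linear) (simp add: linear_iff algebra_simps)
    have supp: "?y x = 0" "cutoff_deriv k x *\<^sub>R (J_mat *v e) = 0" if "x \<notin> {- (real k + 1)..real k + 1}" for x
      using cutoff_eq_0[OF that] cutoff_deriv_eq_0[OF that] by auto
    have ysq: "sq_integrable ?y"
      by (rule sq_integrable_continuous_compact_support[OF local_primitive_continuous[OF y] supp(1)])
    have dc: "continuous_on UNIV (\<lambda>x. cutoff_deriv k x *\<^sub>R (J_mat *v e))"
      unfolding cutoff_deriv_def by (intro continuous_intros) auto
    have Qy: "sq_integrable (\<lambda>x. Q x *v ?y x)"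
    proof -
      obtain K where K: "K > 0" "\<And>(A :: complex ^ ('p + 'p) ^ ('p + 'p)) v :: complex ^ ('p + 'p). norm (A *v v) \<le> norm A * norm v * K"
        using matrix_vector.pos_bounded by blast
      let ?I = "{- (real k + 1)..real k + 1}"
      show ?thesis
      proof (rule sq_integrable_bounded)
        show "(\<lambda>x. Q x *v ?y x) \<in> borel_measurable lebesgue"
          by (rule borel_measurable_matrix_vector_mult[OF L1_loc_borel_measurable[OF Q] sq_integrable_measurable[OF ysq]])
        have "set_integrable lebesgue ?I (\<lambda>x. (norm (Q x))\<^sup>2)" using Q2 unfolding L2_loc_def by blast
        then have "integrable lebesgue (\<lambda>x. (norm e * K)\<^sup>2 * (indicat_real ?I x *\<^sub>R (norm (Q x))\<^sup>2))"
          unfolding set_integrable_def by (rule integrable_mult_right)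
        moreover have "(\<lambda>x. (norm e * K)\<^sup>2 * (indicat_real ?I x *\<^sub>R (norm (Q x))\<^sup>2)) = (\<lambda>x. (indicat_real ?I x * norm (Q x) * norm e * K)\<^sup>2)"
          by (auto simp: fun_eq_iff indicator_def power_mult_distrib)
        ultimately show "integrable lebesgue (\<lambda>x. (indicat_real ?I x * norm (Q x) * norm e * K)\<^sup>2)" by (simp only:)
        show "AE x in lebesgue. norm (Q x *v ?y x) \<le> indicat_real ?I x * norm (Q x) * norm e * K"
        proof (rule AE_I2)
          fix x
          show "norm (Q x *v ?y x) \<le> indicat_real ?I x * norm (Q x) * norm e * K"
          proof (cases "x \<in> ?I")
            case True
            have "norm (Q x *v ?y x) \<le> norm (Q x) * norm (?y x) * K" by (rule K)
            also have "norm (?y x) \<le> 1 * norm e"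
              unfolding norm_scaleR using cutoff_bounds[of k x] by (intro mult_right_mono) auto
            finally show ?thesis using True K(1) by (simp add: mult_right_mono mult_left_mono)
          next
            case False
            then show ?thesis using cutoff_eq_0[OF False] by simp
          qed
        qed
      qed
    qed
    have zsq: "sq_integrable ?z"
      by (rule sq_integrable_add[OF sq_integrable_continuous_compact_support[OF dc supp(2)] Qy])
    have d: "dirac_rep Q ?y ?z"
      unfolding dirac_rep_iff_local_primitive[OF Q]
      using ysq zsq y by (simp add: matrix_vector.minus_right matrix_vector.scaleR_right)
    then have "(abs_L2 ?y, abs_L2 ?z) \<in> D_max R" using sub abs_L2_in_D_max by blast
    then obtain y2 z2 where yz2: "abs_L2 ?y = abs_L2 y2" "abs_L2 ?z = abs_L2 z2" "dirac_rep R y2 z2"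
      unfolding D_max_def by blast
    note D2 = dirac_repD[OF R yz2(3)]
    have "AE x in lebesgue. ?y x = y2 x" using yz2(1) abs_L2_eq_iff[OF ysq D2(1)] by simp
    then have yeq: "?y = y2" by (rule continuous_AE_eq_imp_eq[OF local_primitive_continuous[OF y] D2(4)])
    have zeq: "AE x in lebesgue. ?z x = z2 x" using yz2(2) abs_L2_eq_iff[OF zsq D2(2)] by simp
    have "AE x in lebesgue. J_mat *v (Q x *v ?y x - ?z x) = J_mat *v (R x *v ?y x - z2 x)"
      by (rule local_primitive_unique_AE[OF dirac_repD(3)[OF Q d] D2(3)[folded yeq]])
    then show ?thesis using zeq
    proof eventually_elim
      case (elim x)
      then have "J_mat *v (J_mat *v (Q x *v ?y x - z2 x)) = J_mat *v (J_mat *v (R x *v ?y x - z2 x))" by simp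
      then show ?case by (simp add: matrix_vector.scaleR_right)
    qed
  qed
  have "AE x in lebesgue. \<forall>i. \<forall>k. cutoff k x *\<^sub>R (Q x *v axis i 1) = cutoff k x *\<^sub>R (R x *v axis i 1)"
    by (rule eventually_all_finite, subst AE_all_countable, intro allI *)
  then show ?thesis
  proof eventually_elim
    case (elim x)
    obtain k :: nat where "\<bar>x\<bar> < real k" using reals_Archimedean2 by blast
    then have "cutoff k x > 0" by (intro cutoff_pos) simp
    then have "Q x *v axis i 1 = R x *v axis i 1" for i using elim by auto
    then have "(Q x *v axis i 1) $ j = (R x *v axis i 1) $ j" for i j by simp
    then show ?case
      by (simp add: vec_eq_iff matrix_vector_mult_def axis_def if_distrib cong: if_cong)
  qed
qed

theorem theorem3p2:
  fixes Q :: "real \<Rightarrow> complex ^ ('p::finite + 'p) ^ ('p + 'p)"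
    and Q11 Q12 Q21 Q22 :: "real \<Rightarrow> complex ^ 'p ^ 'p"
  assumes blocks: "\<And>x. Q x = block_mat (Q11 x) (Q12 x) (Q21 x) (Q22 x)"
    and loc: "L1_loc Q"
  shows "((AE x in lebesgue. transpose (Q11 x) = Q22 x \<and>
              transpose (Q12 x) = Q12 x \<and> transpose (Q21 x) = Q21 x) \<longrightarrow>
            j_selfadjoint swap_conj (D_min Q) \<and> D_min Q = D_max Q) \<and>
         (L2_loc Q \<and> j_selfadjoint swap_conj (D_min Q) \<longrightarrow>
            (AE x in lebesgue. transpose (Q11 x) = Q22 x \<and>
              transpose (Q12 x) = Q12 x \<and> transpose (Q21 x) = Q21 x))"
proof -
  have sym: "transpose (Q11 x) = Q22 x \<and> transpose (Q12 x) = Q12 x \<and> transpose (Q21 x) = Q21 x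
      \<longleftrightarrow> Q x = swap_transpose (Q x)" for x
    using swap_transpose_block_mat_eq_iff unfolding blocks by metis
  show ?thesis
    unfolding sym j_selfadjoint_D_min_iff[OF loc]
    using D_min_eq_D_max[OF loc] D_max_cong_AE[of Q "\<lambda>x. swap_transpose (Q x)"]
      D_max_subset_imp_eq_AE[OF loc L1_loc_swap_transpose[OF loc]] by blast
qed

end
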